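(* Let $C'$ be a cut of $Q(C)$ and $u:=u(C')\in P\cap N$ its type. (1) If $u\in\operatorname{Int}(P)$, then the degree $0$ part of the quiver $Q(C)$ (the subquiver with all vertices and the arrows not in $C'$) is acyclic. In particular, the algebra $A(B,C,C')$ is finite dimensional. (2) If $u\notin\operatorname{Int}(P)$, then the algebra $A(B,C,C')$ is infinite dimensional.
   Context: $k$ is an arbitrary field. Polytope and group $H$. Let $N\cong\mathbb Z^d$, $M=\operatorname{Hom}_{\mathbb Z}(N,\mathbb Z)$, and let $P\subset N_{\mathbb R}$ be a $d$-dimensional simplicial lattice polytope with exactly $d+2$ vertices. Let $F$ be the free abelian group on the vertices, $\mathbf p\in F$ the sum of all basis elements, $F_{\ge0}$ the set of elements with nonnegative coordinates, $A_P\colon M\to F$ the map sending $m$ to the vector whose coordinate at a vertex $v$ is $\langle m,v\rangle$, and $H=F/(A_P(M)+\mathbb Z\mathbf p)$, a group of rank one, with projection $\deg_H\colon F\to H$ and $\pi\colon H\to H/H_{\rm tors}\cong\mathbb Z$. The vertices can be labelled $v_0,\dots,v_l,v'_0,\dots,v'_{l'}$ with $l,l'\ge1$, $l+l'=d$, with basis elements $e_i,e'_{i'}$ of $F$ and images $\bar x_i=\deg_H(e_i)$, $\bar x'_{i'}=\deg_H(e'_{i'})$, such that $\pi(\bar x_i)>0$ and $\pi(\bar x'_{i'})<0$. Order $H$ by $h_1\ge h_2$ iff $h_1-h_2\in\sum_i\mathbb Z_{\ge0}\bar x_i+\sum_{i'}\mathbb Z_{\ge0}(-\bar x'_{i'})$,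 and put $s=\sum_i\bar x_i=-\sum_{i'}\bar x'_{i'}$. Fix a non-trivial upper set $I\subset H$ (closed under going up, $\ne\emptyset,H$) and put $J=J(I)=I\cap(I^c+s)$; it is a complete set of representatives of $H/\mathbb Zs$. Quiver $Q(C)$. Let $L=\{v\in\mathbb Z^{l+1}\mid\sum v_i=0\}$ with elements $\alpha_i=f_i-f_{i-1}$ ($1\le i\le l$), $\alpha_0=f_0-f_l$ ($f_i$ unit vectors), and define $L'\subset\mathbb Z^{l'+1}$ and $\alpha'_{i'}$ similarly. Let $\Psi\colon L\oplus L'\to H/\mathbb Zs$ be the surjection $\alpha_i\mapsto\bar x_i$, $\alpha'_{i'}\mapsto\bar x'_{i'}$ and $B=\ker\Psi$. Let $\widehat Q$ be the quiver with vertex set $L\oplus L'$ and arrows $x\to x+\alpha_i$, $x\to x+\alpha'_{i'}$ for all $x,i,i'$. For $x\in L\oplus L'$ let $h_x\in J$ be the representative of $\Psi(x)$. Let $\widehat C$ be the set of arrows $x\to x+\alpha_i$ with $h_x+\bar x_i\notin J$ and arrows $x\to x+\alpha'_{i'}$ with $h_x+\bar x'_{i'}\notin J$. The quiver $\widehat Q(\widehat C)$ has vertex set $L\oplus L'$ and arrows $\widehat Q_1\setminus\widehat C$ together with one new arrow $x\to x+\alpha_i+\alpha'_{i'}$ for every $x,i,i'$ such that both $x\to x+\alpha_i$ and $x\to x+\alpha'_{i'}$ lie in $\widehat C$. $B$ acts by translation; put $Q(C)=\widehat Q(\widehat C)/B$ and $C=C(I)=\widehat C/B$. Vertices of $Q(C)$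 are identified with $(L\oplus L')/B\cong H/\mathbb Zs\cong J$. Cuts of $Q(C)$. Arrows of $Q(C)$ have labels in $F$: $\lambda(x\to x+\alpha_i)=e_i$, $\lambda(x\to x+\alpha'_{i'})=e'_{i'}$, $\lambda(x\to x+\alpha_i+\alpha'_{i'})=e_i+e'_{i'}$; $\lambda(\gamma)$ of a path $\gamma$ is the sum of labels of its arrows. An elementary cycle is a cycle $c$ with $\lambda(c)=\mathbf p$. For $C'\subset Q(C)_1$ let $\varepsilon_{C'}(\gamma)$ be the number of arrows of $\gamma$ (with multiplicity) lying in $C'$. $C'$ is a cut of $Q(C)$ if (i) every elementary cycle has exactly one arrow in $C'$, and (ii) $\varepsilon_{C'}(\gamma)=\varepsilon_{C'}(\gamma')$ for paths $\gamma,\gamma'$ with the same source, the same target and $\lambda(\gamma)=\lambda(\gamma')$. Type: for a cut $C'$ and $b\in B$ choose $x\in L\oplus L'$ and a path $\gamma\colon x\to x+b$ in $\widehat Q(\widehat C)$ and put $\kappa_{C'}(b)=\lambda(\gamma)-\varepsilon_{C'}(\gamma)\mathbf p\in F$ (computed on the image of $\gamma$ in $Q(C)$); this is well defined, gives a homomorphism $\kappa_{C'}\colon B\to F$, and there is a unique $u(C')\in N$ with $\operatorname{Im}\kappa_{C'}=\{A_P(m)-\langle m,u(C')\rangle\mathbf p\mid m\in M\}$. One has $u(C')\in P\cap N$; $u(C')$ is the type of $C'$. Algebras. $\Gamma(B,C)=kQ(C)/I(C)$, where $I(C)$ is generated by all $\gamma-\gamma'$ with $\gamma,\gamma'$ paths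 of positive length with the same source, same target and $\lambda(\gamma)=\lambda(\gamma')$. A cut $C'$ defines a $\mathbb Z_{\ge0}$-grading on $Q(C)$ and on $\Gamma(B,C)$ by $|\gamma|=\varepsilon_{C'}(\gamma)$, and $A(B,C,C')=\Gamma(B,C)_0$ is the degree $0$ part. *)

theory Defs
  imports
    "HOL-Analysis.Analysis"
    "HOL-Algebra.Free_Abelian_Groups"
    "HOL-Algebra.QuotRing"
    "HOL-Algebra.Embedded_Algebras"
    "Graph_Theory.Arc_Walk"
begin

section \<open>Path algebras of quivers\<close>

text \<open>
  A quiver is a \<open>pre_digraph\<close> satisfying \<open>wf_digraph\<close>. A path is a pair of its
  source and its list of arrows, so that the trivial path at a vertex \<open>x\<close> is \<open>(x, [])\<close>.
  Paths are composed from left to right.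
\<close>

definition paths :: "('v, 'a) pre_digraph \<Rightarrow> ('v \<times> 'a list) set" where
  "paths Q = {(x, p). \<exists>y. pre_digraph.awalk Q x p y}"

definition path_mult ::
  "('v, 'a) pre_digraph \<Rightarrow> (('v \<times> 'a list) \<Rightarrow>\<^sub>0 'k) \<Rightarrow> (('v \<times> 'a list) \<Rightarrow>\<^sub>0 'k) \<Rightarrow> (('v \<times> 'a list) \<Rightarrow>\<^sub>0 'k::field)" where
  "path_mult Q f g = (\<Sum>(x, p)\<in>Poly_Mapping.keys f. \<Sum>(y, q)\<in>Poly_Mapping.keys g.
     if pre_digraph.awlast Q x p = y
     then Poly_Mapping.single (x, p @ q) (Poly_Mapping.lookup f (x, p) * Poly_Mapping.lookup g (y, q))
     else 0)"

definition acyclic_quiver :: "('v, 'a) pre_digraph \<Rightarrow> bool" where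
  "acyclic_quiver Q \<longleftrightarrow> \<not> (\<exists>x p. pre_digraph.awalk Q x p x \<and> p \<noteq> [])"

text \<open>The identity below is meaningful because only quivers with finitely many vertices are used.\<close>

definition path_algebra ::
  "'k::field itself \<Rightarrow> ('v, 'a) pre_digraph \<Rightarrow> (('v \<times> 'a list) \<Rightarrow>\<^sub>0 'k) ring" where
  "path_algebra k Q =
     \<lparr>carrier = {f. Poly_Mapping.keys f \<subseteq> paths Q}, mult = path_mult Q,
      one = (\<Sum>x\<in>verts Q. Poly_Mapping.single (x, []) 1), zero = 0, add = (+)\<rparr>"


section \<open>Lattice polytopes and the group \<open>H\<close>\<close>

definition real_vec :: "int ^ 'n \<Rightarrow> real ^ 'n" where
  "real_vec w = (\<chi> i. real_of_int (w $ i))"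

text \<open>Here \<open>N = int ^ 'n\<close> and \<open>d = CARD('n)\<close>.\<close>

locale simplicial_lattice_polytope =
  fixes P :: "(real ^ 'n) set"
  assumes polytope: "polytope P"
    and lattice: "\<And>x. x extreme_point_of P \<Longrightarrow> x \<in> range real_vec"
    and full_dimensional: "aff_dim P = int CARD('n)"
    and simplicial: "\<And>S. S facet_of P \<Longrightarrow> \<exists>r. r simplex S"
    and card_vertices: "card {x. x extreme_point_of P} = CARD('n) + 2"
begin

definition V :: "(int ^ 'n) set" where
  "V = {w. real_vec w extreme_point_of P}"

definition M :: "(int ^ 'n \<Rightarrow> int) set" where
  "M = {m. Modules.additive m}"

definition F :: "(int ^ 'n \<Rightarrow>\<^sub>0 int) monoid" where
  "F = free_Abelian_group V"

definition pF :: "int ^ 'n \<Rightarrow>\<^sub>0 int" where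
  "pF = (\<Sum>w\<in>V. frag_of w)"

definition A_P :: "(int ^ 'n \<Rightarrow> int) \<Rightarrow> (int ^ 'n \<Rightarrow>\<^sub>0 int)" where
  "A_P m = (\<Sum>w\<in>V. frag_cmul (m w) (frag_of w))"

definition relH :: "(int ^ 'n \<Rightarrow>\<^sub>0 int) set" where
  "relH = {A_P m + frag_cmul z pF | m z. m \<in> M}"

definition H :: "(int ^ 'n \<Rightarrow>\<^sub>0 int) set monoid" where
  "H = F Mod relH"

definition deg :: "(int ^ 'n \<Rightarrow>\<^sub>0 int) \<Rightarrow> (int ^ 'n \<Rightarrow>\<^sub>0 int) set" where
  "deg f = relH #>\<^bsub>F\<^esub> f"

end


section \<open>The quiver \<open>Q(C)\<close>\<close>

text \<open>
  The lattice \<open>L\<close> inside \<open>\<int>^(l+1)\<close>, the latter being the free abelian group on \<open>{..l}\<close>.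
\<close>

definition root_lattice :: "nat \<Rightarrow> (nat \<Rightarrow>\<^sub>0 int) set" where
  "root_lattice l = {x. Poly_Mapping.keys x \<subseteq> {..l} \<and> (\<Sum>i\<le>l. Poly_Mapping.lookup x i) = 0}"

definition root :: "nat \<Rightarrow> nat \<Rightarrow> (nat \<Rightarrow>\<^sub>0 int)" where
  "root l i = (if i = 0 then frag_of 0 - frag_of l else frag_of i - frag_of (i - 1))"

text \<open>
  Arrows of the covering quiver are pairs of a source and a type:
  \<open>Fst i\<close> is \<open>x \<rightarrow> x + \<alpha>\<^sub>i\<close>, \<open>Snd j\<close> is \<open>x \<rightarrow> x + \<alpha>'\<^sub>j\<close>, and
  \<open>Diag i j\<close> is the new arrow \<open>x \<rightarrow> x + \<alpha>\<^sub>i + \<alpha>'\<^sub>j\<close>.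
\<close>

datatype arrow_type = Fst nat | Snd nat | Diag nat nat

type_synonym vertex = "(nat \<Rightarrow>\<^sub>0 int) \<times> (nat \<Rightarrow>\<^sub>0 int)"
type_synonym arrow = "vertex \<times> arrow_type"

locale labelled_polytope = simplicial_lattice_polytope P
  for P :: "(real ^ 'n) set" +
  fixes l l' :: nat
    and v v' :: "nat \<Rightarrow> int ^ 'n"
    and \<pi> :: "(int ^ 'n \<Rightarrow>\<^sub>0 int) set \<Rightarrow> int"
  assumes l_ge: "l \<ge> 1" and l'_ge: "l' \<ge> 1" and l_l': "l + l' = CARD('n)"
    and inj_v: "inj_on v {..l}" and inj_v': "inj_on v' {..l'}"
    and disjoint: "v ` {..l} \<inter> v' ` {..l'} = {}"
    and vertices: "V = v ` {..l} \<union> v' ` {..l'}"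
    \<comment> \<open>\<open>\<pi>\<close> is the projection onto \<open>H/H\<^sub>t\<^sub>o\<^sub>r\<^sub>s\<close> followed by some isomorphism with \<open>\<int>\<close>\<close>
    and proj_epi: "\<pi> \<in> epi H integer_group"
    and proj_kernel: "kernel H integer_group \<pi> =
      {h \<in> carrier H. \<exists>r::nat. r > 0 \<and> h [^]\<^bsub>H\<^esub> r = \<one>\<^bsub>H\<^esub>}"
    and proj_pos: "\<And>i. i \<le> l \<Longrightarrow> \<pi> (deg (frag_of (v i))) > 0"
    and proj_neg: "\<And>j. j \<le> l' \<Longrightarrow> \<pi> (deg (frag_of (v' j))) < 0"
begin

definition e :: "nat \<Rightarrow> (int ^ 'n \<Rightarrow>\<^sub>0 int)" where "e i = frag_of (v i)"
definition e' :: "nat \<Rightarrow> (int ^ 'n \<Rightarrow>\<^sub>0 int)" where "e' j = frag_of (v' j)"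

definition geH :: "(int ^ 'n \<Rightarrow>\<^sub>0 int) set \<Rightarrow> (int ^ 'n \<Rightarrow>\<^sub>0 int) set \<Rightarrow> bool" where
  "geH h1 h2 \<longleftrightarrow> h1 \<otimes>\<^bsub>H\<^esub> inv\<^bsub>H\<^esub> h2 \<in>
     {deg ((\<Sum>i\<le>l. frag_cmul (int (a i)) (e i)) + (\<Sum>j\<le>l'. frag_cmul (int (b j)) (- e' j))) | a b. True}"

definition s :: "(int ^ 'n \<Rightarrow>\<^sub>0 int) set" where
  "s = deg (\<Sum>i\<le>l. e i)"

definition HZs :: "(int ^ 'n \<Rightarrow>\<^sub>0 int) set set monoid" where
  "HZs = H Mod generate H {s}"

definition LL :: "vertex set" where
  "LL = root_lattice l \<times> root_lattice l'"

text \<open>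
  \<open>Psi\<close> sends \<open>\<Sum>\<^sub>i c\<^sub>i \<alpha>\<^sub>i + \<Sum>\<^sub>j c'\<^sub>j \<alpha>'\<^sub>j\<close> to the class of
  \<open>\<Sum>\<^sub>i c\<^sub>i x\<^sub>i + \<Sum>\<^sub>j c'\<^sub>j x'\<^sub>j\<close> modulo \<open>\<int>s\<close>, where \<open>x\<^sub>i = deg (e i)\<close>, \<open>x'\<^sub>j = deg (e' j)\<close>.
  Two expressions of an element in terms of the roots differ by adding constants to
  \<open>c\<close> and to \<open>c'\<close>, which changes the sum by an arbitrary multiple of \<open>s\<close>; so the set of values
  obtained from all expressions is a full coset of \<open>\<int>s\<close>.
\<close>

definition Psi :: "vertex \<Rightarrow> (int ^ 'n \<Rightarrow>\<^sub>0 int) set set" where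
  "Psi x = {deg ((\<Sum>i\<le>l. frag_cmul (c i) (e i)) + (\<Sum>j\<le>l'. frag_cmul (c' j) (e' j))) | c c'.
     x = (\<Sum>i\<le>l. frag_cmul (c i) (root l i), \<Sum>j\<le>l'. frag_cmul (c' j) (root l' j))}"

definition B :: "vertex set" where
  "B = {x \<in> LL. Psi x = \<one>\<^bsub>HZs\<^esub>}"

fun shift :: "arrow_type \<Rightarrow> vertex" where
  "shift (Fst i) = (root l i, 0)"
| "shift (Snd j) = (0, root l' j)"
| "shift (Diag i j) = (root l i, root l' j)"

fun type_label :: "arrow_type \<Rightarrow> (int ^ 'n \<Rightarrow>\<^sub>0 int)" where
  "type_label (Fst i) = e i"
| "type_label (Snd j) = e' j"
| "type_label (Diag i j) = e i + e' j"

definition Qhat :: "(vertex, arrow) pre_digraph" where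
  "Qhat = \<lparr>verts = LL, arcs = LL \<times> (Fst ` {..l} \<union> Snd ` {..l'}),
           tail = fst, head = (\<lambda>(x, t). x + shift t)\<rparr>"

definition vertex_orbit :: "vertex \<Rightarrow> vertex set" where
  "vertex_orbit x = (\<lambda>b. x + b) ` B"

definition arrow_orbit :: "arrow \<Rightarrow> arrow set" where
  "arrow_orbit a = (\<lambda>b. (fst a + b, snd a)) ` B"

definition label :: "arrow set \<Rightarrow> (int ^ 'n \<Rightarrow>\<^sub>0 int)" where
  "label a = the_elem ((\<lambda>a. type_label (snd a)) ` a)"

definition path_label :: "arrow set list \<Rightarrow> (int ^ 'n \<Rightarrow>\<^sub>0 int)" where
  "path_label p = sum_list (map label p)"

end

locale upper_set = labelled_polytope P l l' v v' \<pi>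
  for P :: "(real ^ 'n) set" and l l' :: nat and v v' :: "nat \<Rightarrow> int ^ 'n"
    and \<pi> :: "(int ^ 'n \<Rightarrow>\<^sub>0 int) set \<Rightarrow> int" +
  fixes I :: "(int ^ 'n \<Rightarrow>\<^sub>0 int) set set"
  assumes I_subset: "I \<subseteq> carrier H"
    and I_upper: "\<And>h1 h2. h1 \<in> carrier H \<Longrightarrow> h2 \<in> I \<Longrightarrow> geH h1 h2 \<Longrightarrow> h1 \<in> I"
    and I_nonempty: "I \<noteq> {}"
    and I_proper: "I \<noteq> carrier H"
begin

definition J :: "(int ^ 'n \<Rightarrow>\<^sub>0 int) set set" where
  "J = I \<inter> ((carrier H - I) #>\<^bsub>H\<^esub> s)"

definition rep :: "vertex \<Rightarrow> (int ^ 'n \<Rightarrow>\<^sub>0 int) set" where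
  "rep x = (THE h. h \<in> J \<and> h \<in> Psi x)"

definition Chat :: "arrow set" where
  "Chat = {(x, t) \<in> arcs Qhat. rep x \<otimes>\<^bsub>H\<^esub> deg (type_label t) \<notin> J}"

definition QhatC :: "(vertex, arrow) pre_digraph" where
  "QhatC = Qhat\<lparr>arcs := (arcs Qhat - Chat) \<union>
     {(x, Diag i j) | x i j. (x, Fst i) \<in> Chat \<and> (x, Snd j) \<in> Chat}\<rparr>"

definition Q :: "(vertex set, arrow set) pre_digraph" where
  "Q = \<lparr>verts = vertex_orbit ` verts QhatC, arcs = arrow_orbit ` arcs QhatC,
        tail = (\<lambda>a. tail QhatC ` a), head = (\<lambda>a. head QhatC ` a)\<rparr>"

definition eps :: "arrow set set \<Rightarrow> arrow set list \<Rightarrow> nat" where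
  "eps C' p = length (filter (\<lambda>a. a \<in> C') p)"

definition elementary_cycle :: "arrow set list \<Rightarrow> bool" where
  "elementary_cycle c \<longleftrightarrow> (\<exists>x. pre_digraph.awalk Q x c x) \<and> path_label c = pF"

definition is_cut :: "arrow set set \<Rightarrow> bool" where
  "is_cut C' \<longleftrightarrow> C' \<subseteq> arcs Q \<and>
     (\<forall>c. elementary_cycle c \<longrightarrow> eps C' c = 1) \<and>
     (\<forall>x y p q. pre_digraph.awalk Q x p y \<and> pre_digraph.awalk Q x q y \<and>
        path_label p = path_label q \<longrightarrow> eps C' p = eps C' q)"

definition kappa :: "arrow set set \<Rightarrow> vertex \<Rightarrow> (int ^ 'n \<Rightarrow>\<^sub>0 int)" where
  "kappa C' b = (THE f. \<exists>x p. x \<in> LL \<and> pre_digraph.awalk QhatC x p (x + b) \<and>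
     f = path_label (map arrow_orbit p) - frag_cmul (int (eps C' (map arrow_orbit p))) pF)"

definition cut_type :: "arrow set set \<Rightarrow> int ^ 'n" where
  "cut_type C' = (THE u. kappa C' ` B = {A_P m - frag_cmul (m u) pF | m. m \<in> M})"

definition degree_zero_quiver :: "arrow set set \<Rightarrow> (vertex set, arrow set) pre_digraph" where
  "degree_zero_quiver C' = Q\<lparr>arcs := arcs Q - C'\<rparr>"


subsection \<open>The algebras \<open>\<Gamma>(B, C)\<close> and \<open>A(B, C, C')\<close>\<close>

definition relations :: "'k::field itself \<Rightarrow> ((vertex set \<times> arrow set list) \<Rightarrow>\<^sub>0 'k) set" where
  "relations k = {Poly_Mapping.single (x, p) 1 - Poly_Mapping.single (x, q) 1 | x y p q.
     pre_digraph.awalk Q x p y \<and> pre_digraph.awalk Q x q y \<and>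
     p \<noteq> [] \<and> q \<noteq> [] \<and> path_label p = path_label q}"

definition rel_ideal :: "'k::field itself \<Rightarrow> ((vertex set \<times> arrow set list) \<Rightarrow>\<^sub>0 'k) set" where
  "rel_ideal k = Idl\<^bsub>path_algebra k Q\<^esub> (relations k)"

definition Gamma :: "'k::field itself \<Rightarrow> ((vertex set \<times> arrow set list) \<Rightarrow>\<^sub>0 'k) set ring" where
  "Gamma k = path_algebra k Q Quot rel_ideal k"

text \<open>The canonical copy of the ground field \<open>k\<close> in \<open>\<Gamma>\<close>, i.e. the classes of the multiples of the identity.\<close>

definition scalars :: "'k::field itself \<Rightarrow> ((vertex set \<times> arrow set list) \<Rightarrow>\<^sub>0 'k) set set" where
  "scalars k = {rel_ideal k +>\<^bsub>path_algebra k Q\<^esub> (\<Sum>x\<in>verts Q. Poly_Mapping.single (x, []) c) | c. True}"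

definition A :: "'k::field itself \<Rightarrow> arrow set set \<Rightarrow> ((vertex set \<times> arrow set list) \<Rightarrow>\<^sub>0 'k) set set" where
  "A k C' = {rel_ideal k +>\<^bsub>path_algebra k Q\<^esub> f | f. f \<in> carrier (path_algebra k Q) \<and>
     (\<forall>(x, p) \<in> Poly_Mapping.keys f. eps C' p = 0)}"

definition A_finite_dimensional :: "'k::field itself \<Rightarrow> arrow set set \<Rightarrow> bool" where
  "A_finite_dimensional k C' \<longleftrightarrow> ring.finite_dimension (Gamma k) (scalars k) (A k C')"

end

end

theory Submission
  imports Defs
begin

text \<open>
  Every arrow \<open>x \<rightarrow> y\<close> of \<open>QhatC\<close> with label \<open>f\<close> satisfies \<open>h\<^sub>y = h\<^sub>x + deg f\<close> for the representatives
  in \<open>J\<close>, and conversely a label vector \<open>f \<ge> 0\<close> with \<open>h\<^sub>x + deg f \<in> J\<close> is the label of a path from \<open>x\<close>.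
  Hence the elements of \<open>{A\<^sub>P m - \<langle>m, u\<rangle> p | m}\<close> with nonnegative coordinates are exactly the labels of
  the cycles of degree \<open>0\<close> in the quotient quiver \<open>Q\<close>: a cycle of degree \<open>0\<close> lifts to a path \<open>x \<rightarrow> x + b\<close> whose label is
  \<open>\<kappa>(b)\<close>, and conversely a path with label \<open>\<kappa>(b)\<close> must have degree \<open>0\<close>. Nonnegativity
  means \<open>\<langle>m, v - u\<rangle> \<ge> 0\<close> for all vertices \<open>v\<close>, which forces \<open>m = 0\<close> if \<open>u\<close> is an interior point. Otherwise
  there is a supporting hyperplane at \<open>u\<close>, and an integral one by Dirichlet approximation; the powers
  of the resulting cycle have pairwise different labels, hence are linearly independent, since
  the relations of \<open>\<Gamma>\<close> identify only paths with the same ends and the same label.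
\<close>

section \<open>The path algebra is a ring\<close>

text \<open>A vertex \<open>x\<close> is handled through the label vectors \<open>f\<close> in
  \<open>F\<close> with \<open>disp f = x\<close>. These form a coset of the group spanned by
  \<open>sF\<close> and \<open>pF\<close>, and \<open>in_J f\<close> removes the freedom in
  \<open>sF\<close>; so the lifts of a vertex, and hence the labels of two paths of the cover with
  the same ends, differ only by a multiple of \<open>pF\<close>. Subtracting the degree times
  \<open>pF\<close> absorbs exactly this ambiguity, because elementary cycles have label
  \<open>pF\<close> and degree 1. This makes \<open>kappa\<close> well defined, with
  \<open>disp (kappa b) = b\<close>. A path with label \<open>kappa b\<close> therefore ends at the
  translate by \<open>b\<close>, and comparing its label with \<open>kappa b\<close> leaves degree
  times \<open>pF\<close> equal to 0. The diagonal arrows are needed for such a path to exist: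
  unprimed arrows leave \<open>J\<close> upwards, primed ones downwards, and the two together return
  to \<open>J\<close>. Linear independence is detected by functionals that add up the coefficients
  of all paths with given ends and label.\<close>

lemma (in pre_digraph) awlast_append: "awlast u (p @ q) = awlast (awlast u p) q"
  by (induct p arbitrary: u) auto

lemma sum_single_keys: "(\<Sum>a\<in>Poly_Mapping.keys f. Poly_Mapping.single a (Poly_Mapping.lookup f a)) = f"
  by (rule poly_mapping_eqI)
    (simp add: lookup_sum lookup_single when_def in_keys_iff)

text \<open>Reduces identities that are additive in \<open>f\<close> to multiples of basis vectors;
  the bilinear facts about \<open>path_mult\<close> below are checked on single paths in this
  way.\<close>

lemma poly_mapping_single_induct [consumes 1, case_names zero single add]:
  fixes f :: "'a \<Rightarrow>\<^sub>0 'b::comm_monoid_add"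
  assumes "Poly_Mapping.keys f \<subseteq> S"
    and "P 0"
    and "\<And>a c. a \<in> S \<Longrightarrow> P (Poly_Mapping.single a c)"
    and "\<And>f g. P f \<Longrightarrow> P g \<Longrightarrow> P (f + g)"
  shows "P f"
proof -
  have "P (\<Sum>a\<in>A. Poly_Mapping.single a (Poly_Mapping.lookup f a))" if "finite A" "A \<subseteq> S" for A
    using that by (induct A) (auto intro: assms)
  from this[of "Poly_Mapping.keys f"] show ?thesis
    using assms(1) by (simp add: sum_single_keys)
qed

definition path_prod ::
  "('v, 'a) pre_digraph \<Rightarrow> 'v \<times> 'a list \<Rightarrow> 'v \<times> 'a list \<Rightarrow> 'k \<Rightarrow> (('v \<times> 'a list) \<Rightarrow>\<^sub>0 'k::field)" where
  "path_prod Q a b c = (if pre_digraph.awlast Q (fst a) (snd a) = fst b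
     then Poly_Mapping.single (fst a, snd a @ snd b) c else 0)"

lemma path_prod_0 [simp]: "path_prod Q a b 0 = 0"
  by (simp add: path_prod_def)

lemma path_prod_add: "path_prod Q a b (c + d) = path_prod Q a b c + path_prod Q a b d"
  by (simp add: path_prod_def single_add)

text \<open>Supports can shrink under addition by cancellation. Over fixed finite supersets the
  additional summands are 0, so bilinearity becomes a termwise computation.\<close>

lemma path_mult_superset:
  assumes "finite S" "finite T" "Poly_Mapping.keys f \<subseteq> S" "Poly_Mapping.keys g \<subseteq> T"
  shows "path_mult Q f g =
    (\<Sum>a\<in>S. \<Sum>b\<in>T. path_prod Q a b (Poly_Mapping.lookup f a * Poly_Mapping.lookup g b))"
proof -
  have "path_mult Q f g = (\<Sum>a\<in>Poly_Mapping.keys f. \<Sum>b\<in>Poly_Mapping.keys g.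
      path_prod Q a b (Poly_Mapping.lookup f a * Poly_Mapping.lookup g b))"
    unfolding path_mult_def path_prod_def by (auto simp: split_beta intro!: sum.cong)
  also have "\<dots> = (\<Sum>a\<in>S. \<Sum>b\<in>Poly_Mapping.keys g.
      path_prod Q a b (Poly_Mapping.lookup f a * Poly_Mapping.lookup g b))"
    using assms by (intro sum.mono_neutral_left) (auto simp: in_keys_iff)
  also have "\<dots> = (\<Sum>a\<in>S. \<Sum>b\<in>T.
      path_prod Q a b (Poly_Mapping.lookup f a * Poly_Mapping.lookup g b))"
    using assms by (intro sum.cong refl sum.mono_neutral_left) (auto simp: in_keys_iff)
  finally show ?thesis .
qed

lemma path_mult_add_left: "path_mult Q (f + g) h = path_mult Q f h + path_mult Q g h"
proof -
  let ?S = "Poly_Mapping.keys f \<union> Poly_Mapping.keys g" and ?T = "Poly_Mapping.keys h"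
  have "Poly_Mapping.keys (f + g) \<subseteq> ?S" by (rule keys_add)
  then show ?thesis
    by (simp add: path_mult_superset[where S = ?S and T = ?T] lookup_add distrib_right
        path_prod_add sum.distrib)
qed

lemma path_mult_add_right: "path_mult Q f (g + h) = path_mult Q f g + path_mult Q f h"
proof -
  let ?S = "Poly_Mapping.keys f" and ?T = "Poly_Mapping.keys g \<union> Poly_Mapping.keys h"
  have "Poly_Mapping.keys (g + h) \<subseteq> ?T" by (rule keys_add)
  then show ?thesis
    by (simp add: path_mult_superset[where S = ?S and T = ?T] lookup_add distrib_left
        path_prod_add sum.distrib)
qed

lemma path_mult_zero [simp]: "path_mult Q 0 g = 0" "path_mult Q f 0 = 0"
  by (simp_all add: path_mult_def)

lemma path_mult_sum_left: "path_mult Q (\<Sum>x\<in>S. f x) g = (\<Sum>x\<in>S. path_mult Q (f x) g)"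
  by (induct S rule: infinite_finite_induct) (simp_all add: path_mult_add_left)

lemma path_mult_sum_right: "path_mult Q g (\<Sum>x\<in>S. f x) = (\<Sum>x\<in>S. path_mult Q g (f x))"
  by (induct S rule: infinite_finite_induct) (simp_all add: path_mult_add_right)

lemma path_mult_single:
  "path_mult Q (Poly_Mapping.single a c) (Poly_Mapping.single b d) = path_prod Q a b (c * d)"
  by (simp add: path_mult_superset[where S = "{a}" and T = "{b}"])

text \<open>By additivity in each factor only three paths matter; for these both sides are the
  concatenation, or 0 as soon as one pair of adjacent ends disagrees.\<close>

lemma path_mult_assoc: "path_mult Q (path_mult Q f g) h = path_mult Q f (path_mult Q g h)"
proof (induct f rule: poly_mapping_single_induct[OF subset_UNIV])
  case (2 a c)
  show ?case
  proof (induct g rule: poly_mapping_single_induct[OF subset_UNIV])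
    case (2 a' c')
    show ?case
    proof (induct h rule: poly_mapping_single_induct[OF subset_UNIV])
      case (2 a'' c'')
      show ?case
        by (auto simp: path_mult_single path_prod_def pre_digraph.awlast_append mult.assoc)
    qed (simp_all add: path_mult_add_left path_mult_add_right)
  qed (simp_all add: path_mult_add_left path_mult_add_right)
qed (simp_all add: path_mult_add_left path_mult_add_right)

text \<open>Dimension is measured over a subfield of a ring record, while the coefficients form a
  type class. With the coefficients as a record, the scalars of a quotient are the image of a field
  under a ring homomorphism.\<close>

definition field_of_type :: "'k::field itself \<Rightarrow> 'k ring" where
  "field_of_type k = \<lparr>carrier = UNIV, mult = (*), one = 1, zero = 0, add = (+)\<rparr>"

lemma field_field_of_type: "Ring.field (field_of_type k)"
proof -
  have "cring (field_of_type k)"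
  proof (rule cringI)
    show "abelian_group (field_of_type k)"
      by (rule abelian_groupI) (auto simp: field_of_type_def add_ac intro: exI[of _ "- x" for x])
    show "comm_monoid (field_of_type k)"
      by (rule comm_monoidI) (auto simp: field_of_type_def mult_ac)
  qed (simp add: field_of_type_def distrib_right)
  then show ?thesis
  proof (rule cring.cring_fieldI2)
    show "\<exists>b\<in>carrier (field_of_type k). a \<otimes>\<^bsub>field_of_type k\<^esub> b = \<one>\<^bsub>field_of_type k\<^esub>"
      if "a \<noteq> \<zero>\<^bsub>field_of_type k\<^esub>" for a
      using that by (intro bexI[of _ "inverse a"]) (auto simp: field_of_type_def)
  qed (auto simp: field_of_type_def)
qed

definition path_scalar :: "('v, 'a) pre_digraph \<Rightarrow> 'k::field \<Rightarrow> (('v \<times> 'a list) \<Rightarrow>\<^sub>0 'k)" where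
  "path_scalar Q c = (\<Sum>x\<in>verts Q. Poly_Mapping.single (x, []) c)"

lemma path_algebra_simps [simp]:
  "f \<in> carrier (path_algebra k Q) \<longleftrightarrow> Poly_Mapping.keys f \<subseteq> paths Q"
  "mult (path_algebra k Q) = path_mult Q"
  "one (path_algebra k Q) = path_scalar Q 1"
  "zero (path_algebra k Q) = 0"
  "add (path_algebra k Q) = (+)"
  by (simp_all add: path_algebra_def path_scalar_def)

context wf_digraph
begin

lemma path_mult_closed:
  assumes "Poly_Mapping.keys f \<subseteq> paths G" "Poly_Mapping.keys g \<subseteq> paths G"
  shows "Poly_Mapping.keys (path_mult G f g) \<subseteq> paths G"
  using assms(1)
proof (induct f rule: poly_mapping_single_induct)
  case (single a c)
  show ?case using assms(2)
  proof (induct g rule: poly_mapping_single_induct)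
    case (single b d)
    then show ?case using \<open>a \<in> paths G\<close>
      by (auto simp: path_mult_single path_prod_def paths_def)
  next
    case (add f g)
    then show ?case using keys_add[of "path_mult G (Poly_Mapping.single a c) f"]
      by (simp add: path_mult_add_right) blast
  qed auto
next
  case (add f h)
  then show ?case using keys_add[of "path_mult G f g"] by (simp add: path_mult_add_left) blast
qed auto

context
  assumes fin: "finite (verts G)"
begin

lemma path_scalar_closed: "Poly_Mapping.keys (path_scalar G c) \<subseteq> paths G"
  unfolding path_scalar_def
  by (rule order_trans[OF keys_sum]) (auto simp: paths_def awalk_Nil_iff)

text \<open>Only one trivial path composes with a given path on each side: the one at its source on
  the left, the one at its end on the right.\<close>

lemma path_scalar_mult_single:
  assumes "a \<in> paths G"
  shows "path_mult G (path_scalar G c) (Poly_Mapping.single a d) = Poly_Mapping.single a (c * d)"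
    and "path_mult G (Poly_Mapping.single a d) (path_scalar G c) = Poly_Mapping.single a (d * c)"
proof -
  obtain x p y where a: "a = (x, p)" "awalk x p y" using assms by (auto simp: paths_def)
  then have "x \<in> verts G" "y \<in> verts G" and y: "awlast x p = y" by auto
  then show "path_mult G (path_scalar G c) (Poly_Mapping.single a d) = Poly_Mapping.single a (c * d)"
    using fin by (simp add: path_scalar_def path_mult_sum_left path_mult_single path_prod_def a(1))
  show "path_mult G (Poly_Mapping.single a d) (path_scalar G c) = Poly_Mapping.single a (d * c)"
    using fin \<open>y \<in> verts G\<close> by (simp add: path_scalar_def path_mult_sum_right path_mult_single path_prod_def a(1) y)
qed

lemma path_scalar_one_mult:
  assumes "Poly_Mapping.keys f \<subseteq> paths G"
  shows "path_mult G (path_scalar G 1) f = f" "path_mult G f (path_scalar G 1) = f"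
  using assms
  by (induct f rule: poly_mapping_single_induct)
    (simp_all add: path_scalar_mult_single path_mult_add_left path_mult_add_right)

lemma path_algebra_ring: "ring (path_algebra k G)"
proof (rule ringI)
  show "abelian_group (path_algebra k G)"
  proof (rule abelian_groupI)
    fix f g :: "('a \<times> 'b list) \<Rightarrow>\<^sub>0 'c"
    assume "f \<in> carrier (path_algebra k G)" "g \<in> carrier (path_algebra k G)"
    then show "f \<oplus>\<^bsub>path_algebra k G\<^esub> g \<in> carrier (path_algebra k G)"
      using keys_add[of f g] by auto
  next
    fix f :: "('a \<times> 'b list) \<Rightarrow>\<^sub>0 'c" assume "f \<in> carrier (path_algebra k G)"
    then show "\<exists>g\<in>carrier (path_algebra k G). g \<oplus>\<^bsub>path_algebra k G\<^esub> f = \<zero>\<^bsub>path_algebra k G\<^esub>"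
      by (intro bexI[of _ "- f"]) (auto simp: in_keys_iff)
  qed (auto simp: add_ac)
  show "Group.monoid (path_algebra k G)"
    by (rule monoidI)
      (simp_all add: path_mult_assoc path_scalar_one_mult path_mult_closed path_scalar_closed)
qed (simp_all add: path_mult_add_left path_mult_add_right)

lemma path_scalar_hom:
  "ring_hom_ring (field_of_type k) (path_algebra (k :: 'k::field itself) G) (path_scalar G)"
proof (rule ring_hom_ringI2)
  show "path_scalar G \<in> ring_hom (field_of_type k) (path_algebra k G)"
  proof (rule ring_hom_memI)
    fix c d :: 'k
    show "path_scalar G c \<in> carrier (path_algebra k G)"
      using path_scalar_closed by simp
    have "path_mult G (path_scalar G c) (Poly_Mapping.single (x, []) d) = Poly_Mapping.single (x, []) (c * d)"
      if "x \<in> verts G" for x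
      by (rule path_scalar_mult_single(1)) (use that in \<open>auto simp: paths_def awalk_Nil_iff\<close>)
    then show "path_scalar G (c \<otimes>\<^bsub>field_of_type k\<^esub> d) =
        path_scalar G c \<otimes>\<^bsub>path_algebra k G\<^esub> path_scalar G d"
      by (simp add: field_of_type_def path_scalar_def[of G "c * d"] path_scalar_def[of G d]
          path_mult_sum_right)
    show "path_scalar G (c \<oplus>\<^bsub>field_of_type k\<^esub> d) =
        path_scalar G c \<oplus>\<^bsub>path_algebra k G\<^esub> path_scalar G d"
      by (simp add: field_of_type_def path_scalar_def single_add sum.distrib)
  qed (simp add: field_of_type_def)
qed (auto simp: path_algebra_ring field.is_ring[OF field_field_of_type])

end

end


section \<open>Quotients of path algebras\<close>

text \<open>The linear functional that adds up the coefficients of all paths from \<open>x\<close>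
  to \<open>y\<close> with label \<open>c\<close>. It cannot tell apart two paths with equal ends
  and labels, so it survives the relations of \<open>Gamma\<close> and still separates all other
  paths.\<close>

definition path_coeff ::
  "('v, 'a) pre_digraph \<Rightarrow> ('a list \<Rightarrow> 'c) \<Rightarrow> 'v \<Rightarrow> 'v \<Rightarrow> 'c \<Rightarrow> (('v \<times> 'a list) \<Rightarrow>\<^sub>0 'k::field) \<Rightarrow> 'k" where
  "path_coeff Q lab x y c f = (\<Sum>a\<in>Poly_Mapping.keys f.
     if fst a = x \<and> pre_digraph.awlast Q x (snd a) = y \<and> lab (snd a) = c
     then Poly_Mapping.lookup f a else 0)"

lemma path_coeff_add:
  "path_coeff Q lab x y c (f + g) = path_coeff Q lab x y c f + path_coeff Q lab x y c g"
  unfolding path_coeff_def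
  by (rule setsum_keys_plus_distrib) auto

lemma path_coeff_0 [simp]: "path_coeff Q lab x y c 0 = 0"
  by (simp add: path_coeff_def)

lemma path_coeff_uminus: "path_coeff Q lab x y c (- f) = - path_coeff Q lab x y c f"
  using path_coeff_add[of Q lab x y c "- f" f] by (simp add: eq_neg_iff_add_eq_0)

lemma path_coeff_diff:
  "path_coeff Q lab x y c (f - g) = path_coeff Q lab x y c f - path_coeff Q lab x y c g"
  using path_coeff_add[of Q lab x y c f "- g"] by (simp add: path_coeff_uminus)

lemma path_coeff_single:
  "path_coeff Q lab x y c (Poly_Mapping.single a d) =
    (if fst a = x \<and> pre_digraph.awlast Q x (snd a) = y \<and> lab (snd a) = c then d else 0)"
proof (cases "d = 0")
  case False
  then have "Poly_Mapping.keys (Poly_Mapping.single a d) = {a}" by simp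
  then show ?thesis by (auto simp: path_coeff_def simp del: keys_single)
qed simp

context
  fixes lab :: "'a list \<Rightarrow> 'c::ab_group_add"
  assumes lab_append: "\<And>p q. lab (p @ q) = lab p + lab q"
begin

text \<open>Multiplication by a path turns one functional of the family into a multiple of another,
  with an end moved and the label reduced. Hence the common kernel of the whole family is stable
  under multiplication, although no single kernel need be.\<close>

lemma path_coeff_mult_single_left:
  "path_coeff Q lab x y c (path_mult Q (Poly_Mapping.single (x', p) d) g) =
    (if x' = x then d * path_coeff Q lab (pre_digraph.awlast Q x p) y (c - lab p) g else 0)"
proof (induct g rule: poly_mapping_single_induct[OF subset_UNIV])
  case (2 a d')
  show ?case
    by (auto simp: path_mult_single path_prod_def path_coeff_single lab_append
        pre_digraph.awlast_append algebra_simps)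
qed (simp_all add: path_mult_add_right path_coeff_add distrib_left)

lemma path_coeff_mult_single_right:
  "path_coeff Q lab x y c (path_mult Q g (Poly_Mapping.single (y', q) d)) =
    (if pre_digraph.awlast Q y' q = y then path_coeff Q lab x y' (c - lab q) g * d else 0)"
proof (induct g rule: poly_mapping_single_induct[OF subset_UNIV])
  case (2 a d')
  show ?case
    by (auto simp: path_mult_single path_prod_def path_coeff_single lab_append
        pre_digraph.awlast_append algebra_simps)
qed (simp_all add: path_mult_add_left path_coeff_add distrib_right)

lemma path_coeff_mult_eq_0:
  assumes "\<And>x y c. path_coeff Q lab x y c f = 0"
  shows "path_coeff Q lab x y c (path_mult Q g f) = 0" "path_coeff Q lab x y c (path_mult Q f g) = 0"
proof -
  show "path_coeff Q lab x y c (path_mult Q g f) = 0"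
    by (induct g rule: poly_mapping_single_induct[OF subset_UNIV])
      (auto simp: path_mult_add_left path_coeff_add path_coeff_mult_single_left assms)
  show "path_coeff Q lab x y c (path_mult Q f g) = 0"
    by (induct g rule: poly_mapping_single_induct[OF subset_UNIV])
      (auto simp: path_mult_add_right path_coeff_add path_coeff_mult_single_right assms)
qed

end

context wf_digraph
begin

context
  assumes fin: "finite (verts G)"
begin

text \<open>Serves to bound a generated ideal from above: if the generators lie in this common
  kernel, every \<open>path_coeff\<close> vanishes on the ideal.\<close>

lemma ideal_path_coeff_eq_0:
  fixes lab :: "'b list \<Rightarrow> 'c::ab_group_add"
  assumes "\<And>p q. lab (p @ q) = lab p + lab q"
  shows "ideal {f. Poly_Mapping.keys f \<subseteq> paths G \<and> (\<forall>x y c. path_coeff G lab x y c f = 0)}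
    (path_algebra k G)" (is "ideal ?K ?R")
proof (rule idealI[OF path_algebra_ring[OF fin]])
  interpret R: ring ?R by (rule path_algebra_ring[OF fin])
  show "subgroup ?K (add_monoid ?R)"
  proof (rule R.add.subgroupI)
    fix f assume f: "f \<in> ?K"
    then have "\<ominus>\<^bsub>?R\<^esub> f = - f"
      by (intro R.minus_equality) auto
    then show "\<ominus>\<^bsub>?R\<^esub> f \<in> ?K" using f by (simp add: path_coeff_uminus)
  next
    fix f g assume "f \<in> ?K" "g \<in> ?K"
    then show "f \<oplus>\<^bsub>?R\<^esub> g \<in> ?K" using keys_add[of f g] by (auto simp: path_coeff_add)
  qed (auto intro: exI[of _ 0])
qed (auto simp: path_coeff_mult_eq_0[OF assms] dest: subsetD[OF path_mult_closed, rotated 2])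

section \<open>Spans and independence of path classes modulo an arbitrary two-sided ideal\<close>

context
  fixes J :: "(('a \<times> 'b list) \<Rightarrow>\<^sub>0 'k::field) set" and k :: "'k itself"
  assumes J: "ideal J (path_algebra k G)"
begin

abbreviation "cls \<equiv> (\<lambda>f. J +>\<^bsub>path_algebra k G\<^esub> f)"

text \<open>The image of a field under a ring homomorphism is a subfield once the target is not the
  zero ring, and the assumption that the identity is not in \<open>J\<close> excludes that.\<close>

lemma quotient_scalars_subfield:
  assumes "path_scalar G 1 \<notin> J"
  shows "subfield (range (\<lambda>c. cls (path_scalar G c))) (path_algebra k G Quot J)"
proof -
  interpret h: ring_hom_ring "path_algebra k G" "path_algebra k G Quot J" cls
    by (rule ideal.rcos_ring_hom_ring[OF J])
  interpret s: ring_hom_ring "field_of_type k" "path_algebra k G" "path_scalar G"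
    by (rule path_scalar_hom[OF fin])
  have "ring_hom_ring (field_of_type k) (path_algebra k G Quot J) (cls \<circ> path_scalar G)"
    by (rule ring_hom_ringI2[OF s.R.ring_axioms h.S.ring_axioms])
      (rule ring_hom_trans[OF s.homh h.homh])
  moreover have "\<one>\<^bsub>path_algebra k G Quot J\<^esub> \<noteq> \<zero>\<^bsub>path_algebra k G Quot J\<^esub>"
  proof
    assume "\<one>\<^bsub>path_algebra k G Quot J\<^esub> = \<zero>\<^bsub>path_algebra k G Quot J\<^esub>"
    then have "cls \<one>\<^bsub>path_algebra k G\<^esub> = J" by (simp add: FactRing_def)
    then have "\<one>\<^bsub>path_algebra k G\<^esub> \<in> J"
      using abelian_subgroup.a_rcos_self[OF abelian_subgroupI3[OF ideal.axioms(1)[OF J] h.R.is_abelian_group]]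
        h.R.one_closed by blast
    then show False using assms by simp
  qed
  ultimately have "subfield ((cls \<circ> path_scalar G) ` carrier (field_of_type k)) (path_algebra k G Quot J)"
    by (rule ring_hom_ring.img_is_subfield(2)[OF _ field.carrier_is_subfield[OF field_field_of_type]])
  then show ?thesis by (simp add: field_of_type_def image_comp comp_def)
qed

lemma cls_mult_scalar_single:
  assumes "a \<in> paths G"
  shows "cls (path_scalar G c) \<otimes>\<^bsub>path_algebra k G Quot J\<^esub> cls (Poly_Mapping.single a 1)
    = cls (Poly_Mapping.single a c)"
proof -
  interpret h: ring_hom_ring "path_algebra k G" "path_algebra k G Quot J" cls
    by (rule ideal.rcos_ring_hom_ring[OF J])
  show ?thesis
    using h.hom_mult[of "path_scalar G c" "Poly_Mapping.single a 1"] assms path_scalar_closed[OF fin, of c]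
    by (simp add: path_scalar_mult_single[OF fin])
qed

text \<open>A vector supported on \<open>a # as\<close> splits into its part at \<open>a\<close> and
  a rest supported on \<open>as\<close>; this mirrors how \<open>Span\<close> adjoins one line at a
  time.\<close>

lemma Span_cls_paths:
  assumes "set as \<subseteq> paths G"
  shows "ring.Span (path_algebra k G Quot J) (range (\<lambda>c. cls (path_scalar G c)))
      (map (\<lambda>a. cls (Poly_Mapping.single a 1)) as) = cls ` {f. Poly_Mapping.keys f \<subseteq> set as}"
  using assms
proof (induct as)
  interpret h: ring_hom_ring "path_algebra k G" "path_algebra k G Quot J" cls
    by (rule ideal.rcos_ring_hom_ring[OF J])
  {
    case Nil
    show ?case using h.hom_zero by auto
  next
    case (Cons a as)
    let ?K = "range (\<lambda>c. cls (path_scalar G c))" and ?S = "{f. Poly_Mapping.keys f \<subseteq> set as}"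
    have a: "a \<in> paths G" and as: "set as \<subseteq> paths G" using Cons.prems by auto
    have add: "cls (Poly_Mapping.single a c) \<oplus>\<^bsub>path_algebra k G Quot J\<^esub> cls f = cls (Poly_Mapping.single a c + f)"
      if "f \<in> ?S" for c f
      using h.hom_add[of "Poly_Mapping.single a c" f] that a as by auto
    have "h.S.line_extension ?K (cls (Poly_Mapping.single a 1)) (cls ` ?S)
      = cls ` {f. Poly_Mapping.keys f \<subseteq> set (a # as)}"
    proof (intro equalityI subsetI)
      fix z assume "z \<in> h.S.line_extension ?K (cls (Poly_Mapping.single a 1)) (cls ` ?S)"
      then obtain c f where "f \<in> ?S" and
        "z = cls (path_scalar G c) \<otimes>\<^bsub>path_algebra k G Quot J\<^esub> cls (Poly_Mapping.single a 1)
          \<oplus>\<^bsub>path_algebra k G Quot J\<^esub> cls f"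
        by (auto simp: h.S.line_extension_mem_iff)
      then have "z = cls (Poly_Mapping.single a c + f)"
        by (simp add: cls_mult_scalar_single a add)
      moreover have "Poly_Mapping.keys (Poly_Mapping.single a c + f) \<subseteq> set (a # as)"
        using keys_add[of "Poly_Mapping.single a c" f] \<open>f \<in> ?S\<close> by (auto split: if_splits)
      ultimately show "z \<in> cls ` {f. Poly_Mapping.keys f \<subseteq> set (a # as)}" by blast
    next
      fix z assume "z \<in> cls ` {f. Poly_Mapping.keys f \<subseteq> set (a # as)}"
      then obtain f where f: "Poly_Mapping.keys f \<subseteq> set (a # as)" "z = cls f" by auto
      define g where "g = f - Poly_Mapping.single a (Poly_Mapping.lookup f a)"
      have g: "g \<in> ?S" using f(1)
        by (auto simp: g_def in_keys_iff lookup_minus lookup_single when_def split: if_splits)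
      have "z = cls (path_scalar G (Poly_Mapping.lookup f a))
          \<otimes>\<^bsub>path_algebra k G Quot J\<^esub> cls (Poly_Mapping.single a 1) \<oplus>\<^bsub>path_algebra k G Quot J\<^esub> cls g"
        by (simp add: cls_mult_scalar_single a add[OF g] f(2)) (simp add: g_def)
      then show "z \<in> h.S.line_extension ?K (cls (Poly_Mapping.single a 1)) (cls ` ?S)"
        using g unfolding h.S.line_extension_mem_iff by blast
    qed
    then show ?case using Cons.hyps[OF as] by simp
  }
qed

lemma finite_dimension_cls_paths:
  assumes "path_scalar G 1 \<notin> J" "finite S" "S \<subseteq> paths G"
  shows "ring.finite_dimension (path_algebra k G Quot J) (range (\<lambda>c. cls (path_scalar G c)))
    (cls ` {f. Poly_Mapping.keys f \<subseteq> S})"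
proof -
  interpret h: ring_hom_ring "path_algebra k G" "path_algebra k G Quot J" cls
    by (rule ideal.rcos_ring_hom_ring[OF J])
  obtain as where as: "set as = S" using finite_list[OF assms(2)] by auto
  have "set (map (\<lambda>a. cls (Poly_Mapping.single a 1)) as) \<subseteq> carrier (path_algebra k G Quot J)"
    using as assms(3) by (auto intro!: h.hom_closed)
  from h.S.Span_finite_dimension[OF quotient_scalars_subfield[OF assms(1)] this] show ?thesis
    using Span_cls_paths[of as] as assms(3) by simp
qed

text \<open>A list is independent if each entry lies outside the span of the later ones. The
  functional for the ends and label of \<open>a\<close> is 1 on \<open>a\<close>, vanishes on
  \<open>J\<close>, and by injectivity vanishes on every path in \<open>as\<close>.\<close>

lemma independent_cls_paths:
  assumes coeff: "\<And>f x y c. f \<in> J \<Longrightarrow> path_coeff G lab x y c f = 0"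
    and "set as \<subseteq> paths G" "distinct as"
    and "inj_on (\<lambda>a. (fst a, awlast (fst a) (snd a), lab (snd a))) (set as)"
  shows "ring.independent (path_algebra k G Quot J) (range (\<lambda>c. cls (path_scalar G c)))
    (map (\<lambda>a. cls (Poly_Mapping.single a 1)) as)"
  using assms(2-)
proof (induct as)
  interpret h: ring_hom_ring "path_algebra k G" "path_algebra k G Quot J" cls
    by (rule ideal.rcos_ring_hom_ring[OF J])
  {
    case Nil
    show ?case by simp
  next
    case (Cons a as)
    let ?s = "Poly_Mapping.single a (1::'k)"
    let ?c = "path_coeff G lab (fst a) (awlast (fst a) (snd a)) (lab (snd a)) :: _ \<Rightarrow> 'k"
    have "cls ?s \<notin> cls ` {f. Poly_Mapping.keys f \<subseteq> set as}"
    proof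
      assume "cls ?s \<in> cls ` {f. Poly_Mapping.keys f \<subseteq> set as}"
      then obtain f where f: "Poly_Mapping.keys f \<subseteq> set as" "cls ?s = cls f" by auto
      have "?s \<in> cls ?s"
        using J Cons.prems by (intro abelian_subgroup.a_rcos_self abelian_subgroupI3 ideal.axioms(1) h.R.is_abelian_group) auto
      then have "?s \<in> cls f" using f(2) by simp
      then obtain i where "i \<in> J" "?s = i + f" by (auto simp: a_r_coset_def')
      then have "?c ?s = ?c f" by (simp add: path_coeff_add coeff)
      also have "?c f = 0" unfolding path_coeff_def
        using f(1) Cons.prems by (intro sum.neutral) (force simp: inj_on_def)
      finally show False by (simp add: path_coeff_single)
    qed
    then have "cls ?s \<notin> h.S.Span (range (\<lambda>c. cls (path_scalar G c)))
        (map (\<lambda>a. cls (Poly_Mapping.single a 1)) as)"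
      using Span_cls_paths[of as] Cons.prems(1) by simp
    moreover have "cls ?s \<in> carrier (path_algebra k G Quot J)"
      using Cons.prems(1) by (intro h.hom_closed) simp
    ultimately show ?case
      using Cons by (auto intro: h.S.independent.li_Cons simp del: h.S.Span.simps)
  }
qed

lemma infinite_dimension_cls_paths:
  assumes "path_scalar G 1 \<notin> J" and coeff: "\<And>f x y c. f \<in> J \<Longrightarrow> path_coeff G lab x y c f = 0"
    and "infinite S" "S \<subseteq> paths G"
    and "inj_on (\<lambda>a. (fst a, awlast (fst a) (snd a), lab (snd a))) S"
    and E: "\<And>a. a \<in> S \<Longrightarrow> cls (Poly_Mapping.single a 1) \<in> E"
  shows "\<not> ring.finite_dimension (path_algebra k G Quot J) (range (\<lambda>c. cls (path_scalar G c))) E"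
proof
  interpret h: ring_hom_ring "path_algebra k G" "path_algebra k G Quot J" cls
    by (rule ideal.rcos_ring_hom_ring[OF J])
  let ?K = "range (\<lambda>c. cls (path_scalar G c))"
  assume "h.S.finite_dimension ?K E"
  then obtain n where n: "h.S.dimension n ?K E" by auto
  \<comment> \<open>One path more than the supposed dimension \<open>n\<close> allows for an
    independent list.\<close>
  obtain T where T: "T \<subseteq> S" "finite T" "card T = Suc n"
    using infinite_arbitrarily_large[OF assms(3)] by blast
  obtain as where as: "set as = T" "distinct as" using finite_distinct_list[OF T(2)] by auto
  have "h.S.independent ?K (map (\<lambda>a. cls (Poly_Mapping.single a 1)) as)"
    using as T assms by (intro independent_cls_paths[where lab = lab] coeff) (auto intro: inj_on_subset)
  from h.S.independent_length_le_dimension[OF quotient_scalars_subfield[OF assms(1)] n this]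
  have "length as \<le> n" using E T(1) by (fastforce simp: as(1))
  then show False using as T distinct_card[of as] by simp
qed

end

end

end


section \<open>Integral functionals on a lattice polytope\<close>

lemma real_vec_nth [simp]: "real_vec w $ i = real_of_int (w $ i)"
  by (simp add: real_vec_def)

lemma inj_real_vec: "inj real_vec"
  by (rule injI) (simp add: vec_eq_iff real_vec_def)

lemma additive_axis:
  fixes m :: "int ^ 'n \<Rightarrow> int"
  assumes "Modules.additive m"
  shows "m (axis i c) = c * m (axis i 1)"
proof -
  interpret Modules.additive m by (rule assms)
  have nonneg: "m (axis i (int n)) = int n * m (axis i 1)" for n
  proof (induct n)
    case 0
    have "axis i (0::int) = 0" by (simp add: vec_eq_iff axis_def)
    then show ?case unfolding of_nat_0 using zero by (metis mult_zero_left)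
  next
    case (Suc n)
    have "axis i (int (Suc n)) = axis i (int n) + axis i 1" by (simp add: vec_eq_iff axis_def)
    then show ?case using Suc by (simp add: add algebra_simps)
  qed
  show ?thesis
  proof (cases c)
    case (neg n)
    have "axis i c = - axis i (int (Suc n))" by (simp add: vec_eq_iff axis_def neg)
    then show ?thesis using nonneg[of "Suc n"] neg by (metis minus mult_minus_left)
  qed (use nonneg in simp)
qed

lemma additive_eq_sum:
  fixes m :: "int ^ 'n \<Rightarrow> int"
  assumes "Modules.additive m"
  shows "m w = (\<Sum>i\<in>UNIV. m (axis i 1) * w $ i)"
proof -
  interpret Modules.additive m by (rule assms)
  have "axis i (w $ i) $ j = (if j = i then w $ i else 0)" for i j
    by (simp add: axis_def)
  then have "w = (\<Sum>i\<in>UNIV. axis i (w $ i))" by (simp add: vec_eq_iff)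
  then have "m w = m (\<Sum>i\<in>UNIV. axis i (w $ i))" by simp
  also have "\<dots> = (\<Sum>i\<in>UNIV. m (axis i (w $ i)))" by (rule sum)
  also have "\<dots> = (\<Sum>i\<in>UNIV. m (axis i 1) * w $ i)"
    by (rule sum.cong[OF refl]) (subst additive_axis[OF assms], rule mult.commute)
  finally show ?thesis .
qed

text \<open>Extends an element of \<open>M\<close> to a real functional, so that convexity arguments
  on \<open>P\<close> apply to it.\<close>

lemma additive_eq_inner:
  fixes m :: "int ^ 'n \<Rightarrow> int"
  assumes "Modules.additive m"
  shows "real_of_int (m w) = real_vec (\<chi> i. m (axis i 1)) \<bullet> real_vec w"
  by (subst additive_eq_sum[OF assms]) (simp add: inner_vec_def)

lemma linear_functional_min_interior:
  fixes a :: "'a::euclidean_space"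
  assumes "x \<in> interior S" and "\<And>y. y \<in> S \<Longrightarrow> a \<bullet> x \<le> a \<bullet> y"
  shows "a = 0"
proof -
  obtain r where r: "r > 0" "cball x r \<subseteq> S" using assms(1) by (auto simp: mem_interior_cball)
  show ?thesis
  proof (rule ccontr)
    assume a: "a \<noteq> 0"
    \<comment> \<open>The point at distance \<open>r\<close> in the direction of steepest descent;
      the functional is smaller there by \<open>r * norm a\<close>.\<close>
    let ?y = "x - (r / norm a) *\<^sub>R a"
    have "?y \<in> cball x r" using r a by (simp add: dist_norm)
    then have "a \<bullet> x \<le> a \<bullet> ?y" using r assms(2) by blast
    then have "(r / norm a) * (a \<bullet> a) \<le> 0" by (simp add: inner_diff_right)
    moreover have "(r / norm a) * (a \<bullet> a) > 0" using r a by simp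
    ultimately show False by linarith
  qed
qed

text \<open>
  A Dirichlet approximation \<open>p \<approx> q a\<close> of a real functional \<open>a\<close> stays nonnegative on \<open>W\<close>: its
  values there are integers greater than \<open>-1\<close>.
\<close>

lemma integral_functional_nonneg:
  fixes a :: "real ^ 'n" and W :: "(int ^ 'n) set"
  assumes "a \<noteq> 0" "finite W" "\<And>w. w \<in> W \<Longrightarrow> a \<bullet> real_vec w \<ge> 0"
  obtains p :: "int ^ 'n" where "p \<noteq> 0" "\<And>w. w \<in> W \<Longrightarrow> (\<Sum>i\<in>UNIV. p $ i * w $ i) \<ge> 0"
proof -
  obtain i0 where i0: "a $ i0 \<noteq> 0" using assms(1) by (auto simp: vec_eq_iff)
  \<comment> \<open>With this coordinate of absolute value 1, its multiple by
    \<open>q \<ge> 1\<close> is too far from 0 to be rounded to 0, so the approximating vector is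
    nonzero.\<close>
  define b where "b = (1 / \<bar>a $ i0\<bar>) *\<^sub>R a"
  have b_i0: "\<bar>b $ i0\<bar> = 1" using i0 by (simp add: b_def)
  have b: "b \<bullet> real_vec w \<ge> 0" if "w \<in> W" for w
    using assms(3)[OF that] by (simp add: b_def)
  define D where "D = (\<Sum>w\<in>W. \<Sum>i\<in>UNIV. nat \<bar>w $ i\<bar>)"
  \<comment> \<open>\<open>N\<close> exceeds the sum of absolute coordinates of every
    \<open>w\<close> in \<open>W\<close>, so errors below \<open>1 / N\<close> in each coordinate
    change the value at \<open>w\<close> by less than 1.\<close>
  define N where "N = Suc (Suc D)"
  have "N > 0" by (simp add: N_def)
  \<comment> \<open>Simultaneous approximation is indexed by natural numbers, so the coordinates are
    enumerated.\<close>
  obtain h :: "nat \<Rightarrow> 'n" where h: "bij_betw h {0..<CARD('n)} UNIV"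
    using ex_bij_betw_nat_finite[OF finite_class.finite_UNIV] by blast
  have "\<exists>q p. 0 < q \<and> (\<forall>i<CARD('n). \<bar>of_int q * b $ h i - of_int (p i)\<bar> < 1 / N)"
    by (rule Dirichlet_approx_simult[OF \<open>N > 0\<close>, where \<theta> = "\<lambda>i. b $ h i" and n = "CARD('n)"]) blast
  then obtain q p where q: "0 < q"
    and p: "\<And>i. i < CARD('n) \<Longrightarrow> \<bar>of_int q * b $ h i - of_int (p i)\<bar> < 1 / N" by blast
  define p' :: "int ^ 'n" where "p' = (\<chi> i. p (inv_into {0..<CARD('n)} h i))"
  have p': "\<bar>of_int q * b $ i - of_int (p' $ i)\<bar> < 1 / N" for i
  proof -
    have "inv_into {0..<CARD('n)} h i \<in> {0..<CARD('n)}" "h (inv_into {0..<CARD('n)} h i) = i"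
      using h inv_into_into[of i h "{0..<CARD('n)}"] f_inv_into_f[of i h "{0..<CARD('n)}"]
      by (simp_all add: bij_betw_def)
    then show ?thesis using p[of "inv_into {0..<CARD('n)} h i"] by (simp add: p'_def)
  qed
  show thesis
  proof (rule that)
    have "p' $ i0 \<noteq> 0"
    proof
      assume "p' $ i0 = 0"
      then have "of_int q < 1 / real N" using p'[of i0] b_i0 q by (simp add: abs_mult)
      moreover have "1 / real N \<le> 1" by (simp add: N_def)
      moreover have "(of_int q :: real) \<ge> 1" using q by simp
      ultimately show False by linarith
    qed
    then show "p' \<noteq> 0" by auto
  next
    fix w assume w: "w \<in> W"
    have "(\<Sum>i\<in>UNIV. nat \<bar>w $ i\<bar>) \<le> D"
      unfolding D_def using w assms(2) by (intro member_le_sum) auto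
    then have "real (\<Sum>i\<in>UNIV. nat \<bar>w $ i\<bar>) < N" by (simp add: N_def del: of_nat_sum)
    then have "(\<Sum>i\<in>UNIV. \<bar>real_of_int (w $ i)\<bar>) < N" by simp
    then have lt: "(\<Sum>i\<in>UNIV. \<bar>real_of_int (w $ i)\<bar>) / N < 1" using \<open>N > 0\<close> by simp
    have "of_int q * (b \<bullet> real_vec w) - real_of_int (\<Sum>i\<in>UNIV. p' $ i * w $ i)
      = (\<Sum>i\<in>UNIV. (of_int q * b $ i - of_int (p' $ i)) * of_int (w $ i))"
      unfolding inner_vec_def sum_distrib_left of_int_sum sum_subtractf[symmetric]
      by (intro sum.cong) (simp_all add: left_diff_distrib)
    also have "\<dots> \<le> (\<Sum>i\<in>UNIV. 1 / N * \<bar>real_of_int (w $ i)\<bar>)"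
    proof (rule sum_mono)
      fix i
      have "(of_int q * b $ i - of_int (p' $ i)) * of_int (w $ i)
        \<le> \<bar>of_int q * b $ i - of_int (p' $ i)\<bar> * \<bar>real_of_int (w $ i)\<bar>"
        unfolding abs_mult[symmetric] by (rule abs_ge_self)
      also have "\<dots> \<le> 1 / N * \<bar>real_of_int (w $ i)\<bar>"
        by (rule mult_right_mono[OF less_imp_le[OF p']]) simp
      finally show "(of_int q * b $ i - of_int (p' $ i)) * of_int (w $ i) \<le> 1 / N * \<bar>real_of_int (w $ i)\<bar>" .
    qed
    also have "\<dots> < 1" using lt by (simp flip: sum_divide_distrib)
    finally have "real_of_int (\<Sum>i\<in>UNIV. p' $ i * w $ i) > of_int q * (b \<bullet> real_vec w) - 1" by simp
    moreover have "of_int q * (b \<bullet> real_vec w) \<ge> 0" using q b[OF w] by simp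
    ultimately have "real_of_int (\<Sum>i\<in>UNIV. p' $ i * w $ i) > - 1" by linarith
    then show "(\<Sum>i\<in>UNIV. p' $ i * w $ i) \<ge> 0" by linarith
  qed
qed

context simplicial_lattice_polytope
begin

lemma extreme_points: "{x. x extreme_point_of P} = real_vec ` V"
  using lattice by (auto simp: V_def)

lemma finite_V: "finite V"
proof -
  have "card (real_vec ` V) = CARD('n) + 2" using card_vertices extreme_points by simp
  then have "finite (real_vec ` V)" by (intro card_ge_0_finite) simp
  then show ?thesis by (rule finite_imageD) (rule inj_on_subset[OF inj_real_vec subset_UNIV])
qed

lemma P_eq_hull: "P = convex hull (real_vec ` V)"
  unfolding extreme_points[symmetric]
  by (rule Krein_Milman_Minkowski[OF polytope_imp_compact polytope_imp_convex]) (rule polytope)+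

lemma P_functional_ge:
  assumes "\<And>w. w \<in> V \<Longrightarrow> a \<bullet> real_vec w \<ge> b" "x \<in> P"
  shows "a \<bullet> x \<ge> b"
proof -
  have "convex hull (real_vec ` V) \<subseteq> {x. a \<bullet> x \<ge> b}"
    by (rule hull_minimal) (use assms(1) in \<open>auto intro: convex_halfspace_ge\<close>)
  then show ?thesis using assms(2) P_eq_hull by blast
qed

lemma interior_P_nonempty: "interior P \<noteq> {}"
proof -
  have "affine hull P = UNIV" using full_dimensional aff_dim_eq_full[of P] by simp
  moreover have "P \<noteq> {}" using full_dimensional by auto
  ultimately show ?thesis
    using rel_interior_eq_empty[OF polytope_imp_convex[OF polytope]] by (simp add: rel_interior_interior)
qed

text \<open>The bound passes from the vertices to their convex hull, so the interior point
  \<open>u\<close> minimizes \<open>m\<close> on \<open>P\<close>; only the zero functional has an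
  interior minimum.\<close>

lemma functional_min_interior:
  assumes "m \<in> M" "real_vec u \<in> interior P" "\<And>w. w \<in> V \<Longrightarrow> m w \<ge> m u"
  shows "m w = 0"
proof -
  have m: "real_of_int (m w) = real_vec (\<chi> i. m (axis i 1)) \<bullet> real_vec w" for w
    using assms(1) additive_eq_inner by (auto simp: M_def)
  have "real_vec (\<chi> i. m (axis i 1)) = 0"
    by (rule linear_functional_min_interior[OF assms(2)])
      (rule P_functional_ge, simp_all add: m[symmetric] assms(3))
  then show ?thesis using m[of w] by simp
qed

text \<open>Being constant on the vertices bounds \<open>m\<close> on \<open>P\<close> from both
  sides, so it is constant on a set with interior points. The consequence needed later is that
  \<open>m\<close> and \<open>z\<close> can be read off from
  \<open>A_P m + frag_cmul z pF\<close>.\<close>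

lemma functional_const_on_V:
  assumes "m \<in> M" "\<And>w. w \<in> V \<Longrightarrow> m w = z"
  shows "m w = 0" "z = 0"
proof -
  let ?a = "real_vec (\<chi> i. m (axis i 1))"
  have m: "real_of_int (m w) = ?a \<bullet> real_vec w" for w
    using assms(1) additive_eq_inner by (auto simp: M_def)
  have "?a \<bullet> x \<ge> z" if "x \<in> P" for x
    by (rule P_functional_ge[OF _ that]) (simp add: m[symmetric] assms(2))
  moreover have "- ?a \<bullet> x \<ge> - z" if "x \<in> P" for x
    by (rule P_functional_ge[OF _ that]) (simp add: m[symmetric] assms(2))
  ultimately have *: "?a \<bullet> x = z" if "x \<in> P" for x using that by (simp add: antisym)
  obtain x where x: "x \<in> interior P" using interior_P_nonempty by auto
  then have "x \<in> P" using interior_subset by blast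
  have a: "?a = 0"
    by (rule linear_functional_min_interior[OF x]) (simp add: * \<open>x \<in> P\<close>)
  then show "m w = 0" using m[of w] by simp
  show "z = 0" using *[OF \<open>x \<in> P\<close>] a by simp
qed

text \<open>Since \<open>u\<close> may lie on the boundary, it is separated from the interior of
  \<open>P\<close> only; taking closures extends the bound to \<open>P\<close>. Passing to the
  differences \<open>w - u\<close> makes the inequalities homogeneous, as the rounding to an
  integral functional requires.\<close>

lemma supporting_functional:
  assumes "real_vec u \<notin> interior P"
  obtains m where "m \<in> M" "\<And>w. w \<in> V \<Longrightarrow> m w \<ge> m u" "\<exists>w. m w \<noteq> 0"
proof -
  have conv: "convex P" using polytope by (rule polytope_imp_convex)
  have "\<exists>a b. a \<noteq> 0 \<and> (\<forall>x\<in>{real_vec u}. a \<bullet> x \<le> b) \<and> (\<forall>x\<in>interior P. a \<bullet> x \<ge> b)"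
    by (rule separating_hyperplane_sets) (use assms interior_P_nonempty convex_interior[OF conv] in simp_all)
  then obtain a b where a: "a \<noteq> 0" "a \<bullet> real_vec u \<le> b" "\<forall>x\<in>interior P. a \<bullet> x \<ge> b"
    by blast
  have "closure (interior P) \<subseteq> {x. a \<bullet> x \<ge> b}"
    by (rule closure_minimal[OF _ closed_halfspace_ge]) (use a(3) in blast)
  then have P: "P \<subseteq> {x. a \<bullet> x \<ge> b}"
    unfolding convex_closure_interior[OF conv interior_P_nonempty] by (rule order_trans[OF closure_subset])
  have ge: "a \<bullet> real_vec w \<ge> b" if "w \<in> V" for w
  proof -
    have "real_vec w \<in> P" using that by (simp add: V_def extreme_point_of_def)
    then show ?thesis using P by blast
  qed
  have W: "a \<bullet> real_vec w \<ge> 0" if w: "w \<in> (\<lambda>w. w - u) ` V" for w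
  proof -
    obtain w' where w': "w = w' - u" "w' \<in> V" using w by blast
    have "real_vec w = real_vec w' - real_vec u" by (simp add: vec_eq_iff w'(1))
    then show ?thesis using a(2) ge[OF w'(2)] by (simp add: inner_diff_right)
  qed
  obtain p where p: "p \<noteq> 0" "\<And>w. w \<in> (\<lambda>w. w - u) ` V \<Longrightarrow> (\<Sum>i\<in>UNIV. p $ i * w $ i) \<ge> 0"
    using integral_functional_nonneg[OF a(1) finite_imageI[OF finite_V, of "\<lambda>w. w - u"] W] by blast
  define m where "m = (\<lambda>w. \<Sum>i\<in>UNIV. p $ i * w $ i)"
  show thesis
  proof
    show "m \<in> M"
      by (simp add: M_def m_def Modules.additive_def distrib_left sum.distrib)
    show "m w \<ge> m u" if "w \<in> V" for w
      using p(2)[OF imageI[OF that]] by (simp add: m_def right_diff_distrib sum_subtractf)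
    obtain i where i: "p $ i \<noteq> 0" using p(1) by (auto simp: vec_eq_iff)
    have "p $ j * axis i 1 $ j = (if j = i then p $ j else 0)" for j by (simp add: axis_def)
    then have "m (axis i 1) = p $ i" by (simp add: m_def)
    with i show "\<exists>w. m w \<noteq> 0" by (intro exI[of _ "axis i 1"]) simp
  qed
qed

end


section \<open>Coordinates on the root lattices\<close>

text \<open>The term \<open>if k = l then 0 else Suc k\<close> is the cyclic successor of
  \<open>k\<close>: the root with that index is the one that subtracts 1 at coordinate
  \<open>k\<close>.\<close>

lemma lookup_root:
  assumes "i \<le> l"
  shows "Poly_Mapping.lookup (root l i) k = (if i = k then 1 else 0)
    - (if k \<le> l \<and> i = (if k = l then 0 else Suc k) then 1 else 0)"
  using assms by (auto simp: root_def lookup_minus lookup_one when_def)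

definition root_sum :: "nat \<Rightarrow> (nat \<Rightarrow> int) \<Rightarrow> (nat \<Rightarrow>\<^sub>0 int)" where
  "root_sum l c = (\<Sum>i\<le>l. frag_cmul (c i) (root l i))"

lemma lookup_root_sum:
  "Poly_Mapping.lookup (root_sum l c) k = (if k \<le> l then c k - c (if k = l then 0 else Suc k) else 0)"
proof -
  have "Poly_Mapping.lookup (root_sum l c) k
    = (\<Sum>i\<le>l. (if i = k then c i else 0) - (if i = (if k = l then 0 else Suc k) then (if k \<le> l then c i else 0) else 0))"
    unfolding root_sum_def lookup_sum
    by (intro sum.cong) (auto simp: lookup_root)
  also have "\<dots> = (if k \<le> l then c k - c (if k = l then 0 else Suc k) else 0)"
    unfolding sum_subtractf by (subst (1 2) sum.delta) auto
  finally show ?thesis .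
qed

lemma root_sum_const: "root_sum l (\<lambda>_. c) = 0"
  by (rule poly_mapping_eqI) (simp add: lookup_root_sum)

lemma root_sum_add: "root_sum l (\<lambda>i. c i + d i) = root_sum l c + root_sum l d"
  by (rule poly_mapping_eqI) (simp add: lookup_root_sum lookup_add)

lemma root_sum_single:
  assumes "i \<le> l"
  shows "root_sum l (\<lambda>j. if j = i then 1 else 0) = root l i"
  by (rule poly_mapping_eqI) (use assms in \<open>auto simp: lookup_root_sum lookup_root\<close>)

text \<open>The only linear relation among the roots is that they sum to 0. Coordinate
  \<open>k\<close> of a root sum is the difference of consecutive coefficients, so equality forces
  \<open>c - d\<close> to be constant.\<close>

lemma root_sum_eq_iff: "root_sum l c = root_sum l d \<longleftrightarrow> (\<forall>i\<le>l. c i - d i = c 0 - d 0)"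
proof
  assume eq: "root_sum l c = root_sum l d"
  show "\<forall>i\<le>l. c i - d i = c 0 - d 0"
  proof (intro allI impI)
    fix i assume "i \<le> l"
    then show "c i - d i = c 0 - d 0"
    proof (induct i)
      case (Suc i)
      then show ?case
        using arg_cong[OF eq, of "\<lambda>f. Poly_Mapping.lookup f i"] by (simp add: lookup_root_sum)
    qed simp
  qed
next
  assume *: "\<forall>i\<le>l. c i - d i = c 0 - d 0"
  show "root_sum l c = root_sum l d"
  proof (rule poly_mapping_eqI)
    fix k
    show "Poly_Mapping.lookup (root_sum l c) k = Poly_Mapping.lookup (root_sum l d) k"
      using *[rule_format, of k] *[rule_format, of "Suc k"] by (auto simp: lookup_root_sum)
  qed
qed

lemma root_sum_in_root_lattice: "root_sum l c \<in> root_lattice l"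
proof -
  have "(\<Sum>k\<le>l. Poly_Mapping.lookup (root_sum l c) k) = (\<Sum>k<l. c k - c (Suc k)) + (c l - c 0)"
    by (simp add: lookup_root_sum lessThan_Suc_atMost[symmetric])
  also have "\<dots> = 0"
    by (simp add: sum_lessThan_telescope')
  finally show ?thesis by (auto simp: root_lattice_def in_keys_iff lookup_root_sum split: if_splits)
qed

lemma root_lattice_eq_range: "root_lattice l = range (root_sum l)"
proof (intro equalityI subsetI)
  fix x assume x: "x \<in> root_lattice l"
  \<comment> \<open>Consecutive differences of the negated partial sums return \<open>x\<close>; at
    the wrap-around from \<open>l\<close> to 0 this uses that the coordinates of \<open>x\<close>
    sum to 0.\<close>
  have "x = root_sum l (\<lambda>k. - (\<Sum>j<k. Poly_Mapping.lookup x j))"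
  proof (rule poly_mapping_eqI)
    fix k
    have "(\<Sum>j<Suc l. Poly_Mapping.lookup x j) = 0" and "k > l \<Longrightarrow> Poly_Mapping.lookup x k = 0"
      using x by (auto simp: root_lattice_def lessThan_Suc_atMost in_keys_iff subset_iff)
    then show "Poly_Mapping.lookup x k =
        Poly_Mapping.lookup (root_sum l (\<lambda>k. - (\<Sum>j<k. Poly_Mapping.lookup x j))) k"
      by (auto simp: lookup_root_sum)
  qed
  then show "x \<in> range (root_sum l)" by blast
qed (auto intro: root_sum_in_root_lattice)


section \<open>The group \<open>H\<close> as classes of label vectors\<close>

lemma frag_cmul_add_left: "frag_cmul c f + frag_cmul d f = frag_cmul (c + d) f"
  by (simp add: frag_cmul_distrib)

context simplicial_lattice_polytope
begin

lemma F_carrier [simp]: "f \<in> carrier F \<longleftrightarrow> Poly_Mapping.keys f \<subseteq> V"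
  by (simp add: F_def)

lemma keys_closed:
  assumes "Poly_Mapping.keys f \<subseteq> S" "Poly_Mapping.keys g \<subseteq> S"
  shows "Poly_Mapping.keys (f + g) \<subseteq> S" "Poly_Mapping.keys (f - g) \<subseteq> S"
  using assms keys_add[of f g] keys_diff[of f g] by blast+

lemma lookup_A_P: "Poly_Mapping.lookup (A_P m) w = (if w \<in> V then m w else 0)"
proof -
  have "Poly_Mapping.lookup (A_P m) w = (\<Sum>x\<in>V. if x = w then m x else 0)"
    unfolding A_P_def lookup_sum by (intro sum.cong) auto
  then show ?thesis using finite_V by simp
qed

lemma lookup_pF: "Poly_Mapping.lookup pF w = (if w \<in> V then 1 else 0)"
proof -
  have "Poly_Mapping.lookup pF w = (\<Sum>x\<in>V. if x = w then 1 else 0)"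
    unfolding pF_def lookup_sum by (intro sum.cong) auto
  then show ?thesis using finite_V by simp
qed

lemma keys_A_P: "Poly_Mapping.keys (A_P m) \<subseteq> V"
  by (auto simp: in_keys_iff lookup_A_P split: if_splits)

lemma keys_pF: "Poly_Mapping.keys pF \<subseteq> V"
  by (auto simp: in_keys_iff lookup_pF split: if_splits)

lemma relH_keys: "r \<in> relH \<Longrightarrow> Poly_Mapping.keys r \<subseteq> V"
  using keys_A_P keys_pF keys_cmul[of _ pF] by (fastforce simp: relH_def dest: subsetD[OF keys_add])

lemma relHI: "m \<in> M \<Longrightarrow> A_P m + frag_cmul z pF \<in> relH"
  by (auto simp: relH_def)

lemma A_P_zero: "A_P (\<lambda>_. 0) = 0"
  by (simp add: A_P_def)

lemma zero_in_M: "(\<lambda>_. 0) \<in> M"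
  by (simp add: M_def Modules.additive_def)

lemma cmul_pF_in_relH: "frag_cmul z pF \<in> relH"
  using relHI[OF zero_in_M, of z] by (simp add: A_P_zero)

lemma zero_in_relH: "0 \<in> relH"
  using cmul_pF_in_relH[of 0] by simp

lemma relH_diff:
  assumes "r \<in> relH" "r' \<in> relH"
  shows "r - r' \<in> relH"
proof -
  obtain m z m' z' where *: "m \<in> M" "r = A_P m + frag_cmul z pF" "m' \<in> M" "r' = A_P m' + frag_cmul z' pF"
    using assms by (auto simp: relH_def)
  have "(\<lambda>x. m x - m' x) \<in> M" using *(1,3) by (simp add: M_def Modules.additive_def)
  moreover have "r - r' = A_P (\<lambda>x. m x - m' x) + frag_cmul (z - z') pF"
    by (rule poly_mapping_eqI) (simp add: * lookup_add lookup_minus lookup_A_P lookup_pF)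
  ultimately show ?thesis using relHI by metis
qed

lemma relH_uminus: "r \<in> relH \<Longrightarrow> - r \<in> relH"
  using relH_diff[OF zero_in_relH] by simp

lemma relH_add: "r \<in> relH \<Longrightarrow> r' \<in> relH \<Longrightarrow> r + r' \<in> relH"
  using relH_diff[of r "- r'"] relH_uminus[of r'] by simp

lemma relH_cmul: "r \<in> relH \<Longrightarrow> frag_cmul (int n) r \<in> relH"
  by (induct n) (simp_all add: zero_in_relH relH_add frag_cmul_distrib)

lemma comm_group_F: "comm_group F"
  by (simp add: F_def abelian_free_Abelian_group)

lemma relH_normal: "relH \<lhd> F"
proof -
  interpret F: comm_group F by (rule comm_group_F)
  have "subgroup relH F"
  proof (rule F.subgroupI)
    show "relH \<subseteq> carrier F" using relH_keys by auto
    show "relH \<noteq> {}" using zero_in_relH by blast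
    show "inv\<^bsub>F\<^esub> r \<in> relH" if "r \<in> relH" for r
      using that relH_uminus relH_keys by (simp add: F_def)
    show "r \<otimes>\<^bsub>F\<^esub> r' \<in> relH" if "r \<in> relH" "r' \<in> relH" for r r'
      using that relH_add by (simp add: F_def)
  qed
  then show ?thesis by (rule F.normal_iff_subgroup[THEN iffD2])
qed

lemma deg_eq: "deg f = (\<lambda>r. r + f) ` relH"
  by (auto simp: deg_def r_coset_def F_def)

lemma deg_eq_iff: "deg f = deg g \<longleftrightarrow> f - g \<in> relH"
proof
  assume "deg f = deg g"
  moreover have "f \<in> deg f" using zero_in_relH by (force simp: deg_eq)
  ultimately show "f - g \<in> relH" by (auto simp: deg_eq)
next
  assume fg: "f - g \<in> relH"
  have "r + f \<in> deg g" if "r \<in> relH" for r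
    unfolding deg_eq using relH_add[OF that fg] by (intro image_eqI[of _ _ "r + (f - g)"]) auto
  moreover have "r + g \<in> deg f" if "r \<in> relH" for r
    unfolding deg_eq using relH_diff[OF that fg] by (intro image_eqI[of _ _ "r - (f - g)"]) auto
  ultimately show "deg f = deg g" by (auto simp: deg_eq[of f] deg_eq[of g])
qed

lemma carrier_H: "carrier H = deg ` carrier F"
  by (auto simp: H_def FactGroup_def RCOSETS_def deg_def)

lemma group_H: "group H"
  unfolding H_def by (rule normal.factorgroup_is_group[OF relH_normal])

lemma deg_hom: "group_hom F H deg"
  using normal.r_coset_hom_Mod[OF relH_normal] comm_group_F group_H
  by (auto simp: group_hom_def group_hom_axioms_def comm_group_def H_def deg_def[abs_def])

lemma deg_mult:
  assumes "Poly_Mapping.keys f \<subseteq> V" "Poly_Mapping.keys g \<subseteq> V"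
  shows "deg f \<otimes>\<^bsub>H\<^esub> deg g = deg (f + g)"
  using group_hom.hom_mult[OF deg_hom, of f g] assms by (simp add: F_def)

lemma deg_inv:
  assumes "Poly_Mapping.keys f \<subseteq> V"
  shows "inv\<^bsub>H\<^esub> deg f = deg (- f)"
  using group_hom.hom_inv[OF deg_hom, of f] assms by (simp add: F_def)

lemma deg_int_pow:
  assumes "Poly_Mapping.keys f \<subseteq> V"
  shows "deg f [^]\<^bsub>H\<^esub> (n::int) = deg (frag_cmul n f)"
  using hom_int_pow[of deg F H f n] deg_hom assms by (simp add: F_def group_hom_def group_hom_axioms_def)

lemma deg_add_relH: "r \<in> relH \<Longrightarrow> deg (f + r) = deg f"
  by (simp add: deg_eq_iff)

end


section \<open>Displacements of label vectors\<close>

context labelled_polytope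
begin

text \<open>The displacement of a path with label \<open>f\<close> in the cover, extended to all
  label vectors. On \<open>F\<close> it is the surjection onto \<open>LL\<close> with kernel spanned
  by \<open>sF\<close> and \<open>pF\<close>, by which statements on vertices are moved to
  \<open>F\<close>.\<close>

definition disp :: "(int ^ 'n \<Rightarrow>\<^sub>0 int) \<Rightarrow> vertex" where
  "disp f = (root_sum l (\<lambda>i. Poly_Mapping.lookup f (v i)), root_sum l' (\<lambda>j. Poly_Mapping.lookup f (v' j)))"

definition sF :: "int ^ 'n \<Rightarrow>\<^sub>0 int" where "sF = (\<Sum>i\<le>l. e i)"

lemma v_in_V [simp]: "i \<le> l \<Longrightarrow> v i \<in> V" "j \<le> l' \<Longrightarrow> v' j \<in> V"
  using vertices by auto

lemma v_neq_v' [simp]: "i \<le> l \<Longrightarrow> j \<le> l' \<Longrightarrow> v i \<noteq> v' j" "i \<le> l \<Longrightarrow> j \<le> l' \<Longrightarrow> v' j \<noteq> v i"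
  using disjoint by auto

lemma v_eq_iff [simp]: "i \<le> l \<Longrightarrow> i' \<le> l \<Longrightarrow> v i = v i' \<longleftrightarrow> i = i'"
  "j \<le> l' \<Longrightarrow> j' \<le> l' \<Longrightarrow> v' j = v' j' \<longleftrightarrow> j = j'"
  using inj_v inj_v' by (auto simp: inj_on_def)

lemma lookup_combination:
  fixes a b :: "nat \<Rightarrow> int"
  defines "f \<equiv> (\<Sum>i\<le>l. frag_cmul (a i) (e i)) + (\<Sum>j\<le>l'. frag_cmul (b j) (e' j))"
  shows "i \<le> l \<Longrightarrow> Poly_Mapping.lookup f (v i) = a i"
    and "j \<le> l' \<Longrightarrow> Poly_Mapping.lookup f (v' j) = b j"
    and "Poly_Mapping.keys f \<subseteq> V"
proof -
  have f: "Poly_Mapping.lookup f w = (\<Sum>i\<le>l. if v i = w then a i else 0) + (\<Sum>j\<le>l'. if v' j = w then b j else 0)" for w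
    unfolding f_def lookup_add lookup_sum
    by (intro arg_cong2[of _ _ _ _ "(+)"] sum.cong) (auto simp: e_def e'_def)
  show "Poly_Mapping.lookup f (v i) = a i" if "i \<le> l"
  proof -
    have "(\<Sum>i'\<le>l. if v i' = v i then a i' else 0) = (\<Sum>i'\<le>l. if i' = i then a i' else 0)"
      using that by (intro sum.cong) auto
    moreover have "(\<Sum>j\<le>l'. if v' j = v i then b j else 0) = 0"
      using that by (intro sum.neutral) auto
    ultimately show ?thesis using that by (simp add: f)
  qed
  show "Poly_Mapping.lookup f (v' j) = b j" if "j \<le> l'"
  proof -
    have "(\<Sum>j'\<le>l'. if v' j' = v' j then b j' else 0) = (\<Sum>j'\<le>l'. if j' = j then b j' else 0)"
      using that by (intro sum.cong) auto
    moreover have "(\<Sum>i\<le>l. if v i = v' j then a i else 0) = 0"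
      using that by (intro sum.neutral) auto
    ultimately show ?thesis using that by (simp add: f)
  qed
  show "Poly_Mapping.keys f \<subseteq> V"
  proof
    fix w assume w: "w \<in> Poly_Mapping.keys f"
    show "w \<in> V"
    proof (rule ccontr)
      assume "w \<notin> V"
      then have "v i \<noteq> w" if "i \<le> l" for i using that v_in_V by metis
      moreover have "v' j \<noteq> w" if "j \<le> l'" for j using \<open>w \<notin> V\<close> that v_in_V by metis
      ultimately have "(\<Sum>i\<le>l. if v i = w then a i else 0) = 0" "(\<Sum>j\<le>l'. if v' j = w then b j else 0) = 0"
        by (auto intro!: sum.neutral)
      then have "Poly_Mapping.lookup f w = 0" by (simp add: f)
      then show False using w by (simp add: in_keys_iff)
    qed
  qed
qed

lemma F_eqI:
  assumes "Poly_Mapping.keys f \<subseteq> V" "Poly_Mapping.keys g \<subseteq> V"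
    and "\<And>i. i \<le> l \<Longrightarrow> Poly_Mapping.lookup f (v i) = Poly_Mapping.lookup g (v i)"
    and "\<And>j. j \<le> l' \<Longrightarrow> Poly_Mapping.lookup f (v' j) = Poly_Mapping.lookup g (v' j)"
  shows "f = g"
proof (rule poly_mapping_eqI)
  fix w
  show "Poly_Mapping.lookup f w = Poly_Mapping.lookup g w"
  proof (cases "w \<in> V")
    case True
    then show ?thesis using vertices assms(3,4) by auto
  next
    case False
    then have "w \<notin> Poly_Mapping.keys f" "w \<notin> Poly_Mapping.keys g" using assms(1,2) by auto
    then show ?thesis by (simp add: in_keys_iff)
  qed
qed

lemma F_eq_combination:
  assumes "Poly_Mapping.keys f \<subseteq> V"
  shows "(\<Sum>i\<le>l. frag_cmul (Poly_Mapping.lookup f (v i)) (e i))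
    + (\<Sum>j\<le>l'. frag_cmul (Poly_Mapping.lookup f (v' j)) (e' j)) = f"
  by (rule F_eqI) (simp_all add: lookup_combination assms)

lemma keys_e [simp]: "i \<le> l \<Longrightarrow> Poly_Mapping.keys (e i) \<subseteq> V" "j \<le> l' \<Longrightarrow> Poly_Mapping.keys (e' j) \<subseteq> V"
  by (simp_all add: e_def e'_def)

lemma lookup_e [simp]:
  "i \<le> l \<Longrightarrow> i' \<le> l \<Longrightarrow> Poly_Mapping.lookup (e i) (v i') = (if i' = i then 1 else 0)"
  "i \<le> l \<Longrightarrow> j \<le> l' \<Longrightarrow> Poly_Mapping.lookup (e i) (v' j) = 0"
  "j \<le> l' \<Longrightarrow> j' \<le> l' \<Longrightarrow> Poly_Mapping.lookup (e' j) (v' j') = (if j' = j then 1 else 0)"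
  "j \<le> l' \<Longrightarrow> i \<le> l \<Longrightarrow> Poly_Mapping.lookup (e' j) (v i) = 0"
  by (auto simp: e_def e'_def)

lemma lookup_pF_v [simp]:
  "i \<le> l \<Longrightarrow> Poly_Mapping.lookup pF (v i) = 1" "j \<le> l' \<Longrightarrow> Poly_Mapping.lookup pF (v' j) = 1"
  by (simp_all add: lookup_pF)

lemma sF_eq: "sF = (\<Sum>i\<le>l. frag_cmul 1 (e i)) + (\<Sum>j\<le>l'. frag_cmul 0 (e' j))"
  by (simp add: sF_def)

lemma keys_sF [simp]: "Poly_Mapping.keys sF \<subseteq> V"
  unfolding sF_eq by (rule lookup_combination)

lemma lookup_sF [simp]:
  "i \<le> l \<Longrightarrow> Poly_Mapping.lookup sF (v i) = 1" "j \<le> l' \<Longrightarrow> Poly_Mapping.lookup sF (v' j) = 0"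
  unfolding sF_eq by (simp_all only: lookup_combination)

lemma keys_cmul_sF [simp]: "Poly_Mapping.keys (frag_cmul n sF) \<subseteq> V" "Poly_Mapping.keys (frag_cmul n pF) \<subseteq> V"
  by (rule order_trans[OF keys_cmul keys_sF], rule order_trans[OF keys_cmul keys_pF])

lemma disp_zero [simp]: "disp 0 = 0"
  by (simp add: disp_def root_sum_const zero_prod_def)

lemma disp_add: "disp (f + g) = disp f + disp g"
  by (simp add: disp_def lookup_add root_sum_add)

lemma disp_uminus: "disp (- f) = - disp f"
  using disp_add[of "- f" f] by (simp add: eq_neg_iff_add_eq_0)

lemma disp_diff: "disp (f - g) = disp f - disp g"
  using disp_add[of f "- g"] by (simp add: disp_uminus)

lemma disp_eq_iff:
  "disp f = disp g \<longleftrightarrow>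
    (\<forall>i\<le>l. Poly_Mapping.lookup f (v i) - Poly_Mapping.lookup g (v i)
      = Poly_Mapping.lookup f (v 0) - Poly_Mapping.lookup g (v 0)) \<and>
    (\<forall>j\<le>l'. Poly_Mapping.lookup f (v' j) - Poly_Mapping.lookup g (v' j)
      = Poly_Mapping.lookup f (v' 0) - Poly_Mapping.lookup g (v' 0))"
  by (simp add: disp_def root_sum_eq_iff)

lemma disp_sF: "disp (f + frag_cmul n sF) = disp f"
  by (simp add: disp_eq_iff lookup_add)

lemma disp_pF: "disp (f + frag_cmul n pF) = disp f"
  by (simp add: disp_eq_iff lookup_add)

lemma disp_eq_D:
  assumes "Poly_Mapping.keys f \<subseteq> V" "Poly_Mapping.keys g \<subseteq> V" "disp f = disp g"
  obtains n z where "f = g + frag_cmul n sF + frag_cmul z pF"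
proof
  \<comment> \<open>Primed coordinates see only \<open>pF\<close>, which determines its coefficient;
    unprimed coordinates see both, so the coefficient of \<open>sF\<close> is the difference of the
    two discrepancies.\<close>
  show "f = g + frag_cmul (Poly_Mapping.lookup f (v 0) - Poly_Mapping.lookup g (v 0)
        - (Poly_Mapping.lookup f (v' 0) - Poly_Mapping.lookup g (v' 0))) sF
      + frag_cmul (Poly_Mapping.lookup f (v' 0) - Poly_Mapping.lookup g (v' 0)) pF"
    (is "f = g + frag_cmul ?a sF + frag_cmul ?b pF")
  proof (rule F_eqI)
    fix i assume "i \<le> l"
    moreover from this have "Poly_Mapping.lookup f (v i) - Poly_Mapping.lookup g (v i)
        = Poly_Mapping.lookup f (v 0) - Poly_Mapping.lookup g (v 0)"
      using assms(3) unfolding disp_eq_iff by blast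
    ultimately show "Poly_Mapping.lookup f (v i) = Poly_Mapping.lookup (g + frag_cmul ?a sF + frag_cmul ?b pF) (v i)"
      by (simp add: lookup_add)
  next
    fix j assume "j \<le> l'"
    moreover from this have "Poly_Mapping.lookup f (v' j) - Poly_Mapping.lookup g (v' j)
        = Poly_Mapping.lookup f (v' 0) - Poly_Mapping.lookup g (v' 0)"
      using assms(3) unfolding disp_eq_iff by blast
    ultimately show "Poly_Mapping.lookup f (v' j) = Poly_Mapping.lookup (g + frag_cmul ?a sF + frag_cmul ?b pF) (v' j)"
      by (simp add: lookup_add)
  qed (intro keys_closed assms keys_cmul_sF)+
qed

lemma disp_in_LL: "disp f \<in> LL"
  by (simp add: disp_def LL_def root_sum_in_root_lattice)

lemma LL_E:
  assumes "x \<in> LL"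
  obtains f where "Poly_Mapping.keys f \<subseteq> V" "x = disp f"
proof -
  obtain a b where x: "x = (root_sum l a, root_sum l' b)"
    using assms by (auto simp: LL_def root_lattice_eq_range)
  let ?f = "(\<Sum>i\<le>l. frag_cmul (a i) (e i)) + (\<Sum>j\<le>l'. frag_cmul (b j) (e' j))"
  have "x = disp ?f"
    unfolding x disp_def by (simp add: root_sum_eq_iff lookup_combination)
  with lookup_combination(3)[of a b] show thesis by (rule that)
qed

section \<open>The values of \<open>Psi\<close> and its kernel \<open>B\<close>\<close>

lemma s_eq: "s = deg sF"
  by (simp add: s_def sF_def)

lemma generate_s: "generate H {s} = {deg (frag_cmul n sF) | n. True}"
proof -
  have "s \<in> carrier H" by (auto simp: s_eq carrier_H intro!: imageI)
  from group.generate_pow[OF group_H this] show ?thesis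
    by (auto simp: s_eq deg_int_pow)
qed

text \<open>An expression of a vertex in the roots is the same as a label vector with that
  displacement, so \<open>Psi\<close> is the image of a fibre of \<open>disp\<close> under
  \<open>deg\<close>.\<close>

lemma Psi_disp: "Psi (disp f) = {deg g | g. Poly_Mapping.keys g \<subseteq> V \<and> disp g = disp f}"
proof (intro equalityI subsetI)
  fix h assume "h \<in> Psi (disp f)"
  then obtain a b where h: "h = deg ((\<Sum>i\<le>l. frag_cmul (a i) (e i)) + (\<Sum>j\<le>l'. frag_cmul (b j) (e' j)))" (is "_ = deg ?g")
    and f: "disp f = (root_sum l a, root_sum l' b)"
    by (auto simp: Psi_def root_sum_def)
  have "disp ?g = (root_sum l a, root_sum l' b)"
    unfolding disp_def by (simp add: root_sum_eq_iff lookup_combination)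
  then have "disp ?g = disp f" using f by simp
  then show "h \<in> {deg g | g. Poly_Mapping.keys g \<subseteq> V \<and> disp g = disp f}"
    using h lookup_combination(3) by blast
next
  fix h assume "h \<in> {deg g | g. Poly_Mapping.keys g \<subseteq> V \<and> disp g = disp f}"
  then obtain g where g: "h = deg g" "Poly_Mapping.keys g \<subseteq> V" "disp g = disp f" by auto
  show "h \<in> Psi (disp f)"
    unfolding Psi_def
  proof (intro CollectI exI conjI)
    show "h = deg ((\<Sum>i\<le>l. frag_cmul (Poly_Mapping.lookup g (v i)) (e i))
      + (\<Sum>j\<le>l'. frag_cmul (Poly_Mapping.lookup g (v' j)) (e' j)))"
      unfolding F_eq_combination[OF g(2)] by (rule g(1))
    show "disp f = (\<Sum>i\<le>l. frag_cmul (Poly_Mapping.lookup g (v i)) (root l i),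
      \<Sum>j\<le>l'. frag_cmul (Poly_Mapping.lookup g (v' j)) (root l' j))"
      unfolding g(3)[symmetric] by (simp only: disp_def root_sum_def)
  qed
qed

lemma Psi_disp_sF:
  assumes "Poly_Mapping.keys f \<subseteq> V"
  shows "Psi (disp f) = {deg (f + frag_cmul n sF) | n. True}"
  unfolding Psi_disp
proof (intro equalityI subsetI)
  fix h assume "h \<in> {deg g | g. Poly_Mapping.keys g \<subseteq> V \<and> disp g = disp f}"
  then obtain g where g: "h = deg g" "Poly_Mapping.keys g \<subseteq> V" "disp g = disp f" by auto
  obtain n z where "g = f + frag_cmul n sF + frag_cmul z pF"
    by (rule disp_eq_D[OF g(2) assms g(3)])
  then have "h = deg (f + frag_cmul n sF)" using g(1) deg_add_relH cmul_pF_in_relH by simp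
  then show "h \<in> {deg (f + frag_cmul n sF) | n. True}" by blast
next
  fix h assume "h \<in> {deg (f + frag_cmul n sF) | n. True}"
  then obtain n where "h = deg (f + frag_cmul n sF)" by auto
  moreover have "Poly_Mapping.keys (f + frag_cmul n sF) \<subseteq> V"
    by (intro keys_closed assms keys_cmul_sF)
  ultimately show "h \<in> {deg g | g. Poly_Mapping.keys g \<subseteq> V \<and> disp g = disp f}"
    using disp_sF[of f n] by blast
qed

text \<open>Lying in the kernel of \<open>Psi\<close> means that \<open>deg f\<close> is a multiple
  of \<open>s\<close>. Removing that multiple of \<open>sF\<close> leaves the displacement unchanged
  and puts the label vector into \<open>relH\<close>.\<close>

lemma B_eq: "B = disp ` relH"
proof (intro equalityI subsetI)
  fix x assume "x \<in> B"
  then have x: "x \<in> LL" "Psi x = generate H {s}" by (auto simp: B_def HZs_def FactGroup_def)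
  obtain f where f: "Poly_Mapping.keys f \<subseteq> V" "x = disp f" by (rule LL_E[OF x(1)])
  have "deg f \<in> Psi x" using f Psi_disp by auto
  then obtain n where "deg f = deg (frag_cmul n sF)" using x(2) generate_s by auto
  then have "f - frag_cmul n sF \<in> relH" by (simp add: deg_eq_iff)
  moreover have "disp (f - frag_cmul n sF) = x" using disp_sF[of 0 n] f(2) by (simp add: disp_diff)
  ultimately show "x \<in> disp ` relH" by blast
next
  fix x assume "x \<in> disp ` relH"
  then obtain r where r: "r \<in> relH" "x = disp r" by auto
  have "deg (r + frag_cmul n sF) = deg (frag_cmul n sF)" for n
    using r(1) by (simp add: deg_eq_iff)
  then have "Psi x = generate H {s}"
    using Psi_disp_sF[OF relH_keys[OF r(1)]] r(2) generate_s by simp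
  then show "x \<in> B" using disp_in_LL r(2) by (simp add: B_def HZs_def FactGroup_def)
qed

lemma zero_in_B: "0 \<in> B"
  unfolding B_eq using zero_in_relH by (rule rev_image_eqI) simp

lemma B_add: "b \<in> B \<Longrightarrow> b' \<in> B \<Longrightarrow> b + b' \<in> B"
  unfolding B_eq by (elim imageE) (simp add: disp_add[symmetric] relH_add)

lemma B_uminus: "b \<in> B \<Longrightarrow> - b \<in> B"
  unfolding B_eq by (elim imageE) (simp add: disp_uminus[symmetric] relH_uminus)

lemma B_subset_LL: "B \<subseteq> LL"
  using disp_in_LL by (auto simp: B_eq)

lemma vertex_orbit_eq_iff: "vertex_orbit x = vertex_orbit y \<longleftrightarrow> y - x \<in> B"
proof
  assume "vertex_orbit x = vertex_orbit y"
  moreover have "y \<in> vertex_orbit y"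
    unfolding vertex_orbit_def using zero_in_B by (rule rev_image_eqI) simp
  ultimately have "y \<in> vertex_orbit x" by simp
  then obtain b where "b \<in> B" "y = x + b" unfolding vertex_orbit_def by blast
  then show "y - x \<in> B" by simp
next
  have sub: "vertex_orbit y \<subseteq> vertex_orbit x" if b: "y - x \<in> B" for x y
  proof
    fix z assume "z \<in> vertex_orbit y"
    then obtain b' where b': "b' \<in> B" "z = y + b'" by (auto simp: vertex_orbit_def)
    then have "z = x + ((y - x) + b')" by (simp add: algebra_simps)
    then show "z \<in> vertex_orbit x"
      unfolding vertex_orbit_def using B_add[OF b b'(1)] by (rule image_eqI)
  qed
  assume b: "y - x \<in> B"
  then have "x - y \<in> B" using B_uminus by fastforce
  with b show "vertex_orbit x = vertex_orbit y" using sub by blast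
qed


section \<open>The representatives \<open>J\<close> and the arrows of the quiver\<close>

text \<open>The order on \<open>H\<close> comes from the coordinatewise order on \<open>F\<close>,
  reversed on the primed coordinates.\<close>

lemma geH_degI:
  assumes "Poly_Mapping.keys f \<subseteq> V" "Poly_Mapping.keys g \<subseteq> V"
    and "\<And>i. i \<le> l \<Longrightarrow> Poly_Mapping.lookup g (v i) \<le> Poly_Mapping.lookup f (v i)"
    and "\<And>j. j \<le> l' \<Longrightarrow> Poly_Mapping.lookup f (v' j) \<le> Poly_Mapping.lookup g (v' j)"
  shows "geH (deg f) (deg g)"
proof -
  define a where "a = (\<lambda>i. nat (Poly_Mapping.lookup f (v i) - Poly_Mapping.lookup g (v i)))"
  define b where "b = (\<lambda>j. nat (Poly_Mapping.lookup g (v' j) - Poly_Mapping.lookup f (v' j)))"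
  have keys: "Poly_Mapping.keys (f - g) \<subseteq> V" by (intro keys_closed assms)
  have "deg f \<otimes>\<^bsub>H\<^esub> inv\<^bsub>H\<^esub> deg g = deg (f - g)"
    using assms(1,2) by (simp add: deg_inv deg_mult)
  also have "f - g = (\<Sum>i\<le>l. frag_cmul (int (a i)) (e i)) + (\<Sum>j\<le>l'. frag_cmul (- int (b j)) (e' j))"
    by (rule F_eqI[OF keys lookup_combination(3)])
      (simp_all only: lookup_combination, simp_all add: lookup_minus a_def b_def assms)
  also have "(\<Sum>j\<le>l'. frag_cmul (- int (b j)) (e' j)) = (\<Sum>j\<le>l'. frag_cmul (int (b j)) (- e' j))"
    by (rule sum.cong[OF refl], rule poly_mapping_eqI) simp
  finally show ?thesis unfolding geH_def by blast
qed

end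

context upper_set
begin

definition in_I :: "(int ^ 'n \<Rightarrow>\<^sub>0 int) \<Rightarrow> bool" where
  "in_I f \<longleftrightarrow> deg f \<in> I"

text \<open>Membership of \<open>deg f\<close> in \<open>J\<close>, without cosets: lying in the
  shifted complement of \<open>I\<close> means that subtracting \<open>sF\<close> leaves
  \<open>I\<close>. Arrows can then be followed by adding their labels to \<open>f\<close>.\<close>

definition in_J :: "(int ^ 'n \<Rightarrow>\<^sub>0 int) \<Rightarrow> bool" where
  "in_J f \<longleftrightarrow> Poly_Mapping.keys f \<subseteq> V \<and> in_I f \<and> \<not> in_I (f - sF)"

lemma in_J_keys: "in_J f \<Longrightarrow> Poly_Mapping.keys f \<subseteq> V"
  by (simp add: in_J_def)

lemma in_I_mono:
  assumes "in_I g" "Poly_Mapping.keys f \<subseteq> V" "Poly_Mapping.keys g \<subseteq> V"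
    and "\<And>i. i \<le> l \<Longrightarrow> Poly_Mapping.lookup g (v i) \<le> Poly_Mapping.lookup f (v i)"
    and "\<And>j. j \<le> l' \<Longrightarrow> Poly_Mapping.lookup f (v' j) \<le> Poly_Mapping.lookup g (v' j)"
  shows "in_I f"
  using I_upper[of "deg f" "deg g"] geH_degI[of f g] assms carrier_H by (simp add: in_I_def)

lemma in_I_cmul_sF:
  assumes "in_I (f + frag_cmul n sF)" "Poly_Mapping.keys f \<subseteq> V" "n \<le> n'"
  shows "in_I (f + frag_cmul n' sF)"
  by (rule in_I_mono[OF assms(1)]) (simp_all add: keys_closed assms lookup_add)

lemma in_I_add_relH: "r \<in> relH \<Longrightarrow> in_I (f + r) \<longleftrightarrow> in_I f"
  by (simp add: in_I_def deg_add_relH)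

lemma in_J_add_relH:
  assumes "r \<in> relH"
  shows "in_J (f + r) \<longleftrightarrow> in_J f"
proof -
  have "Poly_Mapping.keys (f + r) \<subseteq> V \<longleftrightarrow> Poly_Mapping.keys f \<subseteq> V"
    using keys_closed(1)[of f V r] keys_closed(2)[of "f + r" V r] relH_keys[OF assms] by auto
  moreover have "f + r - sF = (f - sF) + r" by simp
  ultimately show ?thesis
    unfolding in_J_def using in_I_add_relH[OF assms] by metis
qed

lemma lookup_diff_bounded:
  assumes "Poly_Mapping.keys f \<subseteq> V" "Poly_Mapping.keys g \<subseteq> V"
  shows "\<exists>n::nat. \<forall>w. \<bar>Poly_Mapping.lookup f w - Poly_Mapping.lookup g w\<bar> \<le> int n"
proof (intro exI allI)
  show "\<bar>Poly_Mapping.lookup f w - Poly_Mapping.lookup g w\<bar>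
    \<le> int (nat (\<Sum>w\<in>V. \<bar>Poly_Mapping.lookup f w - Poly_Mapping.lookup g w\<bar>))" for w
  proof (cases "w \<in> V")
    case True
    then have "\<bar>Poly_Mapping.lookup f w - Poly_Mapping.lookup g w\<bar>
      \<le> (\<Sum>w\<in>V. \<bar>Poly_Mapping.lookup f w - Poly_Mapping.lookup g w\<bar>)"
      by (intro member_le_sum finite_V) auto
    then show ?thesis by simp
  next
    case False
    then have "Poly_Mapping.lookup f w = 0" "Poly_Mapping.lookup g w = 0"
      using assms by (auto simp: in_keys_iff)
    then show ?thesis by simp
  qed
qed

text \<open>
  Modulo \<open>relH\<close>, the class of \<open>2 n sF\<close> is that of \<open>\<Sum>\<^sub>i n e\<^sub>i - \<Sum>\<^sub>j n e'\<^sub>j\<close>, which dominates every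
  label vector with coordinates at most \<open>n\<close> in absolute value.
\<close>

lemma in_I_dominate:
  assumes "Poly_Mapping.keys f \<subseteq> V" "Poly_Mapping.keys g \<subseteq> V" "in_I g"
    and "\<And>w. \<bar>Poly_Mapping.lookup f w - Poly_Mapping.lookup g w\<bar> \<le> n"
  shows "in_I (f + frag_cmul (2 * n) sF)"
proof -
  have "in_I (f + frag_cmul (2 * n) sF + frag_cmul (- n) pF)"
  proof (rule in_I_mono[OF assms(3)])
    fix i assume "i \<le> l"
    then show "Poly_Mapping.lookup g (v i) \<le> Poly_Mapping.lookup (f + frag_cmul (2 * n) sF + frag_cmul (- n) pF) (v i)"
      using assms(4)[of "v i"] by (simp add: lookup_add)
  next
    fix j assume "j \<le> l'"
    then show "Poly_Mapping.lookup (f + frag_cmul (2 * n) sF + frag_cmul (- n) pF) (v' j) \<le> Poly_Mapping.lookup g (v' j)"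
      using assms(4)[of "v' j"] by (simp add: lookup_add)
  qed (intro keys_closed assms keys_cmul_sF)+
  then show ?thesis using in_I_add_relH[OF cmul_pF_in_relH] by blast
qed

text \<open>On the line \<open>f + frag_cmul n sF\<close> membership in \<open>I\<close> is monotone
  in \<open>n\<close>. It holds far up, by domination of an element of \<open>I\<close>, and fails
  far down, where otherwise an element outside \<open>I\<close> would dominate. The first index in
  \<open>I\<close> is the one in \<open>J\<close>.\<close>

lemma ex_in_J:
  assumes f: "Poly_Mapping.keys f \<subseteq> V"
  obtains n where "in_J (f + frag_cmul n sF)"
proof -
  obtain h where "h \<in> I" using I_nonempty by auto
  then obtain g where g: "Poly_Mapping.keys g \<subseteq> V" "in_I g"
    using I_subset by (auto simp: in_I_def carrier_H)
  obtain m :: nat where m: "\<bar>Poly_Mapping.lookup f w - Poly_Mapping.lookup g w\<bar> \<le> int m" for w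
    using lookup_diff_bounded[OF f g(1)] by blast
  have up: "in_I (f + frag_cmul (2 * int m) sF)"
    by (rule in_I_dominate[OF f g m])
  obtain h' where "h' \<in> carrier H" "h' \<notin> I" using I_proper I_subset by auto
  then obtain g' where g': "Poly_Mapping.keys g' \<subseteq> V" "\<not> in_I g'"
    by (auto simp: in_I_def carrier_H)
  obtain m' :: nat where m': "\<bar>Poly_Mapping.lookup g' w - Poly_Mapping.lookup f w\<bar> \<le> int m'" for w
    using lookup_diff_bounded[OF g'(1) f] by blast
  have low: "\<not> in_I (f + frag_cmul n sF)" if n: "n \<le> - (2 * int m')" for n
  proof
    assume "in_I (f + frag_cmul n sF)"
    then have "in_I (f + frag_cmul (- (2 * int m')) sF)" by (rule in_I_cmul_sF[OF _ f n])
    then have "in_I (g' + frag_cmul (- (2 * int m')) sF + frag_cmul (2 * int m') sF)"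
      by (intro in_I_dominate[where g = "f + frag_cmul (- (2 * int m')) sF"] keys_closed keys_cmul_sF f g')
        (simp_all add: lookup_add m')
    moreover have "g' + frag_cmul (- (2 * int m')) sF + frag_cmul (2 * int m') sF = g'"
      by (rule poly_mapping_eqI) (simp add: lookup_add)
    ultimately show False using g'(2) by simp
  qed
  \<comment> \<open>The shift by \<open>2 * int m'\<close> lets the least index be taken among
    natural numbers; index 0 is still outside \<open>I\<close>, so \<open>k - 1\<close> is a genuine
    predecessor.\<close>
  define S where "S = {k::nat. in_I (f + frag_cmul (int k - 2 * int m') sF)}"
  have "nat (2 * int m + 2 * int m') \<in> S" using up by (simp add: S_def)
  define k where "k = (LEAST k. k \<in> S)"
  have "k \<in> S" unfolding k_def using \<open>_ \<in> S\<close> by (rule LeastI)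
  then have k: "in_I (f + frag_cmul (int k - 2 * int m') sF)" by (simp add: S_def)
  have "k \<noteq> 0"
  proof
    assume "k = 0"
    then show False using k low[of "- (2 * int m')"] by simp
  qed
  then have "k - 1 \<notin> S" using not_less_Least[of "k - 1" "\<lambda>k. k \<in> S"] by (simp add: k_def)
  moreover have "f + frag_cmul (int k - 2 * int m') sF - sF = f + frag_cmul (int (k - 1) - 2 * int m') sF"
    using \<open>k \<noteq> 0\<close> by (intro poly_mapping_eqI) (simp add: lookup_add lookup_minus of_nat_diff algebra_simps)
  ultimately have "\<not> in_I (f + frag_cmul (int k - 2 * int m') sF - sF)" by (simp only: S_def mem_Collect_eq not_False_eq_True)
  then have "in_J (f + frag_cmul (int k - 2 * int m') sF)"
    unfolding in_J_def using k keys_closed(1)[OF f keys_cmul_sF(1)] by blast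
  then show thesis by (rule that)
qed

text \<open>Of two distinct points of the line in \<open>J\<close>, the upper one minus
  \<open>sF\<close> would still be at or above the lower one, hence in \<open>I\<close>.\<close>

lemma in_J_unique:
  assumes "in_J f" "in_J (f + frag_cmul n sF)"
  shows "n = 0"
proof (rule ccontr)
  assume "n \<noteq> 0"
  have f: "Poly_Mapping.keys f \<subseteq> V" using assms(1) by (rule in_J_keys)
  have eq: "f + frag_cmul n sF - sF = f + frag_cmul (n - 1) sF" "f - sF = f + frag_cmul (- 1) sF"
    by (rule poly_mapping_eqI, simp add: lookup_add lookup_minus algebra_simps)+
  show False
  proof (cases "n > 0")
    case True
    have "in_I (f + frag_cmul 0 sF)" using assms(1) by (simp add: in_J_def)
    then have "in_I (f + frag_cmul (n - 1) sF)" by (rule in_I_cmul_sF[OF _ f]) (use True in simp)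
    then show False using assms(2) unfolding in_J_def eq(1) by blast
  next
    case False
    have "in_I (f + frag_cmul n sF)" using assms(2) by (simp add: in_J_def)
    then have "in_I (f + frag_cmul (- 1) sF)"
      by (rule in_I_cmul_sF[OF _ f]) (use False \<open>n \<noteq> 0\<close> in simp)
    then show False using assms(1) unfolding in_J_def eq(2) by blast
  qed
qed

text \<open>Two lifts of a vertex differ by multiples of \<open>sF\<close> and \<open>pF\<close>,
  and \<open>in_J\<close> fixes the former. Labels of paths with equal ends are compared through
  this.\<close>

lemma in_J_disp_eq:
  assumes "in_J f" "in_J g" "disp f = disp g"
  obtains z where "f = g + frag_cmul z pF"
proof -
  obtain n z where f: "f = g + frag_cmul n sF + frag_cmul z pF"
    by (rule disp_eq_D[OF in_J_keys[OF assms(1)] in_J_keys[OF assms(2)] assms(3)])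
  then have "in_J (g + frag_cmul n sF)"
    using assms(1) in_J_add_relH[OF cmul_pF_in_relH] by simp
  then have "n = 0" by (rule in_J_unique[OF assms(2)])
  then show thesis using f that by simp
qed

lemma ex_in_J_disp:
  assumes "x \<in> LL"
  obtains f where "in_J f" "disp f = x"
proof -
  obtain f where f: "Poly_Mapping.keys f \<subseteq> V" "x = disp f" by (rule LL_E[OF assms])
  obtain n where "in_J (f + frag_cmul n sF)" by (rule ex_in_J[OF f(1)])
  then show thesis by (rule that) (simp add: disp_sF f(2))
qed

lemma deg_in_J_iff:
  assumes f: "Poly_Mapping.keys f \<subseteq> V"
  shows "deg f \<in> J \<longleftrightarrow> in_J f"
proof -
  have "deg f \<in> (carrier H - I) #>\<^bsub>H\<^esub> s \<longleftrightarrow> \<not> in_I (f - sF)"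
  proof
    assume "deg f \<in> (carrier H - I) #>\<^bsub>H\<^esub> s"
    then obtain h where "h \<in> carrier H - I" "deg f = h \<otimes>\<^bsub>H\<^esub> s"
      by (auto simp: r_coset_def)
    then obtain g where g: "Poly_Mapping.keys g \<subseteq> V" "\<not> in_I g" "deg f = deg g \<otimes>\<^bsub>H\<^esub> deg sF"
      by (auto simp: carrier_H in_I_def s_eq)
    then have "deg f = deg (g + sF)" by (simp add: deg_mult)
    then have "deg (f - sF) = deg g" by (simp add: deg_eq_iff algebra_simps)
    then show "\<not> in_I (f - sF)" using g(2) by (simp add: in_I_def)
  next
    assume "\<not> in_I (f - sF)"
    moreover have keys: "Poly_Mapping.keys (f - sF) \<subseteq> V" by (intro keys_closed f keys_sF)
    ultimately have "deg (f - sF) \<in> carrier H - I" by (auto simp: in_I_def carrier_H)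
    moreover have "deg f = deg (f - sF) \<otimes>\<^bsub>H\<^esub> s" using keys by (simp add: s_eq deg_mult)
    ultimately show "deg f \<in> (carrier H - I) #>\<^bsub>H\<^esub> s" by (auto simp: r_coset_def)
  qed
  then show ?thesis using f by (simp add: J_def in_J_def in_I_def)
qed

lemma rep_disp:
  assumes "in_J f"
  shows "rep (disp f) = deg f"
  unfolding rep_def
proof (rule the_equality)
  have f: "Poly_Mapping.keys f \<subseteq> V" using assms by (rule in_J_keys)
  show "deg f \<in> J \<and> deg f \<in> Psi (disp f)"
    using f assms by (auto simp: deg_in_J_iff Psi_disp)
  fix h assume "h \<in> J \<and> h \<in> Psi (disp f)"
  then obtain n where h: "deg (f + frag_cmul n sF) \<in> J" "h = deg (f + frag_cmul n sF)"
    by (auto simp: Psi_disp_sF[OF f])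
  then have "in_J (f + frag_cmul n sF)"
    using deg_in_J_iff[of "f + frag_cmul n sF"] keys_closed(1)[OF f keys_cmul_sF(1)] by blast
  then have "n = 0" by (rule in_J_unique[OF assms])
  then show "h = deg f" using h(2) by simp
qed

section \<open>Arrows of the cover as steps between lifts in \<open>J\<close>\<close>

fun valid_type :: "arrow_type \<Rightarrow> bool" where
  "valid_type (Fst i) \<longleftrightarrow> i \<le> l"
| "valid_type (Snd j) \<longleftrightarrow> j \<le> l'"
| "valid_type (Diag i j) \<longleftrightarrow> i \<le> l \<and> j \<le> l'"

lemma keys_type_label: "valid_type t \<Longrightarrow> Poly_Mapping.keys (type_label t) \<subseteq> V"
  by (cases t) (simp_all add: keys_closed)

lemma disp_e: "i \<le> l \<Longrightarrow> disp (e i) = (root l i, 0)" "j \<le> l' \<Longrightarrow> disp (e' j) = (0, root l' j)"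
proof -
  assume i: "i \<le> l"
  have "root_sum l (\<lambda>k. Poly_Mapping.lookup (e i) (v k)) = root_sum l (\<lambda>k. if k = i then 1 else 0)"
    using i by (subst root_sum_eq_iff) simp
  moreover have "root_sum l' (\<lambda>k. Poly_Mapping.lookup (e i) (v' k)) = root_sum l' (\<lambda>k. 0)"
    using i by (subst root_sum_eq_iff) simp
  ultimately show "disp (e i) = (root l i, 0)"
    using i by (simp add: disp_def root_sum_single root_sum_const)
next
  assume j: "j \<le> l'"
  have "root_sum l (\<lambda>k. Poly_Mapping.lookup (e' j) (v k)) = root_sum l (\<lambda>k. 0)"
    using j by (subst root_sum_eq_iff) simp
  moreover have "root_sum l' (\<lambda>k. Poly_Mapping.lookup (e' j) (v' k)) = root_sum l' (\<lambda>k. if k = j then 1 else 0)"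
    using j by (subst root_sum_eq_iff) simp
  ultimately show "disp (e' j) = (0, root l' j)"
    using j by (simp add: disp_def root_sum_single root_sum_const)
qed

lemma disp_type_label: "valid_type t \<Longrightarrow> disp (type_label t) = shift t"
  by (cases t) (simp_all add: disp_e disp_add)

lemma Chat_iff:
  assumes "in_J f"
  shows "(disp f, Fst i) \<in> Chat \<longleftrightarrow> i \<le> l \<and> \<not> in_J (f + e i)"
    and "(disp f, Snd j) \<in> Chat \<longleftrightarrow> j \<le> l' \<and> \<not> in_J (f + e' j)"
    and "(disp f, Diag i j) \<notin> Chat"
proof -
  have f: "Poly_Mapping.keys f \<subseteq> V" using assms by (rule in_J_keys)
  have Fst: "(disp f, Fst i) \<in> arcs Qhat \<longleftrightarrow> i \<le> l" and Snd: "(disp f, Snd j) \<in> arcs Qhat \<longleftrightarrow> j \<le> l'"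
    by (auto simp: Qhat_def disp_in_LL)
  have Chat: "(disp f, t) \<in> Chat \<longleftrightarrow> (disp f, t) \<in> arcs Qhat \<and> deg f \<otimes>\<^bsub>H\<^esub> deg (type_label t) \<notin> J" for t
    by (simp add: Chat_def rep_disp[OF assms])
  show "(disp f, Fst i) \<in> Chat \<longleftrightarrow> i \<le> l \<and> \<not> in_J (f + e i)"
  proof (cases "i \<le> l")
    case True
    then show ?thesis
      by (simp add: Chat Fst deg_mult[OF f keys_e(1)] deg_in_J_iff[OF keys_closed(1)[OF f keys_e(1)]])
  qed (simp add: Chat Fst)
  show "(disp f, Snd j) \<in> Chat \<longleftrightarrow> j \<le> l' \<and> \<not> in_J (f + e' j)"
  proof (cases "j \<le> l'")
    case True
    then show ?thesis
      by (simp add: Chat Snd deg_mult[OF f keys_e(2)] deg_in_J_iff[OF keys_closed(1)[OF f keys_e(2)]])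
  qed (simp add: Chat Snd)
  show "(disp f, Diag i j) \<notin> Chat" by (auto simp: Chat Qhat_def)
qed

lemma arcs_QhatC_iff:
  assumes "in_J f"
  shows "(disp f, Fst i) \<in> arcs QhatC \<longleftrightarrow> i \<le> l \<and> in_J (f + e i)"
    and "(disp f, Snd j) \<in> arcs QhatC \<longleftrightarrow> j \<le> l' \<and> in_J (f + e' j)"
    and "(disp f, Diag i j) \<in> arcs QhatC \<longleftrightarrow> i \<le> l \<and> j \<le> l' \<and> \<not> in_J (f + e i) \<and> \<not> in_J (f + e' j)"
proof -
  have "(x, t) \<in> arcs QhatC \<longleftrightarrow> (x, t) \<in> arcs Qhat \<and> (x, t) \<notin> Chat \<or>
      (\<exists>i j. t = Diag i j \<and> (x, Fst i) \<in> Chat \<and> (x, Snd j) \<in> Chat)" for x t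
    by (cases x) (auto simp: QhatC_def)
  moreover have "(disp f, Fst i) \<in> arcs Qhat \<longleftrightarrow> i \<le> l" "(disp f, Snd j) \<in> arcs Qhat \<longleftrightarrow> j \<le> l'"
    "(disp f, Diag i j) \<notin> arcs Qhat"
    by (auto simp: Qhat_def disp_in_LL)
  ultimately show "(disp f, Fst i) \<in> arcs QhatC \<longleftrightarrow> i \<le> l \<and> in_J (f + e i)"
    "(disp f, Snd j) \<in> arcs QhatC \<longleftrightarrow> j \<le> l' \<and> in_J (f + e' j)"
    "(disp f, Diag i j) \<in> arcs QhatC \<longleftrightarrow> i \<le> l \<and> j \<le> l' \<and> \<not> in_J (f + e i) \<and> \<not> in_J (f + e' j)"
    by (auto simp: Chat_iff[OF assms])
qed

lemma QhatC_simps [simp]: "verts QhatC = LL" "tail QhatC = fst" "head QhatC a = fst a + shift (snd a)"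
  by (simp_all add: QhatC_def Qhat_def split_beta)

text \<open>An unprimed step goes up and stays in \<open>I\<close>, so it can leave \<open>J\<close>
  only through the top.\<close>

lemma not_in_J_add_e:
  assumes "in_J f" "i \<le> l" "\<not> in_J (f + e i)"
  shows "in_I (f + e i - sF)"
proof -
  have "in_I (f + e i)"
    by (rule in_I_mono[of f]) (use assms in \<open>simp_all add: in_J_def keys_closed lookup_add\<close>)
  then show ?thesis using assms by (simp add: in_J_def keys_closed)
qed

text \<open>Dually, a primed step goes down: \<open>f + e' j - sF\<close> remains outside
  \<open>I\<close> because \<open>f - sF\<close> is, so \<open>J\<close> can be left only through
  the bottom.\<close>

lemma not_in_J_add_e':
  assumes "in_J f" "j \<le> l'" "\<not> in_J (f + e' j)"
  shows "\<not> in_I (f + e' j)"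
proof
  assume "in_I (f + e' j)"
  moreover have "\<not> in_I (f + e' j - sF)"
  proof
    assume "in_I (f + e' j - sF)"
    then have "in_I (f - sF)"
      by (rule in_I_mono) (use assms in \<open>simp_all add: in_J_def keys_closed lookup_add lookup_minus\<close>)
    then show False using assms(1) by (simp add: in_J_def)
  qed
  ultimately show False using assms by (simp add: in_J_def keys_closed)
qed

lemma arc_in_J:
  assumes f: "in_J f" and a: "(disp f, t) \<in> arcs QhatC"
  shows "in_J (f + type_label t)" "disp (f + type_label t) = disp f + shift t" "valid_type t"
proof -
  show t: "valid_type t" using a by (cases t) (auto simp: arcs_QhatC_iff[OF f])
  show "disp (f + type_label t) = disp f + shift t"
    using t by (simp add: disp_add disp_type_label)
  show "in_J (f + type_label t)"
  proof (cases t)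
    case (Diag i j)
    with a have ij: "i \<le> l" "j \<le> l'" "\<not> in_J (f + e i)" "\<not> in_J (f + e' j)"
      by (simp_all add: arcs_QhatC_iff[OF f])
    note up = not_in_J_add_e[OF f ij(1,3)] and low = not_in_J_add_e'[OF f ij(2,4)]
    have keys: "Poly_Mapping.keys (f + (e i + e' j)) \<subseteq> V"
      by (intro keys_closed in_J_keys[OF f] keys_e ij)
    \<comment> \<open>Subtracting \<open>pF\<close> does not change the class in \<open>H\<close>.
      The result agrees with \<open>f + e i - sF\<close> on unprimed coordinates and is at most as
      large on primed ones, so it lies above it.\<close>
    have "in_I (f + (e i + e' j) + frag_cmul (- 1) pF)"
      by (rule in_I_mono[OF up])
        (use ij keys f keys_pF in \<open>simp_all add: in_J_def keys_closed lookup_add lookup_minus\<close>)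
    then have "in_I (f + (e i + e' j))" using in_I_add_relH[OF cmul_pF_in_relH] by blast
    moreover have "\<not> in_I (f + (e i + e' j) - sF)"
    proof
      assume "in_I (f + (e i + e' j) - sF)"
      then have "in_I (f + e' j)"
        by (rule in_I_mono) (use ij keys f in \<open>simp_all add: in_J_def keys_closed lookup_add lookup_minus\<close>)
      then show False using low by blast
    qed
    ultimately show ?thesis using keys by (simp add: Diag in_J_def)
  qed (use a in \<open>simp_all add: arcs_QhatC_iff[OF f]\<close>)
qed


section \<open>Paths and their labels\<close>

definition lab :: "arrow list \<Rightarrow> (int ^ 'n \<Rightarrow>\<^sub>0 int)" where
  "lab p = sum_list (map (\<lambda>a. type_label (snd a)) p)"

lemma lab_simps [simp]: "lab [] = 0" "lab (a # p) = type_label (snd a) + lab p" "lab (p @ q) = lab p + lab q"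
  by (simp_all add: lab_def)

text \<open>Every arrow contributes at least 1, so this bounds the length of a path by its label and
  serves as the measure when arrows are split off.\<close>

definition total :: "(int ^ 'n \<Rightarrow>\<^sub>0 int) \<Rightarrow> int" where
  "total f = (\<Sum>w\<in>V. Poly_Mapping.lookup f w)"

lemma total_add: "total (f + g) = total f + total g"
  by (simp add: total_def lookup_add sum.distrib)

lemma total_diff: "total (f - g) = total f - total g"
  by (simp add: total_def lookup_minus sum_subtractf)

lemma total_e: "i \<le> l \<Longrightarrow> total (e i) = 1" "j \<le> l' \<Longrightarrow> total (e' j) = 1"
  using finite_V by (simp_all add: total_def e_def e'_def)

lemma total_type_label: "valid_type t \<Longrightarrow> total (type_label t) \<ge> 1"
  by (cases t) (simp_all add: total_e total_add)

lemma lookup_type_label_nonneg: "Poly_Mapping.lookup (type_label t) w \<ge> 0"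
  by (cases t) (simp_all add: e_def e'_def lookup_add)

lemma arc_tail_in_LL: "(x, t) \<in> arcs QhatC \<Longrightarrow> x \<in> LL"
  by (auto simp: QhatC_def Chat_def Qhat_def)

lemma arc_E:
  assumes "a \<in> arcs QhatC"
  obtains f t where "a = (disp f, t)" "in_J f"
proof -
  obtain x t where a: "a = (x, t)" by (cases a)
  obtain f where "in_J f" "disp f = x" by (rule ex_in_J_disp[OF arc_tail_in_LL]) (use assms a in auto)
  then show thesis using that a by blast
qed

lemma wf_QhatC: "wf_digraph QhatC"
proof
  fix a assume a: "a \<in> arcs QhatC"
  then obtain f t where f: "a = (disp f, t)" "in_J f" by (rule arc_E)
  show "tail QhatC a \<in> verts QhatC" by (simp add: f(1) disp_in_LL)
  have "head QhatC a = disp (f + type_label t)" using arc_in_J[OF f(2)] a f(1) by simp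
  then show "head QhatC a \<in> verts QhatC" by (simp add: disp_in_LL)
qed

sublocale Qhat: wf_digraph QhatC by (rule wf_QhatC)

lemma awalk_in_J:
  assumes "in_J f" "Qhat.awalk (disp f) p y"
  shows "in_J (f + lab p) \<and> disp (f + lab p) = y"
  using assms
proof (induct p arbitrary: f)
  case Nil
  then show ?case by (simp add: Qhat.awalk_Nil_iff)
next
  case (Cons a p)
  obtain t where a: "a = (disp f, t)" "(disp f, t) \<in> arcs QhatC"
    using Cons.prems(2) by (cases a) (auto simp: Qhat.awalk_Cons_iff)
  note step = arc_in_J[OF Cons.prems(1) a(2)]
  have "Qhat.awalk (disp (f + type_label t)) p y"
    using Cons.prems(2) step(2) by (simp add: Qhat.awalk_Cons_iff a(1))
  from Cons.hyps[OF step(1) this] show ?case by (simp add: a(1) add.assoc)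
qed

lemma awalk_disp:
  assumes "Qhat.awalk x p y"
  shows "y = x + disp (lab p)"
proof -
  obtain f where "in_J f" "disp f = x" by (rule ex_in_J_disp[of x]) (use assms in auto)
  then show ?thesis using awalk_in_J[of f p y] assms by (simp add: disp_add)
qed

lemma lab_nonneg: "Poly_Mapping.lookup (lab p) w \<ge> 0"
  by (induct p) (simp_all add: lookup_add lookup_type_label_nonneg)

lemma arc_valid_type: "a \<in> arcs QhatC \<Longrightarrow> valid_type (snd a)"
  using arc_in_J(3) by (metis arc_E snd_conv)

lemma length_le_total_lab: "set p \<subseteq> arcs QhatC \<Longrightarrow> int (length p) \<le> total (lab p)"
proof (induct p)
  case (Cons a p)
  then show ?case using total_type_label[OF arc_valid_type, of a] by (simp add: total_add)
qed (simp add: total_def)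

lemma ex_lookup_pos:
  fixes g :: "int ^ 'n \<Rightarrow>\<^sub>0 int"
  assumes "Poly_Mapping.keys g \<subseteq> V" "\<And>w. Poly_Mapping.lookup g w \<ge> 0" "g \<noteq> 0"
  shows "(\<exists>i\<le>l. Poly_Mapping.lookup g (v i) > 0) \<or> (\<exists>j\<le>l'. Poly_Mapping.lookup g (v' j) > 0)"
proof (rule ccontr)
  assume *: "\<not> ?thesis"
  have "g = 0"
  proof (rule F_eqI)
    show "Poly_Mapping.lookup g (v i) = Poly_Mapping.lookup 0 (v i)" if "i \<le> l" for i
      unfolding lookup_zero using * that assms(2)[of "v i"] by (metis less_le)
    show "Poly_Mapping.lookup g (v' j) = Poly_Mapping.lookup 0 (v' j)" if "j \<le> l'" for j
      unfolding lookup_zero using * that assms(2)[of "v' j"] by (metis less_le)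
  qed (simp_all add: assms(1))
  then show False using assms(3) by blast
qed

text \<open>
  If \<open>g\<close> has only unprimed labels left and all of them leave \<open>J\<close>, then \<open>f + g - sF\<close> already lies
  in \<open>I\<close>; dually for primed labels. Otherwise a diagonal arrow is available.
\<close>

lemma ex_arc:
  assumes f: "in_J f" and g: "Poly_Mapping.keys g \<subseteq> V" "\<And>w. Poly_Mapping.lookup g w \<ge> 0"
    and fg: "in_J (f + g)" and "g \<noteq> 0"
  shows "\<exists>t. (disp f, t) \<in> arcs QhatC \<and> (\<forall>w. Poly_Mapping.lookup (type_label t) w \<le> Poly_Mapping.lookup g w)"
proof -
  have e_le: "Poly_Mapping.lookup (e i) w \<le> Poly_Mapping.lookup g w" if "Poly_Mapping.lookup g (v i) > 0" for i w
    using that g(2)[of w] by (auto simp: e_def)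
  have e'_le: "Poly_Mapping.lookup (e' j) w \<le> Poly_Mapping.lookup g w" if "Poly_Mapping.lookup g (v' j) > 0" for j w
    using that g(2)[of w] by (auto simp: e'_def)
  have keys: "Poly_Mapping.keys (f + g) \<subseteq> V" "Poly_Mapping.keys f \<subseteq> V"
    using fg f by (simp_all add: in_J_keys)
  consider (Fst) i where "i \<le> l" "Poly_Mapping.lookup g (v i) > 0" "in_J (f + e i)"
    | (Snd) j where "j \<le> l'" "Poly_Mapping.lookup g (v' j) > 0" "in_J (f + e' j)"
    | (Diag) i j where "i \<le> l" "Poly_Mapping.lookup g (v i) > 0" "\<not> in_J (f + e i)"
        "j \<le> l'" "Poly_Mapping.lookup g (v' j) > 0" "\<not> in_J (f + e' j)"
    | (only_Fst) i where "i \<le> l" "\<not> in_J (f + e i)" "Poly_Mapping.lookup g (v i) > 0"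
        "\<forall>j\<le>l'. Poly_Mapping.lookup g (v' j) = 0"
    | (only_Snd) j where "j \<le> l'" "\<not> in_J (f + e' j)" "Poly_Mapping.lookup g (v' j) > 0"
        "\<forall>i\<le>l. Poly_Mapping.lookup g (v i) = 0"
    using ex_lookup_pos[OF g \<open>g \<noteq> 0\<close>] g(2) by (metis less_le)
  then show ?thesis
  proof cases
    case (Fst i)
    then show ?thesis by (intro exI[of _ "Fst i"]) (simp add: arcs_QhatC_iff[OF f] e_le)
  next
    case (Snd j)
    then show ?thesis by (intro exI[of _ "Snd j"]) (simp add: arcs_QhatC_iff[OF f] e'_le)
  next
    case (Diag i j)
    have "Poly_Mapping.lookup (e i + e' j) w \<le> Poly_Mapping.lookup g w" for w
      using Diag(1,2,4,5) g(2)[of w] by (auto simp: lookup_add e_def e'_def)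
    with Diag show ?thesis by (intro exI[of _ "Diag i j"]) (simp add: arcs_QhatC_iff[OF f])
  next
    case (only_Fst i)
    have "in_I (f + e i - sF)" using not_in_J_add_e[OF f] only_Fst by blast
    then have "in_I (f + g - sF)"
    proof (rule in_I_mono)
      show "Poly_Mapping.lookup (f + e i - sF) (v k) \<le> Poly_Mapping.lookup (f + g - sF) (v k)" for k
        using e_le[OF only_Fst(3), of "v k"] by (simp add: lookup_add lookup_minus)
    qed (use only_Fst keys in \<open>simp_all add: lookup_add lookup_minus keys_closed\<close>)
    then show ?thesis using fg by (simp add: in_J_def)
  next
    case (only_Snd j)
    have "in_I (f + g)" using fg by (simp add: in_J_def)
    then have "in_I (f + e' j)"
      by (rule in_I_mono) (use only_Snd g(2) keys in \<open>auto simp: lookup_add keys_closed e'_le\<close>)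
    then show ?thesis using not_in_J_add_e'[OF f] only_Snd by blast
  qed
qed

text \<open>The path is built greedily: while the remaining label is nonzero, \<open>ex_arc\<close>
  supplies an arrow whose label fits below it and whose target lifts to \<open>J\<close>, and
  \<open>total\<close> drops.\<close>

lemma ex_awalk:
  assumes "in_J f" "Poly_Mapping.keys g \<subseteq> V" "\<And>w. Poly_Mapping.lookup g w \<ge> 0" "in_J (f + g)"
  shows "\<exists>p. Qhat.awalk (disp f) p (disp (f + g)) \<and> lab p = g"
  using assms
proof (induct "nat (total g)" arbitrary: f g rule: less_induct)
  case less
  show ?case
  proof (cases "g = 0")
    case True
    then show ?thesis by (intro exI[of _ "[]"]) (simp add: Qhat.awalk_Nil_iff disp_in_LL)
  next
    case False
    obtain t where t: "(disp f, t) \<in> arcs QhatC"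
      and le: "Poly_Mapping.lookup (type_label t) w \<le> Poly_Mapping.lookup g w" for w
      using ex_arc[OF less.prems(1-4) False] by blast
    note step = arc_in_J[OF less.prems(1) t]
    have "total (type_label t) \<le> total g" unfolding total_def by (intro sum_mono le)
    then have "nat (total (g - type_label t)) < nat (total g)"
      using total_type_label[OF step(3)] by (simp add: total_diff)
    moreover have "Poly_Mapping.keys (g - type_label t) \<subseteq> V"
      by (intro keys_closed less.prems keys_type_label step)
    moreover have "f + type_label t + (g - type_label t) = f + g" by simp
    ultimately obtain p where "Qhat.awalk (disp (f + type_label t)) p (disp (f + g))" "lab p = g - type_label t"
      using less.hyps[of "g - type_label t" "f + type_label t"] step(1) less.prems(4) le
      by (auto simp: lookup_minus)
    then have "Qhat.awalk (disp f) ((disp f, t) # p) (disp (f + g)) \<and> lab ((disp f, t) # p) = g"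
      using t step(2) by (simp add: Qhat.awalk_Cons_iff)
    then show ?thesis by blast
  qed
qed

text \<open>The difference of two lifts may have negative coordinates. Adding a large multiple of
  \<open>pF\<close> removes them and affects neither \<open>J\<close> nor the displacement.\<close>

lemma ex_awalk_between:
  assumes "x \<in> LL" "y \<in> LL"
  obtains p where "Qhat.awalk x p y"
proof -
  obtain f where f: "in_J f" "disp f = x" by (rule ex_in_J_disp[OF assms(1)])
  obtain g where g: "in_J g" "disp g = y" by (rule ex_in_J_disp[OF assms(2)])
  obtain n :: nat where n: "\<bar>Poly_Mapping.lookup g w - Poly_Mapping.lookup f w\<bar> \<le> int n" for w
    using lookup_diff_bounded[OF in_J_keys[OF g(1)] in_J_keys[OF f(1)]] by blast
  let ?h = "g + frag_cmul (int n) pF - f"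
  have keys: "Poly_Mapping.keys ?h \<subseteq> V"
    by (intro keys_closed in_J_keys f g keys_cmul_sF)
  have "Poly_Mapping.lookup ?h w \<ge> 0" for w
  proof (cases "w \<in> V")
    case True
    then show ?thesis using n[of w] by (simp add: lookup_add lookup_minus lookup_pF)
  next
    case False
    then have "w \<notin> Poly_Mapping.keys ?h" using keys by blast
    then have "Poly_Mapping.lookup ?h w = 0" unfolding in_keys_iff by blast
    then show ?thesis by (simp only: order_refl)
  qed
  moreover have "f + ?h = g + frag_cmul (int n) pF" by simp
  ultimately obtain p where "Qhat.awalk x p (disp (g + frag_cmul (int n) pF))"
    using ex_awalk[OF f(1) keys] in_J_add_relH[OF cmul_pF_in_relH] g(1) f(2) by metis
  then show thesis using that by (simp add: disp_pF g(2))
qed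

text \<open>Elements of \<open>relH\<close> preserve \<open>J\<close>, so a nonnegative one is the
  label of a path. It becomes a cycle in \<open>Q\<close>, where translation by
  \<open>disp r\<close> in \<open>B\<close> is trivial.\<close>

lemma ex_loop:
  assumes "x \<in> LL" "r \<in> relH" "\<And>w. Poly_Mapping.lookup r w \<ge> 0"
  obtains p where "Qhat.awalk x p (x + disp r)" "lab p = r"
proof -
  obtain f where f: "in_J f" "disp f = x" by (rule ex_in_J_disp[OF assms(1)])
  obtain p where "Qhat.awalk (disp f) p (disp (f + r))" "lab p = r"
    using ex_awalk[OF f(1) relH_keys[OF assms(2)] assms(3)] in_J_add_relH[OF assms(2)] f(1) by blast
  then show thesis using that f(2) by (simp add: disp_add)
qed

section \<open>Translation by \<open>B\<close> and the covering of \<open>Q\<close> by the infinite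
  quiver\<close>

lemma arcs_translate:
  assumes "a \<in> arcs QhatC" "b \<in> B"
  shows "(fst a + b, snd a) \<in> arcs QhatC"
proof -
  obtain f t where f: "a = (disp f, t)" "in_J f" using assms(1) by (rule arc_E)
  obtain r where r: "r \<in> relH" "b = disp r" using assms(2) by (auto simp: B_eq)
  have fr: "in_J (f + r)" using f(2) in_J_add_relH[OF r(1)] by blast
  have *: "in_J (f + r + g) \<longleftrightarrow> in_J (f + g)" for g
    using in_J_add_relH[OF r(1), of "f + g"] by (simp add: add_ac)
  have "(disp (f + r), t) \<in> arcs QhatC"
    using assms(1) by (cases t) (simp_all add: f(1) arcs_QhatC_iff[OF f(2)] arcs_QhatC_iff[OF fr] *)
  then show ?thesis by (simp add: f(1) r(2) disp_add)
qed

lemma arrow_orbit_translate: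
  assumes "b \<in> B"
  shows "arrow_orbit (fst a + b, snd a) = arrow_orbit a"
proof -
  have "(fst a + b + b', snd a) \<in> arrow_orbit a" if "b' \<in> B" for b'
    unfolding arrow_orbit_def using B_add[OF assms that] by (rule rev_image_eqI) (simp add: add.assoc)
  moreover have "(fst a + b', snd a) \<in> arrow_orbit (fst a + b, snd a)" if "b' \<in> B" for b'
    unfolding arrow_orbit_def using B_add[OF B_uminus[OF assms] that]
    by (rule rev_image_eqI) (simp add: add.assoc[symmetric])
  ultimately show ?thesis
    by (auto simp: arrow_orbit_def[of a] arrow_orbit_def[of "(fst a + b, snd a)"])
qed

lemma label_arrow_orbit: "label (arrow_orbit a) = type_label (snd a)"
proof -
  have "(\<lambda>a. type_label (snd a)) ` arrow_orbit a = {type_label (snd a)}"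
    using zero_in_B by (force simp: arrow_orbit_def)
  then show ?thesis by (simp add: label_def)
qed

lemma path_label_map: "path_label (map arrow_orbit p) = lab p"
  by (simp add: path_label_def lab_def label_arrow_orbit comp_def)

lemma Q_simps [simp]: "verts Q = vertex_orbit ` LL" "arcs Q = arrow_orbit ` arcs QhatC"
  by (simp_all add: Q_def)

lemma tail_Q: "tail Q (arrow_orbit a) = vertex_orbit (fst a)"
  by (simp add: Q_def arrow_orbit_def vertex_orbit_def image_image)

lemma head_Q: "head Q (arrow_orbit a) = vertex_orbit (fst a + shift (snd a))"
  by (simp add: Q_def arrow_orbit_def vertex_orbit_def image_image add.assoc add.commute[of "shift _"])

lemma wf_Q: "wf_digraph Q"
proof
  fix a assume "a \<in> arcs Q"
  then obtain a' where a': "a = arrow_orbit a'" "a' \<in> arcs QhatC" by auto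
  show "tail Q a \<in> verts Q" "head Q a \<in> verts Q"
    using Qhat.wellformed[OF a'(2)] by (simp_all add: a'(1) tail_Q head_Q)
qed

sublocale Q: wf_digraph Q by (rule wf_Q)

lemma awalk_project:
  assumes "Qhat.awalk x p y"
  shows "Q.awalk (vertex_orbit x) (map arrow_orbit p) (vertex_orbit y)"
  using assms
proof (induct p arbitrary: x)
  case Nil
  then show ?case by (auto simp: Qhat.awalk_Nil_iff Q.awalk_Nil_iff)
next
  case (Cons a p)
  then show ?case by (simp add: Qhat.awalk_Cons_iff Q.awalk_Cons_iff tail_Q head_Q)
qed

lemma awalk_lift:
  assumes "Q.awalk (vertex_orbit x) p Y" "x \<in> LL"
  shows "\<exists>p' y. Qhat.awalk x p' y \<and> map arrow_orbit p' = p \<and> vertex_orbit y = Y"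
  using assms
proof (induct p arbitrary: x)
  case Nil
  then show ?case by (intro exI[of _ "[]"] exI[of _ x]) (simp add: Qhat.awalk_Nil_iff Q.awalk_Nil_iff)
next
  case (Cons a p)
  then obtain a' where a': "a = arrow_orbit a'" "a' \<in> arcs QhatC"
    and "vertex_orbit (fst a') = vertex_orbit x"
    and p: "Q.awalk (head Q a) p Y"
    by (auto simp: Q.awalk_Cons_iff tail_Q)
  then have b: "x - fst a' \<in> B" by (simp add: vertex_orbit_eq_iff)
  \<comment> \<open>The translate of \<open>a'\<close> that starts at \<open>x\<close>; it
    represents the same arrow of \<open>Q\<close>.\<close>
  let ?a = "(x, snd a')"
  have a: "?a \<in> arcs QhatC" "a = arrow_orbit ?a"
    using arcs_translate[OF a'(2) b] arrow_orbit_translate[OF b, of a'] a'(1) by simp_all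
  have "x + shift (snd a') \<in> LL" using Qhat.wellformed(2)[OF a(1)] by simp
  then obtain p' y where "Qhat.awalk (x + shift (snd a')) p' y" "map arrow_orbit p' = p" "vertex_orbit y = Y"
    using Cons.hyps[of "x + shift (snd a')"] p by (auto simp: a(2) head_Q)
  then have "Qhat.awalk x (?a # p') y \<and> map arrow_orbit (?a # p') = a # p \<and> vertex_orbit y = Y"
    using a by (simp add: Qhat.awalk_Cons_iff)
  then show ?case by (intro exI)
qed

lemma LL_add_B:
  assumes "x \<in> LL" "b \<in> B"
  shows "x + b \<in> LL"
proof -
  obtain f where "x = disp f" using assms(1) by (rule LL_E)
  moreover obtain r where "b = disp r" using assms(2) by (auto simp: B_eq)
  ultimately show ?thesis using disp_in_LL[of "f + r"] by (simp add: disp_add)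
qed

text \<open>Obtained by lifting the projected path at \<open>x + b\<close>. Lifting controls the end
  only up to \<open>B\<close>, but the label, which is unchanged, fixes it.\<close>

lemma awalk_translate:
  assumes "Qhat.awalk x p y" "b \<in> B"
  obtains p' where "Qhat.awalk (x + b) p' (y + b)" "map arrow_orbit p' = map arrow_orbit p"
proof -
  have "x \<in> LL" using assms(1) by auto
  then have xb: "x + b \<in> LL" using assms(2) by (rule LL_add_B)
  have "vertex_orbit (x + b) = vertex_orbit x"
    using vertex_orbit_eq_iff[of x "x + b"] assms(2) by simp
  then obtain p' y' where p': "Qhat.awalk (x + b) p' y'" "map arrow_orbit p' = map arrow_orbit p"
    using awalk_lift[OF _ xb] awalk_project[OF assms(1)] by metis
  have "lab p' = lab p" using p'(2) path_label_map by metis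
  then have "y' = y + b" using awalk_disp[OF p'(1)] awalk_disp[OF assms(1)] by (simp add: algebra_simps)
  then show thesis using that p' by simp
qed


section \<open>The type of a cut\<close>

lemma A_P_eqD:
  assumes "m \<in> M" "m' \<in> M" "A_P m + frag_cmul z pF = A_P m' + frag_cmul z' pF"
  shows "m = m'" "z = z'"
proof -
  have d: "(\<lambda>w. m w - m' w) \<in> M"
    using assms(1,2) by (simp add: M_def Modules.additive_def)
  have const: "m w - m' w = z' - z" if "w \<in> V" for w
    using arg_cong[OF assms(3), of "\<lambda>f. Poly_Mapping.lookup f w"] that
    by (simp add: lookup_add lookup_A_P lookup_pF)
  show "z = z'" using functional_const_on_V(2)[OF d const] by simp
  show "m = m'"
  proof
    show "m w = m' w" for w using functional_const_on_V(1)[OF d const, of w] by simp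
  qed
qed

text \<open>Adding \<open>r\<close> and \<open>r'\<close> to one lift in \<open>J\<close> gives two
  lifts of the same vertex, so no multiple of \<open>sF\<close> can occur in the difference.\<close>

lemma relH_disp_eq:
  assumes "r \<in> relH" "r' \<in> relH" "disp r = disp r'"
  obtains z where "r = r' + frag_cmul z pF"
proof -
  obtain f where f: "in_J f" using ex_in_J[of 0] by auto
  have "disp (f + r) = disp (f + r')" by (simp add: disp_add assms(3))
  then obtain z where "f + r = f + r' + frag_cmul z pF"
    using in_J_disp_eq[of "f + r" "f + r'"] f in_J_add_relH assms(1,2) by metis
  then show thesis using that by (simp add: add.assoc)
qed

lemma eps_simps [simp]:
  "eps C' [] = 0" "eps C' (p @ q) = eps C' p + eps C' q"
  by (simp_all add: eps_def)

context
  fixes C' :: "arrow set set"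
  assumes cut: "is_cut C'"
begin

abbreviation epsh :: "arrow list \<Rightarrow> nat" where
  "epsh p \<equiv> eps C' (map arrow_orbit p)"

text \<open>The expression under \<open>kappa\<close>. It is additive under concatenation and 0 on
  elementary cycles, which makes it depend on the ends of the path only.\<close>

definition reduced_label :: "arrow list \<Rightarrow> (int ^ 'n \<Rightarrow>\<^sub>0 int)" where
  "reduced_label p = lab p - frag_cmul (int (epsh p)) pF"

lemma reduced_label_append: "reduced_label (p @ q) = reduced_label p + reduced_label q"
  by (simp add: reduced_label_def frag_cmul_distrib)

lemma epsh_eq:
  assumes "Qhat.awalk x p y" "Qhat.awalk x q y" "lab p = lab q"
  shows "epsh p = epsh q"
  using cut awalk_project[OF assms(1)] awalk_project[OF assms(2)] assms(3)
  unfolding is_cut_def path_label_map[symmetric] by blast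

lemma epsh_elementary:
  assumes "Qhat.awalk x c x" "lab c = pF"
  shows "epsh c = 1"
proof -
  have "elementary_cycle (map arrow_orbit c)"
    using awalk_project[OF assms(1)] assms(2) unfolding elementary_cycle_def path_label_map by blast
  then show ?thesis using cut unfolding is_cut_def by blast
qed

text \<open>Pads a label by \<open>n\<close> copies of \<open>pF\<close> at the known cost
  \<open>n\<close> in degree. Elementary cycles exist at every vertex because \<open>pF\<close> is a
  nonnegative element of \<open>relH\<close> without displacement.\<close>

lemma ex_iterated_elementary:
  assumes "y \<in> LL"
  shows "\<exists>r. Qhat.awalk y r y \<and> lab r = frag_cmul (int n) pF \<and> epsh r = n"
proof (induct n)
  case 0
  show ?case using assms by (intro exI[of _ "[]"]) (simp add: Qhat.awalk_Nil_iff)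
next
  case (Suc n)
  then obtain r where r: "Qhat.awalk y r y" "lab r = frag_cmul (int n) pF" "epsh r = n" by blast
  have pF: "pF \<in> relH" using cmul_pF_in_relH[of 1] by simp
  have nonneg: "Poly_Mapping.lookup pF w \<ge> 0" for w by (simp add: lookup_pF)
  obtain c where "Qhat.awalk y c (y + disp pF)" "lab c = pF"
    by (rule ex_loop[OF assms pF nonneg])
  moreover have "disp pF = 0" using disp_pF[of 0 1] by simp
  ultimately have c: "Qhat.awalk y c y" "lab c = pF" by simp_all
  then have "Qhat.awalk y (r @ c) y \<and> lab (r @ c) = frag_cmul (int (Suc n)) pF \<and> epsh (r @ c) = Suc n"
    using r epsh_elementary[OF c] by (simp add: frag_cmul_distrib add.commute)
  then show ?case by blast
qed

text \<open>The two labels differ by a multiple of \<open>pF\<close>. Appending elementary cycles to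
  the path with the smaller label makes the labels equal, and then the second cut condition compares
  the degrees.\<close>

lemma reduced_label_eq:
  assumes p: "Qhat.awalk x p y" and q: "Qhat.awalk x q y"
  shows "reduced_label p = reduced_label q"
proof -
  have main: "reduced_label p = reduced_label q"
    if p: "Qhat.awalk x p y" and q: "Qhat.awalk x q y" and eq: "lab p = lab q + frag_cmul (int n) pF" for p q n
  proof -
    have "y \<in> LL" using p by auto
    then obtain r where r: "Qhat.awalk y r y" "lab r = frag_cmul (int n) pF" "epsh r = n"
      using ex_iterated_elementary by blast
    have "Qhat.awalk x (q @ r) y" using q r(1) by (rule Qhat.awalk_appendI)
    then have "epsh p = epsh (q @ r)" by (rule epsh_eq[OF p]) (simp add: eq r(2))
    then have "epsh p = epsh q + n" using r(3) by simp
    then show ?thesis by (simp add: reduced_label_def eq frag_cmul_distrib)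
  qed
  obtain f where f: "in_J f" "disp f = x" by (rule ex_in_J_disp[of x]) (use p in auto)
  have "in_J (f + lab p)" "in_J (f + lab q)" "disp (f + lab p) = disp (f + lab q)"
    using awalk_in_J[OF f(1)] p q f(2) by simp_all
  then obtain z where "f + lab p = f + lab q + frag_cmul z pF" by (rule in_J_disp_eq)
  then have z: "lab p = lab q + frag_cmul z pF" by (simp add: add.assoc)
  show ?thesis
  proof (cases "z \<ge> 0")
    case True
    then show ?thesis using main[OF p q, of "nat z"] z by simp
  next
    case False
    then have "int (nat (- z)) = - z" by simp
    then have "lab q = lab p + frag_cmul (int (nat (- z))) pF"
      unfolding z by (simp only: add.assoc frag_cmul_add_left) simp
    then show ?thesis by (rule main[OF q p, symmetric])
  qed
qed

text \<open>Both ways around the square from \<open>x\<close> to \<open>y + b\<close> have the same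
  reduced label, and the two connecting sides \<open>d\<close> and \<open>d'\<close> are translates,
  so they cancel.\<close>

lemma reduced_label_translate:
  assumes "Qhat.awalk x p (x + b)" "Qhat.awalk y q (y + b)" "b \<in> B"
  shows "reduced_label p = reduced_label q"
proof -
  have "x \<in> LL" "y \<in> LL" using assms(1,2) by auto
  then obtain d where d: "Qhat.awalk x d y" by (rule ex_awalk_between)
  obtain d' where d': "Qhat.awalk (x + b) d' (y + b)" "map arrow_orbit d' = map arrow_orbit d"
    by (rule awalk_translate[OF d assms(3)])
  have "lab d' = lab d" using d'(2) path_label_map by metis
  then have "reduced_label d' = reduced_label d" by (simp add: reduced_label_def d'(2))
  moreover have "reduced_label (p @ d') = reduced_label (d @ q)"
    by (rule reduced_label_eq[OF Qhat.awalk_appendI[OF assms(1) d'(1)] Qhat.awalk_appendI[OF d assms(2)]])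
  ultimately show ?thesis by (simp add: reduced_label_append)
qed

lemma kappa_eq:
  assumes p: "Qhat.awalk x p (x + b)" and b: "b \<in> B"
  shows "kappa C' b = reduced_label p"
  unfolding kappa_def
proof (rule the_equality, goal_cases)
  case 1
  show ?case
  proof (intro exI conjI)
    show "x \<in> LL" using p by auto
    show "Qhat.awalk x p (x + b)" by (rule p)
  qed (simp add: path_label_map reduced_label_def)
next
  case (2 f)
  then obtain y q where "Qhat.awalk y q (y + b)" "f = reduced_label q"
    by (auto simp: path_label_map reduced_label_def)
  then show ?case using reduced_label_translate[OF p _ b] by simp
qed

lemma kappa_path:
  assumes "b \<in> B" "x \<in> LL"
  obtains p where "Qhat.awalk x p (x + b)" "kappa C' b = reduced_label p"
proof -
  obtain p where p: "Qhat.awalk x p (x + b)"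
    by (rule ex_awalk_between[OF assms(2) LL_add_B[OF assms(2,1)]])
  show thesis by (rule that[OF p kappa_eq[OF p assms(1)]])
qed

lemma kappa_add:
  assumes "b \<in> B" "b' \<in> B"
  shows "kappa C' (b + b') = kappa C' b + kappa C' b'"
proof -
  have 0: "0 \<in> LL" using zero_in_B B_subset_LL by blast
  obtain p where p: "Qhat.awalk 0 p (0 + b)" "kappa C' b = reduced_label p"
    by (rule kappa_path[OF assms(1) 0])
  have "b \<in> LL" using assms(1) B_subset_LL by blast
  \<comment> \<open>The base point may be moved to \<open>b\<close>, since the value of
    \<open>kappa\<close> does not depend on it; this makes the two paths composable.\<close>
  then obtain q where q: "Qhat.awalk b q (b + b')" "kappa C' b' = reduced_label q"
    by (rule kappa_path[OF assms(2)])
  have "Qhat.awalk 0 (p @ q) (b + b')"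
    using p(1) q(1) unfolding add_0 by (rule Qhat.awalk_appendI)
  then have "Qhat.awalk 0 (p @ q) (0 + (b + b'))" unfolding add_0 .
  then have "kappa C' (b + b') = reduced_label (p @ q)" by (rule kappa_eq[OF _ B_add[OF assms]])
  then show ?thesis using p(2) q(2) by (simp only: reduced_label_append)
qed

text \<open>\<open>kappa\<close> is a section of \<open>disp\<close> from \<open>relH\<close> onto
  \<open>B\<close>: the path label and any element of \<open>relH\<close> over \<open>b\<close>,
  added to the same lift, reach the same vertex, so they differ by a multiple of
  \<open>pF\<close>.\<close>

lemma kappa_in_relH:
  assumes "b \<in> B"
  shows "kappa C' b \<in> relH" "disp (kappa C' b) = b"
proof -
  obtain f where f: "in_J f" using ex_in_J[of 0] by auto
  obtain p where p: "Qhat.awalk (disp f) p (disp f + b)" "kappa C' b = reduced_label p"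
    by (rule kappa_path[OF assms disp_in_LL])
  obtain r where r: "r \<in> relH" "b = disp r" using assms by (auto simp: B_eq)
  have "in_J (f + lab p)" "disp (f + lab p) = disp (f + r)" "in_J (f + r)"
    using awalk_in_J[OF f p(1)] f in_J_add_relH[OF r(1)] r(2) by (simp_all add: disp_add)
  then obtain z where "f + lab p = f + r + frag_cmul z pF" using in_J_disp_eq by blast
  then have "lab p = r + frag_cmul z pF" by (simp add: add.assoc)
  then show "kappa C' b \<in> relH"
    unfolding p(2) reduced_label_def by (simp only: relH_diff relH_add r(1) cmul_pF_in_relH)
  have "disp (reduced_label p) = disp (lab p)"
    using disp_pF[of 0 "int (epsh p)"] by (simp add: reduced_label_def disp_diff)
  then show "disp (kappa C' b) = b"
    using awalk_disp[OF p(1)] p(2) by simp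
qed

text \<open>The correction by which the section \<open>kappa\<close> differs from
  \<open>A_P\<close>. It is additive in \<open>m\<close>, and the type of the cut is the vector that
  represents its negative.\<close>

definition shift_coeff :: "(int ^ 'n \<Rightarrow> int) \<Rightarrow> int" where
  "shift_coeff m = (THE z. kappa C' (disp (A_P m)) = A_P m + frag_cmul z pF)"

lemma A_P_in_relH: "m \<in> M \<Longrightarrow> A_P m \<in> relH"
  using relHI[of m 0] by simp

lemma shift_coeff:
  assumes "m \<in> M"
  shows "kappa C' (disp (A_P m)) = A_P m + frag_cmul (shift_coeff m) pF"
  unfolding shift_coeff_def
proof (rule theI')
  have b: "disp (A_P m) \<in> B" using A_P_in_relH[OF assms] by (auto simp: B_eq)
  obtain z where z: "kappa C' (disp (A_P m)) = A_P m + frag_cmul z pF"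
    by (rule relH_disp_eq[OF kappa_in_relH(1)[OF b] A_P_in_relH[OF assms] kappa_in_relH(2)[OF b]])
  show "\<exists>!z. kappa C' (disp (A_P m)) = A_P m + frag_cmul z pF"
  proof (rule ex1I[of _ z])
    show "z' = z" if "kappa C' (disp (A_P m)) = A_P m + frag_cmul z' pF" for z'
      by (rule A_P_eqD(2)[OF assms assms trans[OF that[symmetric] z]])
  qed (rule z)
qed

lemma shift_coeff_eq:
  assumes "m \<in> M" "kappa C' (disp (A_P m)) = A_P m + frag_cmul z pF"
  shows "shift_coeff m = z"
  by (rule A_P_eqD(2)[OF assms(1,1) trans[OF shift_coeff[OF assms(1), symmetric] assms(2)]])

lemma kappa_image: "kappa C' ` B = {A_P m + frag_cmul (shift_coeff m) pF | m. m \<in> M}"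
proof (intro equalityI subsetI)
  fix f assume "f \<in> kappa C' ` B"
  then obtain m z where m: "m \<in> M" "f = kappa C' (disp (A_P m + frag_cmul z pF))"
    by (auto simp: B_eq relH_def)
  then have "f = A_P m + frag_cmul (shift_coeff m) pF" using shift_coeff[OF m(1)] by (simp add: disp_pF)
  then show "f \<in> {A_P m + frag_cmul (shift_coeff m) pF | m. m \<in> M}" using m(1) by blast
next
  fix f assume "f \<in> {A_P m + frag_cmul (shift_coeff m) pF | m. m \<in> M}"
  then obtain m where m: "m \<in> M" "f = kappa C' (disp (A_P m))" using shift_coeff by auto
  then show "f \<in> kappa C' ` B" using A_P_in_relH[OF m(1)] by (auto simp: B_eq)
qed

lemma shift_coeff_add:
  assumes "m \<in> M" "m' \<in> M"
  shows "shift_coeff (\<lambda>w. m w + m' w) = shift_coeff m + shift_coeff m'"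
proof (rule shift_coeff_eq)
  show "(\<lambda>w. m w + m' w) \<in> M" using assms by (simp add: M_def Modules.additive_def)
  have eq: "A_P (\<lambda>w. m w + m' w) = A_P m + A_P m'"
    by (rule poly_mapping_eqI) (simp add: lookup_A_P lookup_add)
  have "disp (A_P m) \<in> B" "disp (A_P m') \<in> B"
    using A_P_in_relH assms by (auto simp: B_eq)
  then show "kappa C' (disp (A_P (\<lambda>w. m w + m' w)))
    = A_P (\<lambda>w. m w + m' w) + frag_cmul (shift_coeff m + shift_coeff m') pF"
    using shift_coeff[OF assms(1)] shift_coeff[OF assms(2)]
    by (simp add: eq disp_add kappa_add frag_cmul_distrib)
qed

definition linear_form :: "int ^ 'n \<Rightarrow> int ^ 'n \<Rightarrow> int" where
  "linear_form a w = (\<Sum>i\<in>UNIV. a $ i * w $ i)"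

lemma linear_form_in_M: "linear_form a \<in> M"
  by (simp add: M_def linear_form_def Modules.additive_def distrib_left sum.distrib)

lemma M_eq_linear_form:
  assumes "m \<in> M"
  shows "m = linear_form (\<chi> i. m (axis i 1))"
proof
  show "m w = linear_form (\<chi> i. m (axis i 1)) w" for w
    using assms additive_eq_sum[of m w] by (simp add: M_def linear_form_def)
qed

text \<open>A lattice is its own double dual: an additive function on \<open>M\<close> is evaluation
  at the vector of its values on the coordinate functionals. The sign matches the one in
  \<open>cut_type\<close>.\<close>

lemma shift_coeff_eq_eval:
  obtains u where "\<And>m. m \<in> M \<Longrightarrow> shift_coeff m = - m u"
proof
  define \<phi> where "\<phi> = (\<lambda>a. shift_coeff (linear_form a))"
  have add: "Modules.additive \<phi>"
  proof (unfold Modules.additive_def, intro allI)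
    fix a b
    have "linear_form (a + b) = (\<lambda>w. linear_form a w + linear_form b w)"
      by (rule ext) (simp add: linear_form_def distrib_right sum.distrib)
    then show "\<phi> (a + b) = \<phi> a + \<phi> b"
      by (simp add: \<phi>_def shift_coeff_add linear_form_in_M)
  qed
  let ?u = "\<chi> i. - \<phi> (axis i 1)"
  fix m assume m: "m \<in> M"
  have "shift_coeff m = \<phi> (\<chi> i. m (axis i 1))"
    unfolding \<phi>_def using M_eq_linear_form[OF m] by (rule arg_cong)
  also have "\<dots> = (\<Sum>i\<in>UNIV. \<phi> (axis i 1) * m (axis i 1))"
    by (subst additive_eq_sum[OF add]) simp
  also have "\<dots> = - m ?u"
    using m additive_eq_sum[of m ?u] by (simp add: M_def sum_negf mult.commute)
  finally show "shift_coeff m = - m ?u" .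
qed

text \<open>Justifies the definite description of the type. For uniqueness, equality of the images
  yields only some matching \<open>m\<close>; \<open>A_P_eqD\<close> forces it to be the chosen
  coordinate functional, and then all coordinates of \<open>u\<close> and \<open>u'\<close>
  agree.\<close>

lemma kappa_image_cut_type:
  "kappa C' ` B = {A_P m - frag_cmul (m (cut_type C')) pF | m. m \<in> M}"
  unfolding cut_type_def
proof (rule theI')
  obtain u where u: "\<And>m. m \<in> M \<Longrightarrow> shift_coeff m = - m u" using shift_coeff_eq_eval by blast
  have *: "A_P m + frag_cmul (shift_coeff m) pF = A_P m - frag_cmul (m u) pF" if "m \<in> M" for m
    unfolding u[OF that] by (simp only: minus_frag_cmul[symmetric] add_uminus_conv_diff)
  have image: "kappa C' ` B = {A_P m - frag_cmul (m u) pF | m. m \<in> M}"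
    unfolding kappa_image by (intro Collect_cong iff_exI) (use * in fastforce)
  have unique: "u' = u" if u': "kappa C' ` B = {A_P m - frag_cmul (m u') pF | m. m \<in> M}" for u'
  proof -
    have "linear_form (axis i 1) u' = linear_form (axis i 1) u" for i
    proof -
      let ?m = "linear_form (axis i 1)"
      have "A_P ?m - frag_cmul (?m u') pF \<in> kappa C' ` B"
        unfolding u' by (intro CollectI exI[of _ ?m] conjI linear_form_in_M refl)
      then obtain m where m: "A_P ?m - frag_cmul (?m u') pF = A_P m - frag_cmul (m u) pF" "m \<in> M"
        unfolding image by (elim CollectE exE conjE)
      have eq: "A_P ?m + frag_cmul (- ?m u') pF = A_P m + frag_cmul (- m u) pF"
        using m(1) by (simp only: minus_frag_cmul[symmetric] add_uminus_conv_diff)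
      have "?m = m" "- ?m u' = - m u" using A_P_eqD[OF linear_form_in_M m(2) eq] .
      then show ?thesis by simp
    qed
    moreover have "linear_form (axis i 1) w = w $ i" for i w
    proof -
      have "axis i 1 $ j * w $ j = (if j = i then w $ j else 0)" for j by (simp add: axis_def)
      then show ?thesis by (simp add: linear_form_def)
    qed
    ultimately show "u' = u" by (simp add: vec_eq_iff)
  qed
  show "\<exists>!u. kappa C' ` B = {A_P m - frag_cmul (m u) pF | m. m \<in> M}"
    by (rule ex1I[of _ u]) (rule image, rule unique)
qed

end


section \<open>Finiteness of the quiver\<close>

lemma relH_int_cmul: "r \<in> relH \<Longrightarrow> frag_cmul z r \<in> relH"
proof (cases z)
  case (neg n)
  assume "r \<in> relH"
  then have "- frag_cmul (int (Suc n)) r \<in> relH" by (intro relH_uminus relH_cmul)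
  then show ?thesis using neg by simp
qed (simp add: relH_cmul)

lemma proj_deg_hom: "\<pi> \<in> hom H integer_group"
  using proj_epi by (simp add: epi_def)

lemma proj_deg_add:
  assumes "Poly_Mapping.keys f \<subseteq> V" "Poly_Mapping.keys g \<subseteq> V"
  shows "\<pi> (deg (f + g)) = \<pi> (deg f) + \<pi> (deg g)"
  using hom_mult[OF proj_deg_hom, of "deg f" "deg g"] assms
  by (simp add: deg_mult[symmetric] carrier_H integer_group_def)

lemma proj_deg_cmul:
  assumes "Poly_Mapping.keys f \<subseteq> V"
  shows "\<pi> (deg (frag_cmul n f)) = n * \<pi> (deg f)"
proof -
  have "\<pi> (deg f [^]\<^bsub>H\<^esub> n) = \<pi> (deg f) [^]\<^bsub>integer_group\<^esub> n"
    using assms by (intro hom_int_pow proj_deg_hom group_H) (simp_all add: carrier_H)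
  then show ?thesis using assms by (simp add: deg_int_pow group_int_pow_integer_group)
qed

lemma proj_deg_sF: "\<pi> (deg sF) > 0"
proof -
  have "\<pi> (deg (\<Sum>i\<in>T. e i)) = (\<Sum>i\<in>T. \<pi> (deg (e i))) \<and> Poly_Mapping.keys (\<Sum>i\<in>T. e i) \<subseteq> V"
    if "finite T" "T \<subseteq> {..l}" for T
    using that
  proof (induct T)
    case empty
    show ?case using proj_deg_cmul[of 0 0] by simp
  next
    case (insert i T)
    then show ?case by (simp add: proj_deg_add keys_closed)
  qed
  then have "\<pi> (deg sF) = (\<Sum>i\<le>l. \<pi> (deg (e i)))" by (simp add: sF_def)
  moreover have "(\<Sum>i\<le>l. \<pi> (deg (e i))) > 0"
    using proj_pos by (intro sum_pos) (simp_all add: e_def)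
  ultimately show ?thesis by simp
qed

text \<open>Uses that \<open>H\<close> has rank one. Cross-multiplying \<open>frag_of w\<close> and
  \<open>sF\<close> with their values under \<open>\<pi>\<close> gives a class in the kernel of
  \<open>\<pi>\<close>, hence a torsion class, so a multiple lies in \<open>relH\<close>; its
  \<open>sF\<close> part does not move vertices.\<close>

lemma ex_multiple_in_B:
  assumes "w \<in> V"
  shows "\<exists>R::nat. R > 0 \<and> (\<forall>z. disp (frag_cmul (z * int R) (frag_of w)) \<in> B)"
proof -
  let ?x = "frag_cmul (\<pi> (deg sF)) (frag_of w) + frag_cmul (- \<pi> (deg (frag_of w))) sF"
  have w: "Poly_Mapping.keys (frag_of w) \<subseteq> V" using assms by simp
  then have w': "Poly_Mapping.keys (frag_cmul z (frag_of w)) \<subseteq> V" for z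
    by (rule order_trans[OF keys_cmul])
  have x: "Poly_Mapping.keys ?x \<subseteq> V" by (intro keys_closed w' keys_cmul_sF)
  have "\<pi> (deg ?x) = 0"
    using proj_deg_add[OF w' keys_cmul_sF(1)] proj_deg_cmul[OF w] proj_deg_cmul[OF keys_sF] by simp
  moreover have "deg ?x \<in> carrier H" unfolding carrier_H using x by (intro imageI) simp
  ultimately have "deg ?x \<in> kernel H integer_group \<pi>" by (simp add: kernel_def)
  then obtain r :: nat where r: "r > 0" "deg ?x [^]\<^bsub>H\<^esub> r = \<one>\<^bsub>H\<^esub>"
    unfolding proj_kernel by blast
  have "deg ?x [^]\<^bsub>H\<^esub> int r = \<one>\<^bsub>H\<^esub>" using r(2) by (simp add: int_pow_int)
  moreover have "\<one>\<^bsub>H\<^esub> = deg 0" by (simp add: H_def FactGroup_def deg_eq)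
  ultimately have "deg (frag_cmul (int r) ?x) = deg 0" using deg_int_pow[OF x] by simp
  then have rel: "frag_cmul (int r) ?x \<in> relH" by (simp add: deg_eq_iff)
  define R where "R = r * nat (\<pi> (deg sF))"
  have "disp (frag_cmul (z * int R) (frag_of w)) \<in> B" for z
  proof -
    have "frag_cmul z (frag_cmul (int r) ?x) = frag_cmul (z * int R) (frag_of w)
        + frag_cmul (- z * int r * \<pi> (deg (frag_of w))) sF"
      using proj_deg_sF by (simp add: R_def frag_cmul_distrib2 mult.assoc)
    then have "disp (frag_cmul z (frag_cmul (int r) ?x)) = disp (frag_cmul (z * int R) (frag_of w))"
      by (simp only: disp_sF)
    then show ?thesis unfolding B_eq using relH_int_cmul[OF rel] by (metis imageI)
  qed
  moreover have "R > 0" using r(1) proj_deg_sF by (simp add: R_def)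
  ultimately show ?thesis by blast
qed

lemma disp_sum_in_B:
  assumes "\<And>w. w \<in> T \<Longrightarrow> disp (f w) \<in> B"
  shows "disp (\<Sum>w\<in>T. f w) \<in> B"
  using assms
  by (induct T rule: infinite_finite_induct) (simp_all add: zero_in_B disp_add B_add)

text \<open>Reducing each coordinate of a label vector modulo the period \<open>R w\<close> changes
  the displacement by an element of \<open>B\<close>, so the finite box of remainders meets every
  orbit.\<close>

lemma finite_orbit_representatives:
  obtains X where "finite X" "X \<subseteq> LL" "\<And>x. x \<in> LL \<Longrightarrow> \<exists>x0\<in>X. x0 - x \<in> B"
proof -
  obtain R :: "int ^ 'n \<Rightarrow> nat" where R: "\<And>w. w \<in> V \<Longrightarrow> R w > 0"
      "\<And>w z. w \<in> V \<Longrightarrow> disp (frag_cmul (z * int (R w)) (frag_of w)) \<in> B"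
    using ex_multiple_in_B by metis
  define comb where "comb = (\<lambda>h. \<Sum>w\<in>V. frag_cmul (h w :: int) (frag_of w))"
  define X where "X = (\<lambda>h. disp (comb h)) ` (\<Pi>\<^sub>E w\<in>V. {0..<int (R w)})"
  show thesis
  proof
    show "finite X" unfolding X_def by (intro finite_imageI finite_PiE finite_V) simp
    show "X \<subseteq> LL" using disp_in_LL by (auto simp: X_def)
    fix x assume "x \<in> LL"
    then obtain f where f: "Poly_Mapping.keys f \<subseteq> V" "x = disp f" by (rule LL_E)
    have comb: "comb (Poly_Mapping.lookup f) = f"
    proof (rule poly_mapping_eqI)
      fix w
      have "Poly_Mapping.lookup (comb (Poly_Mapping.lookup f)) w
          = (\<Sum>w'\<in>V. if w' = w then Poly_Mapping.lookup f w' else 0)"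
        unfolding comb_def lookup_sum by (intro sum.cong) auto
      also have "\<dots> = Poly_Mapping.lookup f w"
        using f(1) finite_V by (auto simp: in_keys_iff)
      finally show "Poly_Mapping.lookup (comb (Poly_Mapping.lookup f)) w = Poly_Mapping.lookup f w" .
    qed
    let ?h = "restrict (\<lambda>w. Poly_Mapping.lookup f w mod int (R w)) V"
    have "comb ?h - comb (Poly_Mapping.lookup f)
        = (\<Sum>w\<in>V. frag_cmul (- (Poly_Mapping.lookup f w div int (R w)) * int (R w)) (frag_of w))"
      unfolding comb_def sum_subtractf[symmetric]
    proof (rule sum.cong[OF refl])
      fix w assume "w \<in> V"
      then have "?h w - Poly_Mapping.lookup f w = - (Poly_Mapping.lookup f w div int (R w)) * int (R w)"
        using minus_mult_div_eq_mod[of "Poly_Mapping.lookup f w" "int (R w)"] by (simp add: mult.commute)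
      then show "frag_cmul (?h w) (frag_of w) - frag_cmul (Poly_Mapping.lookup f w) (frag_of w)
          = frag_cmul (- (Poly_Mapping.lookup f w div int (R w)) * int (R w)) (frag_of w)"
        by (simp only: frag_cmul_diff_distrib[symmetric])
    qed
    then have "disp (comb ?h - f) \<in> B"
      using R(2) by (simp only: comb) (intro disp_sum_in_B, blast)
    then have "disp (comb ?h) - x \<in> B" by (simp add: disp_diff f(2))
    moreover have "?h \<in> (\<Pi>\<^sub>E w\<in>V. {0..<int (R w)})" using R(1) by auto
    ultimately show "\<exists>x0\<in>X. x0 - x \<in> B" unfolding X_def by blast
  qed
qed

lemma finite_valid_types: "finite {t. valid_type t}"
proof (rule finite_subset)
  show "{t. valid_type t} \<subseteq> Fst ` {..l} \<union> Snd ` {..l'} \<union> (\<lambda>(i, j). Diag i j) ` ({..l} \<times> {..l'})"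
  proof
    fix t assume "t \<in> {t. valid_type t}"
    then show "t \<in> Fst ` {..l} \<union> Snd ` {..l'} \<union> (\<lambda>(i, j). Diag i j) ` ({..l} \<times> {..l'})"
      by (cases t) auto
  qed
qed simp

lemma fin_digraph_Q: "fin_digraph Q"
proof
  obtain X where X: "finite X" "X \<subseteq> LL" "\<And>x. x \<in> LL \<Longrightarrow> \<exists>x0\<in>X. x0 - x \<in> B"
    using finite_orbit_representatives by blast
  have "vertex_orbit ` LL \<subseteq> vertex_orbit ` X"
  proof
    fix z assume "z \<in> vertex_orbit ` LL"
    then obtain x where "x \<in> LL" "z = vertex_orbit x" by blast
    then obtain x0 where "x0 \<in> X" "x0 - x \<in> B" using X(3) by blast
    then have "z = vertex_orbit x0" using vertex_orbit_eq_iff \<open>z = vertex_orbit x\<close> by simp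
    then show "z \<in> vertex_orbit ` X" using \<open>x0 \<in> X\<close> by (rule image_eqI)
  qed
  then show "finite (verts Q)" using X(1) finite_surj by simp
  have "arrow_orbit ` arcs QhatC \<subseteq> arrow_orbit ` (X \<times> {t. valid_type t})"
  proof
    fix z assume "z \<in> arrow_orbit ` arcs QhatC"
    then obtain a where a: "a \<in> arcs QhatC" "z = arrow_orbit a" by blast
    have "fst a \<in> LL" using Qhat.wellformed(1)[OF a(1)] by simp
    then obtain x0 where x0: "x0 \<in> X" "x0 - fst a \<in> B" using X(3) by blast
    have "z = arrow_orbit (x0, snd a)" using arrow_orbit_translate[OF x0(2), of a] a(2) by simp
    then show "z \<in> arrow_orbit ` (X \<times> {t. valid_type t})"
      by (rule image_eqI) (simp add: x0(1) arc_valid_type a(1))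
  qed
  then show "finite (arcs Q)"
    using X(1) finite_valid_types by (simp add: finite_subset)
qed

sublocale Q: fin_digraph Q by (rule fin_digraph_Q)


section \<open>Acyclicity and dimension\<close>

lemma path_label_append: "path_label (p @ q) = path_label p + path_label q"
  by (simp add: path_label_def)

lemma cas_degree_zero: "pre_digraph.cas (degree_zero_quiver C') x p y \<longleftrightarrow> Q.cas x p y"
  by (induct p arbitrary: x) (simp_all add: pre_digraph.cas.simps degree_zero_quiver_def)

lemma awalk_degree_zero:
  "pre_digraph.awalk (degree_zero_quiver C') x p y \<longleftrightarrow> Q.awalk x p y \<and> eps C' p = 0"
  unfolding pre_digraph.awalk_def cas_degree_zero
  by (auto simp: degree_zero_quiver_def eps_def filter_empty_conv)

lemma degree_zero_cycle_trivial:
  assumes cut: "is_cut C'" and u: "real_vec (cut_type C') \<in> interior P"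
    and c: "Q.awalk X c X" "eps C' c = 0"
  shows "c = []"
proof -
  obtain x where x: "x \<in> LL" "X = vertex_orbit x"
    using Q.awalk_hd_in_verts[OF c(1)] unfolding Q_simps by (rule imageE)
  then obtain p y where p: "Qhat.awalk x p y" "map arrow_orbit p = c" "vertex_orbit y = vertex_orbit x"
    using awalk_lift[OF c(1)[unfolded x(2)] x(1)] unfolding x(2) by blast
  have b: "y - x \<in> B" using p(3)[symmetric] unfolding vertex_orbit_eq_iff .
  have "Qhat.awalk x p (x + (y - x))" using p(1) by simp
  then have "kappa C' (y - x) = reduced_label C' p" by (rule kappa_eq[OF cut _ b])
  then have "kappa C' (y - x) = lab p" using c(2) by (simp add: reduced_label_def[OF cut] p(2))
  then have "lab p \<in> kappa C' ` B" using b by (intro image_eqI[of _ _ "y - x"]) simp_all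
  then obtain m where m: "lab p = A_P m - frag_cmul (m (cut_type C')) pF" "m \<in> M"
    unfolding kappa_image_cut_type[OF cut] by (elim CollectE exE conjE)
  have lookup: "Poly_Mapping.lookup (lab p) w = m w - m (cut_type C')" if "w \<in> V" for w
    using that by (simp add: m(1) lookup_minus lookup_A_P lookup_pF)
  have ge: "m w \<ge> m (cut_type C')" if "w \<in> V" for w
    using lookup[OF that] lab_nonneg[of p w] by simp
  have "m w = 0" for w by (rule functional_min_interior[OF m(2) u ge])
  \<comment> \<open>Every arrow adds at least 1 to \<open>total\<close>, so a path with zero label
    has no arrows.\<close>
  then have "total (lab p) = 0" by (simp add: total_def lookup)
  moreover have "set p \<subseteq> arcs QhatC" using p(1) by (simp add: Qhat.awalk_def)
  ultimately have "p = []" using length_le_total_lab[of p] by simp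
  then show ?thesis using p(2) by simp
qed

lemma acyclic_degree_zero:
  assumes "is_cut C'" "real_vec (cut_type C') \<in> interior P"
  shows "acyclic_quiver (degree_zero_quiver C')"
  unfolding acyclic_quiver_def awalk_degree_zero using degree_zero_cycle_trivial[OF assms] by blast

text \<open>A walk that repeats a vertex contains a closed walk. Without these every walk visits
  distinct vertices, and a finite quiver has only finitely many such walks.\<close>

lemma finite_degree_zero_paths:
  assumes "acyclic_quiver (degree_zero_quiver C')"
  shows "finite (paths (degree_zero_quiver C'))"
proof -
  interpret D: fin_digraph "degree_zero_quiver C'"
    by unfold_locales (simp_all add: degree_zero_quiver_def Q.wellformed Q.finite_arcs Q.finite_verts del: Q_simps)
  have apath: "D.apath x p y" if walk: "D.awalk x p y" for x p y
  proof (rule ccontr)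
    assume "\<not> D.apath x p y"
    then have "\<not> distinct (D.awalk_verts x p)" using walk by (simp add: D.apath_def)
    then obtain r where "D.closed_w r" using D.awalk_cyc_decompE'[OF walk] by blast
    then obtain z where "D.awalk z r z" "r \<noteq> []" unfolding D.closed_w_def by blast
    then show False using assms unfolding acyclic_quiver_def by blast
  qed
  have "paths (degree_zero_quiver C') \<subseteq> (\<lambda>(x, p, y). (x, p)) ` {(x, p, y). D.apath x p y}"
  proof (intro subsetI)
    fix z assume "z \<in> paths (degree_zero_quiver C')"
    then obtain x p y where z: "z = (x, p)" "D.awalk x p y" unfolding paths_def by blast
    show "z \<in> (\<lambda>(x, p, y). (x, p)) ` {(x, p, y). D.apath x p y}"
      by (rule image_eqI[of _ _ "(x, p, y)"]) (simp_all add: z(1) apath[OF z(2)])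
  qed
  then show ?thesis by (rule finite_surj[OF D.apaths_finite_triple])
qed

section \<open>The ideal of relations and the dimension of \<open>A\<close>\<close>

lemma scalars_eq: "scalars k = range (\<lambda>c. rel_ideal k +>\<^bsub>path_algebra k Q\<^esub> path_scalar Q c)"
  by (auto simp: scalars_def path_scalar_def)

lemma relations_closed: "relations (k :: 'k::field itself) \<subseteq> carrier (path_algebra k Q)"
proof
  fix f :: "(vertex set \<times> arrow set list) \<Rightarrow>\<^sub>0 'k" assume "f \<in> relations k"
  then obtain x y p q where f: "f = Poly_Mapping.single (x, p) 1 - Poly_Mapping.single (x, q) 1"
      "Q.awalk x p y" "Q.awalk x q y"
    by (auto simp: relations_def)
  have "Poly_Mapping.keys f \<subseteq> paths Q"
    using f(2,3) by (auto simp: f(1) paths_def in_keys_iff lookup_minus lookup_single when_def split: if_splits)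
  then show "f \<in> carrier (path_algebra k Q)" by simp
qed

lemma rel_ideal_ideal: "ideal (rel_ideal k) (path_algebra k Q)"
  unfolding rel_ideal_def
  by (rule ring.genideal_ideal[OF Q.path_algebra_ring[OF Q.finite_verts] relations_closed])

lemma path_coeff_rel_ideal:
  assumes "f \<in> rel_ideal (k :: 'k::field itself)"
  shows "path_coeff Q path_label x y c f = 0"
proof -
  let ?K = "{f :: (vertex set \<times> arrow set list) \<Rightarrow>\<^sub>0 'k.
    Poly_Mapping.keys f \<subseteq> paths Q \<and> (\<forall>x y c. path_coeff Q path_label x y c f = 0)}"
  have "relations k \<subseteq> ?K"
  proof
    fix f assume f: "f \<in> relations k"
    then obtain x y p q where "f = Poly_Mapping.single (x, p) 1 - Poly_Mapping.single (x, q) 1"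
        "Q.awalk x p y" "Q.awalk x q y" "path_label p = path_label q"
      by (auto simp: relations_def)
    then have "path_coeff Q path_label x y c f = 0" for x y c
      by (auto simp: path_coeff_diff path_coeff_single)
    moreover have "f \<in> carrier (path_algebra k Q)" using relations_closed f by (rule subsetD)
    ultimately show "f \<in> ?K" by simp
  qed
  then have "rel_ideal k \<subseteq> ?K"
    unfolding rel_ideal_def
    by (rule ring.genideal_minimal[OF Q.path_algebra_ring[OF Q.finite_verts]
        Q.ideal_path_coeff_eq_0[OF Q.finite_verts path_label_append]])
  then show ?thesis using assms by blast
qed

text \<open>The functional for ends at the orbit of 0 and label 0 takes the value 1 on the identity,
  to which exactly one trivial path contributes, but vanishes on the ideal.\<close>

lemma one_notin_rel_ideal: "path_scalar Q 1 \<notin> rel_ideal (k :: 'k::field itself)"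
proof
  let ?x = "vertex_orbit 0"
  have x: "?x \<in> verts Q" using zero_in_B B_subset_LL by auto
  have sum: "path_coeff Q path_label ?x ?x 0 (\<Sum>y\<in>T. Poly_Mapping.single (y, []) 1)
      = (\<Sum>y\<in>T. if y = ?x then 1 else (0::'k))" for T
    by (induct T rule: infinite_finite_induct) 
      (simp_all add: path_coeff_add path_coeff_single path_label_def del: sum.delta sum.delta')
  assume "path_scalar Q 1 \<in> rel_ideal k"
  then have "(\<Sum>y\<in>verts Q. if y = ?x then 1 else (0::'k)) = 0"
    unfolding sum[symmetric] path_scalar_def[symmetric] by (rule path_coeff_rel_ideal)
  then show False using x Q.finite_verts by (simp del: Q_simps)
qed

text \<open>Brings \<open>A\<close> into the form of the general dimension results: the classes of
  all combinations of the paths of one subquiver.\<close>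

lemma A_eq: "A (k :: 'k::field itself) C' = (\<lambda>f. rel_ideal k +>\<^bsub>path_algebra k Q\<^esub> f) `
    {f. Poly_Mapping.keys f \<subseteq> paths (degree_zero_quiver C')}"
proof -
  have paths: "a \<in> paths (degree_zero_quiver C') \<longleftrightarrow> a \<in> paths Q \<and> eps C' (snd a) = 0" for a
    by (cases a) (simp add: paths_def awalk_degree_zero)
  have "f \<in> carrier (path_algebra k Q) \<and> (\<forall>(x, p) \<in> Poly_Mapping.keys f. eps C' p = 0) \<longleftrightarrow>
      Poly_Mapping.keys f \<subseteq> paths (degree_zero_quiver C')" for f :: "(vertex set \<times> arrow set list) \<Rightarrow>\<^sub>0 'k"
    unfolding path_algebra_simps subset_iff paths split_beta by blast
  then show ?thesis unfolding A_def by blast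
qed

lemma finite_dimensional_if_interior:
  assumes "is_cut C'" "real_vec (cut_type C') \<in> interior P"
  shows "A_finite_dimensional k C'"
  unfolding A_finite_dimensional_def Gamma_def scalars_eq A_eq
proof (rule Q.finite_dimension_cls_paths[OF Q.finite_verts rel_ideal_ideal one_notin_rel_ideal])
  show "finite (paths (degree_zero_quiver C'))"
    by (rule finite_degree_zero_paths[OF acyclic_degree_zero[OF assms]])
  show "paths (degree_zero_quiver C') \<subseteq> paths Q" by (auto simp: paths_def awalk_degree_zero)
qed

lemma degree_zero_cycle:
  assumes cut: "is_cut C'" and u: "real_vec (cut_type C') \<notin> interior P"
  obtains X c where "Q.awalk X c X" "eps C' c = 0" "path_label c \<noteq> 0"
proof -
  obtain m where m: "m \<in> M" "\<And>w. w \<in> V \<Longrightarrow> m w \<ge> m (cut_type C')" "\<exists>w. m w \<noteq> 0"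
    using supporting_functional[OF u] by blast
  define f where "f = A_P m - frag_cmul (m (cut_type C')) pF"
  have f: "Poly_Mapping.lookup f w = (if w \<in> V then m w - m (cut_type C') else 0)" for w
    by (simp add: f_def lookup_minus lookup_A_P lookup_pF)
  have "f \<noteq> 0"
  proof
    assume "f = 0"
    then have "m w = m (cut_type C')" if "w \<in> V" for w using f[of w] that by simp
    then show False using functional_const_on_V(1)[OF m(1)] m(3) by blast
  qed
  have "f \<in> kappa C' ` B" using kappa_image_cut_type[OF cut] m(1) f_def by blast
  then obtain b where b: "b \<in> B" "f = kappa C' b" by blast
  have rel: "f \<in> relH" and disp: "disp f = b" using kappa_in_relH[OF cut b(1)] b(2) by simp_all
  have "0 \<in> LL" using zero_in_B B_subset_LL by blast
  moreover have "Poly_Mapping.lookup f w \<ge> 0" for w using m(2) by (simp add: f)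
  ultimately obtain p where p: "Qhat.awalk 0 p (0 + disp f)" "lab p = f" using ex_loop rel by metis
  have "Qhat.awalk 0 p (0 + b)" using p(1) disp by simp
  then have "kappa C' b = reduced_label C' p" by (rule kappa_eq[OF cut _ b(1)])
  \<comment> \<open>Both \<open>kappa C' b\<close> and \<open>lab p\<close> equal \<open>f\<close>,
    so their difference, the degree times \<open>pF\<close>, is 0; as \<open>pF\<close> is nonzero
    the degree vanishes.\<close>
  then have "frag_cmul (int (eps C' (map arrow_orbit p))) pF = 0"
    using b(2) p(2) by (simp add: reduced_label_def[OF cut])
  moreover have "pF \<noteq> 0" by (metis lookup_pF_v(1) lookup_zero zero_neq_one le0)
  ultimately have "eps C' (map arrow_orbit p) = 0" by simp
  moreover have "vertex_orbit (0 + disp f) = vertex_orbit 0"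
    using vertex_orbit_eq_iff[of 0 b] b(1) disp by simp
  moreover have "path_label (map arrow_orbit p) \<noteq> 0" using \<open>f \<noteq> 0\<close> p(2) path_label_map by simp
  ultimately show thesis using that[of "vertex_orbit 0"] awalk_project[OF p(1)] by simp
qed

lemma infinite_dimensional_if_not_interior:
  assumes cut: "is_cut C'" and u: "real_vec (cut_type C') \<notin> interior P"
  shows "\<not> A_finite_dimensional k C'"
proof -
  obtain X c where c: "Q.awalk X c X" "eps C' c = 0" "path_label c \<noteq> 0"
    by (rule degree_zero_cycle[OF assms])
  define pow where "pow = (\<lambda>n. concat (replicate n c))"
  have pow: "Q.awalk X (pow n) X \<and> eps C' (pow n) = 0 \<and> path_label (pow n) = frag_cmul (int n) (path_label c)" for n
  proof (induct n)
    case 0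
    then show ?case using c(1) by (auto simp: pow_def Q.awalk_Nil_iff path_label_def)
  next
    case (Suc n)
    have eq: "pow (Suc n) = c @ pow n" by (simp add: pow_def)
    have "Q.awalk X (c @ pow n) X" by (rule Q.awalk_appendI[OF c(1) conjunct1[OF Suc]])
    moreover have "path_label (c @ pow n) = frag_cmul (int (Suc n)) (path_label c)"
      using Suc by (simp add: path_label_append frag_cmul_distrib)
    ultimately show ?case unfolding eq using Suc c(2) by (intro conjI) simp_all
  qed
  \<comment> \<open>The labels are the multiples of a nonzero element of a torsion-free group, so
    they are pairwise different.\<close>
  have inj: "n = n'" if "path_label (pow n) = path_label (pow n')" for n n'
  proof -
    have "frag_cmul (int n - int n') (path_label c) = 0"
      using that pow by (simp add: frag_cmul_diff_distrib)
    then show ?thesis using c(3) by simp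
  qed
  let ?S = "range (\<lambda>n. (X, pow n))"
  have in_D: "?S \<subseteq> paths (degree_zero_quiver C')"
    using pow by (auto simp: paths_def awalk_degree_zero)
  show ?thesis
    unfolding A_finite_dimensional_def Gamma_def scalars_eq
  proof (rule Q.infinite_dimension_cls_paths[OF Q.finite_verts rel_ideal_ideal one_notin_rel_ideal,
        where lab = path_label and S = ?S])
    show "path_coeff Q path_label x y d f = 0" if "f \<in> rel_ideal k" for f x y d
      by (rule path_coeff_rel_ideal[OF that])
    have "inj (\<lambda>n. (X, pow n))" using inj by (auto intro!: injI)
    then show "infinite ?S" by (rule range_inj_infinite)
    show "?S \<subseteq> paths Q" using pow by (auto simp: paths_def)
    show "inj_on (\<lambda>a. (fst a, Q.awlast (fst a) (snd a), path_label (snd a))) ?S"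
      using inj by (auto simp: inj_on_def)
    show "rel_ideal k +>\<^bsub>path_algebra k Q\<^esub> Poly_Mapping.single a 1 \<in> A k C'" if "a \<in> ?S" for a
      unfolding A_eq using that in_D by (intro imageI) auto
  qed
qed

end

theorem proposition4p20:
  fixes k :: "'k::field itself"
    and P :: "(real ^ 'n) set"
    and l l' :: nat
    and v v' :: "nat \<Rightarrow> int ^ 'n"
    and \<pi> :: "(int ^ 'n \<Rightarrow>\<^sub>0 int) set \<Rightarrow> int"
    and I :: "(int ^ 'n \<Rightarrow>\<^sub>0 int) set set"
    and C' :: "arrow set set"
    and u :: "int ^ 'n"
  assumes "upper_set P l l' v v' \<pi> I"
    and "upper_set.is_cut P l l' v v' I C'"
    and "u = upper_set.cut_type P l l' v v' I C'"
  shows "(real_vec u \<in> interior P \<longrightarrow>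
            acyclic_quiver (upper_set.degree_zero_quiver P l l' v v' I C') \<and>
            upper_set.A_finite_dimensional P l l' v v' I k C') \<and>
         (real_vec u \<notin> interior P \<longrightarrow>
            \<not> upper_set.A_finite_dimensional P l l' v v' I k C')"
proof -
  interpret upper_set P l l' v v' \<pi> I by (rule assms(1))
  show ?thesis
    using acyclic_degree_zero[OF assms(2)] finite_dimensional_if_interior[OF assms(2), of k]
      infinite_dimensional_if_not_interior[OF assms(2), of k] assms(3) by blast
qed

end
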